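(* Let $G$ be a finite group and let $\tau$ be an arbitrary transfer system of $G$. There exists an intersection $\mathbb E_\infty$-operad $\mathscr{D}\mathscr{E}$, namely the dyadic Barratt–Eccles operad $\mathscr{D}\mathscr{E}=\mathcal R^{\{1\}}(\mathscr{WD})$, such that $\underline{\mathrm N}_e^{\tau}\mathscr{D}\mathscr{E}=\mathcal R^{\tau}(\mathscr{WD})$ is an $\mathbb N_\infty$-operad that realizes the transfer system $\tau$.
   Context: $G$ is a finite group; spaces are compactly generated weak Hausdorff; $\underline n=\{1,\dots,n\}$, $\underline 0=\emptyset$. Operads are symmetric operads with left $\Sigma_n$-actions; a $G$-operad is an operad in $G$-spaces, so its $n$-th level has a left $G\times\Sigma_n$-action. An intersection monoid $(M,\wedge)$ is a (topological) monoid $M$ with a symmetric reflexive relation $\wedge$ such that for all elements: (1) if $x_1y_1\wedge x_2y_2$ then $x_1\wedge x_2$; (2) if $xy_1\wedge xy_2$ then $y_1\wedge y_2$. Write $\vee$ for the complement of $\wedge$ ("disjoint"). For a monoid $M$, the $G$-operad $\mathcal O^G(M)$ has $\mathcal O^G(M)(n)=\mathrm{Map}(G\times\underline n,M)$ (a point for $n=0$), action $((g,\sigma)\cdot x)(k,i)=x(g^{-1}k,\sigma^{-1}i)$, unit the constant map $1$ on $G\times\underline 1$, and for $x$ of arity $n$, $y$ of arity $m$, $i\in\underline n$: $(x\circ_i y)(g,k)=x(g,i)\,y(g,k-i+1)$ if $i\le k\le i+m-1$, $=x(g,k)$ if $k<i$, and $=x(g,k-m+1)$ if $k>i+m-1$.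 For an intersection monoid $M$, the suboperad $\mathcal R^G(M)$ consists of those $x\in \mathcal O^G(M)(n)$ that are $\Sigma$-disjoint ($x(g,i)\vee x(g,j)$ for all $g\in G$, $i\ne j$) and have strict columns (for all $i\in\underline n$, $g_1,g_2\in G$, either $x(g_1,i)=x(g_2,i)$ or $x(g_1,i)\vee x(g_2,i)$). An intersection operad is an operad of the form $\mathcal R^{\{1\}}(M)$ for an intersection monoid $M$ ($G$ replaced by the trivial group). A transfer system $\tau$ of $G$ is a partial order $\to_\tau$ on the subgroups of $G$ refining inclusion, closed under conjugation ($K\to_\tau H$ implies $K^g\to_\tau H^g$ for all $g\in G$) and under restriction ($K\to_\tau H$ and $H'\le H$ imply $K\cap H'\to_\tau H'$). A twist map for $G\times\underline n$ is a map $\alpha:S\to\underline n$ with $S\subseteq G$ such that $Sg_0$ is a subgroup of $G$ for some $g_0\in G$. It structures a transfer $K\to H$ at position $i\in\mathrm{im}(\alpha)$ if there is $g_0\in G$ with $Sg_0=H$ and $K$ is a subgroup contained in $\alpha^{-1}(i)g_0$, maximal among the subgroups contained in $\alpha^{-1}(i)g_0$. An element $x\in\mathcal R^G(M)(n)$ supports a transfer $K\to H$ if there is a twist map $\alpha$ structuring $K\to H$ at some position with $x(g_1,\alpha(g_1))\wedge x(g_2,\alpha(g_2))$ for all $g_1,g_2$ in the domain of $\alpha$. Define $\mathcal R^\tau(M)(n)=\{x\in\mathcal R^G(M)(n) : \text{if } x \text{ supports a transfer } K\to H \text{ then } K\to_\tau H\}$; this is a $G$-suboperad of $\mathcal R^G(M)$.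 For an intersection operad $P=\mathcal R^{\{1\}}(M)$, the $\tau$-incomplete coinduction is $\underline{\mathrm N}_e^\tau P=\mathcal R^\tau(M)$. The fat dyadic intervals monoid $\mathscr{WD}$. Let $\mathscr D$ be the free monoid on $\{a,b\}$, with words $w,w'\in\mathscr D$ declared disjoint iff there is $k\le\min(\mathrm{len}(w),\mathrm{len}(w'))$ such that their $k$-th letters differ; let $\mathscr D_n=\{a,b\}^n$ be the (discrete) set of words of length $n$. Let $\mathbf{Inj}$ be the category with objects $\underline n$ ($n\ge0$) and morphisms the order-preserving injections. Let $\underline I:\mathbf{Inj}\to\mathrm{Top}$ be $\underline n\mapsto I^n$, $I=[0,1]$, a morphism $\delta:\underline m\to\underline n$ acting by inserting $0$ in the coordinates not in the image of $\delta$; let $\underline{\mathscr D}:\mathbf{Inj}^{op}\to\mathrm{Top}$ be $\underline n\mapsto\mathscr D_n$, $\delta$ acting by $(\ell_1,\dots,\ell_n)\mapsto(\ell_{\delta(1)},\dots,\ell_{\delta(m)})$. Then $\mathscr{WD}=\int^{\underline n\in\mathbf{Inj}}\mathscr D_n\times I^n$, with multiplication $[(\vec\ell;\vec t)][(\vec\ell';\vec t')]=[(\vec\ell,\vec\ell';\vec t,\vec t')]$ given by concatenation and unit the class of the empty word. Every class has a unique reduced representative $(\vec\ell;\vec t)$, i.e. one with all $t_k\neq0$; let $\omega:\mathscr{WD}\to\mathscr D$ send a class to the word $\ell_1\cdots\ell_n$ of its reduced representative. Set $x\wedge y$ in $\mathscr{WD}$ iff $\omega(x)$ and $\omega(y)$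 are not disjoint in $\mathscr D$; this makes $\mathscr{WD}$ an intersection monoid. An $\mathbb E_\infty$-operad is a non-equivariant operad $P$ in spaces such that each $P(n)$ is contractible with free $\Sigma_n$-action. An $\mathbb N_\infty$-operad is an operad $\mathcal O$ in $G$-spaces such that $\mathcal O(0)$ is contractible, $\Sigma_n$ acts freely on $\mathcal O(n)$, and $\mathcal O(n)$ is a universal space for a family $\mathcal F_n(\mathcal O)$ of subgroups of $G\times\Sigma_n$ containing all subgroups $H\times\{1\}$, $H\le G$ (universal: $\mathcal O(n)^\Phi$ is contractible for $\Phi\in\mathcal F_n(\mathcal O)$ and empty otherwise). For $H\le G$ and a finite $H$-set $T$ with $|T|=n$ and a chosen ordering $T\cong\underline n$, let $\Gamma_T=\{(h,\phi_T(h)):h\in H\}\le G\times\Sigma_n$ where $\phi_T:H\to\Sigma_n$ is the action homomorphism. $T$ is admissible for a $G$-operad $Q$ if $Q(n)^{\Gamma_T}\neq\emptyset$. A $G$-operad $Q$ realizes $\tau$ if (i) $\Sigma_n$ acts freely on $Q(n)$ for every $n$; (ii) $Q(2)^{H\times\{\mathrm{id}\}}\ne\emptyset$ for every $H\le G$; and (iii) for all $K\le H\le G$, the $H$-set $H/K$ is admissible for $Q$ if and only if $K\to_\tau H$. *)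

theory Defs
  imports
    "HOL-Analysis.Analysis"
    "HOL-Algebra.Sym_Groups"
    "HOL-Algebra.Group_Action"
    "HOL-Algebra.Elementary_Groups"
begin

section \<open>Compactly generated weak Hausdorff spaces\<close>

text \<open>
  The test spaces of the weak Hausdorff condition may be taken on the type \<open>'a set set\<close>:
  given \<open>u\<close> from an arbitrary compact Hausdorff space \<open>C\<close>, choose one preimage for each point of
  the image; the closure \<open>C'\<close> of the chosen points has at most \<open>2 ^ 2 ^ |'a|\<close> elements and
  \<open>u ` C' = u ` C\<close>.
\<close>

definition weak_Hausdorff_space :: "'a topology \<Rightarrow> bool" where
  "weak_Hausdorff_space X \<longleftrightarrow>
     (\<forall>(C :: 'a set set topology) u.
        compact_space C \<and> Hausdorff_space C \<and> continuous_map C X u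
          \<longrightarrow> closedin X (u ` topspace C))"

text \<open>
  The k-ification, for weak Hausdorff \<open>X\<close>.  There every continuous image of a compact Hausdorff
  space is a closed compact Hausdorff subspace, and a quotient of that space, so testing against
  maps from compact Hausdorff spaces and testing against compact Hausdorff subspaces agree.
\<close>

definition kification :: "'a topology \<Rightarrow> 'a topology" where
  "kification X = topology (\<lambda>U. U \<subseteq> topspace X \<and>
     (\<forall>K. compactin X K \<and> Hausdorff_space (subtopology X K)
            \<longrightarrow> openin (subtopology X K) (K \<inter> U)))"

lemma openin_kification:
  "openin (kification X) U \<longleftrightarrow> U \<subseteq> topspace X \<and>
     (\<forall>K. compactin X K \<and> Hausdorff_space (subtopology X K)
            \<longrightarrow> openin (subtopology X K) (K \<inter> U))"
proof -
  have "istopology (\<lambda>U. U \<subseteq> topspace X \<and>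
     (\<forall>K. compactin X K \<and> Hausdorff_space (subtopology X K)
            \<longrightarrow> openin (subtopology X K) (K \<inter> U)))" (is "istopology ?P")
    unfolding istopology_def
  proof (rule conjI; (rule allI impI)+)
    fix S T assume S: "?P S" and T: "?P T"
    have "openin (subtopology X K) (K \<inter> (S \<inter> T))"
      if "compactin X K \<and> Hausdorff_space (subtopology X K)" for K
    proof -
      have "openin (subtopology X K) (K \<inter> S)" "openin (subtopology X K) (K \<inter> T)"
        using S T that by auto
      then have "openin (subtopology X K) ((K \<inter> S) \<inter> (K \<inter> T))"
        by (rule openin_Int)
      also have "(K \<inter> S) \<inter> (K \<inter> T) = K \<inter> (S \<inter> T)"
        by blast
      finally show ?thesis .
    qed
    moreover have "S \<inter> T \<subseteq> topspace X"
      using S by blast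
    ultimately show "?P (S \<inter> T)"
      by (intro conjI allI impI)
  next
    fix \<K> assume *: "\<forall>U\<in>\<K>. ?P U"
    have "openin (subtopology X K) (\<Union>U\<in>\<K>. K \<inter> U)"
      if "compactin X K \<and> Hausdorff_space (subtopology X K)" for K
      using * that by (intro openin_Union) auto
    then have "openin (subtopology X K) (K \<inter> \<Union>\<K>)"
      if "compactin X K \<and> Hausdorff_space (subtopology X K)" for K
      using that by (simp only: Int_Union)
    moreover have "\<Union>\<K> \<subseteq> topspace X"
      using * by (intro Union_least) blast
    ultimately show "?P (\<Union>\<K>)"
      by (intro conjI allI impI)
  qed
  then show ?thesis
    unfolding kification_def by (simp only: topology_inverse')
qed

lemma topspace_kification [simp]: "topspace (kification X) = topspace X"
proof
  show "topspace (kification X) \<subseteq> topspace X"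
    using openin_kification[of X "topspace (kification X)"] by simp
  have "openin (kification X) (topspace X)"
    by (auto simp: openin_kification openin_subtopology_Int2)
  then show "topspace X \<subseteq> topspace (kification X)"
    by (rule openin_subset)
qed

definition cgwh_space :: "'a topology \<Rightarrow> bool" where
  "cgwh_space X \<longleftrightarrow> kification X = X \<and> weak_Hausdorff_space X"

definition k_prod_topology :: "'a topology \<Rightarrow> 'b topology \<Rightarrow> ('a \<times> 'b) topology" where
  "k_prod_topology X Y = kification (prod_topology X Y)"

definition k_subtopology :: "'a topology \<Rightarrow> 'a set \<Rightarrow> 'a topology" where
  "k_subtopology X S = kification (subtopology X S)"

definition quotient_topology :: "'a topology \<Rightarrow> ('a \<Rightarrow> 'b) \<Rightarrow> 'b topology" where
  "quotient_topology X f =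
     topology (\<lambda>U. U \<subseteq> f ` topspace X \<and> openin X {x \<in> topspace X. f x \<in> U})"

lemma openin_quotient_topology:
  "openin (quotient_topology X f) U \<longleftrightarrow>
     U \<subseteq> f ` topspace X \<and> openin X {x \<in> topspace X. f x \<in> U}"
proof -
  have "istopology (\<lambda>U. U \<subseteq> f ` topspace X \<and> openin X {x \<in> topspace X. f x \<in> U})"
    (is "istopology ?P")
    unfolding istopology_def
  proof (rule conjI; (rule allI impI)+)
    fix S T assume S: "?P S" and T: "?P T"
    have "openin X ({x \<in> topspace X. f x \<in> S} \<inter> {x \<in> topspace X. f x \<in> T})"
      using S T by (intro openin_Int) auto
    also have "{x \<in> topspace X. f x \<in> S} \<inter> {x \<in> topspace X. f x \<in> T} =
        {x \<in> topspace X. f x \<in> S \<inter> T}"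
      by blast
    finally show "?P (S \<inter> T)"
      using S by (intro conjI) blast
  next
    fix \<K> assume *: "\<forall>U\<in>\<K>. ?P U"
    have "{x \<in> topspace X. f x \<in> \<Union>\<K>} = (\<Union>U\<in>\<K>. {x \<in> topspace X. f x \<in> U})"
      by blast
    moreover have "openin X (\<Union>U\<in>\<K>. {x \<in> topspace X. f x \<in> U})"
      using * by (intro openin_Union) auto
    moreover have "\<Union>\<K> \<subseteq> f ` topspace X"
      using * by (intro Union_least) blast
    ultimately show "?P (\<Union>\<K>)"
      by simp
  qed
  then show ?thesis
    unfolding quotient_topology_def by (simp only: topology_inverse')
qed

lemma topspace_quotient_topology [simp]: "topspace (quotient_topology X f) = f ` topspace X"
proof
  show "topspace (quotient_topology X f) \<subseteq> f ` topspace X"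
    using openin_quotient_topology[of X f "topspace (quotient_topology X f)"] by simp
  have "{x \<in> topspace X. f x \<in> f ` topspace X} = topspace X"
    by blast
  then have "openin (quotient_topology X f) (f ` topspace X)"
    by (simp add: openin_quotient_topology)
  then show "f ` topspace X \<subseteq> topspace (quotient_topology X f)"
    by (rule openin_subset)
qed

lemma quotient_map_quotient_topology: "quotient_map X (quotient_topology X f) f"
  by (auto simp: quotient_map_def openin_quotient_topology)

text \<open>The library predicate \<^const>\<open>contractible_space\<close> holds for the empty space.\<close>

definition nonempty_contractible :: "'a topology \<Rightarrow> bool" where
  "nonempty_contractible X \<longleftrightarrow> topspace X \<noteq> {} \<and> contractible_space X"


section \<open>Operads in \<open>G\<close>-spaces\<close>

text \<open>
  \<open>act Q n (g, \<sigma>)\<close> is the action on the \<open>n\<close>-th level, and \<open>pcomp Q n m i x y\<close> is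
  \<open>x \<circ>\<^sub>i y\<close> for \<open>x\<close> of arity \<open>n\<close> and \<open>y\<close> of arity \<open>m\<close>.
\<close>

record ('g, 'x) g_operad_data =
  level :: "nat \<Rightarrow> 'x topology"
  act :: "nat \<Rightarrow> 'g \<times> (nat \<Rightarrow> nat) \<Rightarrow> 'x \<Rightarrow> 'x"
  opunit :: 'x
  pcomp :: "nat \<Rightarrow> nat \<Rightarrow> nat \<Rightarrow> 'x \<Rightarrow> 'x \<Rightarrow> 'x"

text \<open>
  The permutation \<open>\<sigma> \<circ>\<^sub>i \<rho>\<close> of \<open>{1..n+m-1}\<close>: the block \<open>{i..i+m-1}\<close> is carried by \<open>\<rho>\<close> onto the
  block starting at \<open>\<sigma> i\<close>, and the remaining positions are moved as by \<open>\<sigma>\<close>.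
\<close>

definition perm_pcomp ::
  "nat \<Rightarrow> nat \<Rightarrow> nat \<Rightarrow> (nat \<Rightarrow> nat) \<Rightarrow> (nat \<Rightarrow> nat) \<Rightarrow> nat \<Rightarrow> nat" where
  "perm_pcomp n m i \<sigma> \<rho> j =
     (if j \<notin> {1..n + m - 1} then j
      else if i \<le> j \<and> j < i + m then \<sigma> i + \<rho> (j + 1 - i) - 1
      else let k = (if j < i then j else j + 1 - m)
           in if \<sigma> k < \<sigma> i then \<sigma> k else \<sigma> k + m - 1)"

locale g_operad = group G for G (structure) +
  fixes Q :: "('g, 'x) g_operad_data"
  assumes cgwh_level: "cgwh_space (level Q n)"
    and action: "group_action (G \<times>\<times> sym_group n) (topspace (level Q n)) (act Q n)"
    and act_continuous:
      "p \<in> carrier (G \<times>\<times> sym_group n) \<Longrightarrow> continuous_map (level Q n) (level Q n) (act Q n p)"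
    and unit_in: "opunit Q \<in> topspace (level Q 1)"
    and unit_fixed: "g \<in> carrier G \<Longrightarrow> act Q 1 (g, id) (opunit Q) = opunit Q"
    and pcomp_continuous: "i \<in> {1..n} \<Longrightarrow>
      continuous_map (k_prod_topology (level Q n) (level Q m)) (level Q (n + m - 1))
        (\<lambda>(x, y). pcomp Q n m i x y)"
    and pcomp_unit_left: "x \<in> topspace (level Q n) \<Longrightarrow> pcomp Q 1 n 1 (opunit Q) x = x"
    and pcomp_unit_right: "\<lbrakk>x \<in> topspace (level Q n); i \<in> {1..n}\<rbrakk> \<Longrightarrow>
      pcomp Q n 1 i x (opunit Q) = x"
    and pcomp_assoc_seq:
      "\<lbrakk>x \<in> topspace (level Q n); y \<in> topspace (level Q m); z \<in> topspace (level Q l);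
        i \<in> {1..n}; j \<in> {1..m}\<rbrakk> \<Longrightarrow>
       pcomp Q (n + m - 1) l (i + j - 1) (pcomp Q n m i x y) z =
       pcomp Q n (m + l - 1) i x (pcomp Q m l j y z)"
    and pcomp_assoc_par:
      "\<lbrakk>x \<in> topspace (level Q n); y \<in> topspace (level Q m); z \<in> topspace (level Q l);
        i \<in> {1..n}; k \<in> {1..n}; i < k\<rbrakk> \<Longrightarrow>
       pcomp Q (n + m - 1) l (k + m - 1) (pcomp Q n m i x y) z =
       pcomp Q (n + l - 1) m i (pcomp Q n l k x z) y"
    and pcomp_equivariant:
      "\<lbrakk>x \<in> topspace (level Q n); y \<in> topspace (level Q m); i \<in> {1..n}; g \<in> carrier G;
        \<sigma> \<in> carrier (sym_group n); \<rho> \<in> carrier (sym_group m)\<rbrakk> \<Longrightarrow>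
       pcomp Q n m (\<sigma> i) (act Q n (g, \<sigma>) x) (act Q m (g, \<rho>) y) =
       act Q (n + m - 1) (g, perm_pcomp n m i \<sigma> \<rho>) (pcomp Q n m i x y)"

definition sigma_free :: "('g, 'm) monoid_scheme \<Rightarrow> ('g, 'x) g_operad_data \<Rightarrow> nat \<Rightarrow> bool" where
  "sigma_free G Q n \<longleftrightarrow>
     (\<forall>x \<in> topspace (level Q n). \<forall>\<sigma> \<in> carrier (sym_group n).
        act Q n (\<one>\<^bsub>G\<^esub>, \<sigma>) x = x \<longrightarrow> \<sigma> = id)"

definition fixed_points ::
  "('g, 'x) g_operad_data \<Rightarrow> nat \<Rightarrow> ('g \<times> (nat \<Rightarrow> nat)) set \<Rightarrow> 'x set" where
  "fixed_points Q n \<Phi> = {x \<in> topspace (level Q n). \<forall>p \<in> \<Phi>. act Q n p x = x}"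

definition suboperad ::
  "('g, 'x) g_operad_data \<Rightarrow> (nat \<Rightarrow> 'x set) \<Rightarrow> ('g, 'x) g_operad_data" where
  "suboperad Q S =
     \<lparr>level = (\<lambda>n. k_subtopology (level Q n) (S n)),
      act = (\<lambda>n p. restrict (act Q n p) (topspace (level Q n) \<inter> S n)),
      opunit = opunit Q,
      pcomp = pcomp Q\<rparr>"

text \<open>A non-equivariant operad is an operad in \<open>G\<close>-spaces for the trivial group.\<close>

definition E_infty_operad :: "(unit, 'x) g_operad_data \<Rightarrow> bool" where
  "E_infty_operad P \<longleftrightarrow> g_operad (singleton_group ()) P \<and>
     (\<forall>n. nonempty_contractible (level P n) \<and> sigma_free (singleton_group ()) P n)"

definition family_of_subgroups :: "('a, 'm) monoid_scheme \<Rightarrow> 'a set set \<Rightarrow> bool" where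
  "family_of_subgroups G F \<longleftrightarrow>
     (\<forall>H \<in> F. subgroup H G) \<and>
     (\<forall>H \<in> F. \<forall>K. subgroup K G \<and> K \<subseteq> H \<longrightarrow> K \<in> F) \<and>
     (\<forall>H \<in> F. \<forall>g \<in> carrier G. (\<lambda>h. g \<otimes>\<^bsub>G\<^esub> h \<otimes>\<^bsub>G\<^esub> inv\<^bsub>G\<^esub> g) ` H \<in> F)"

definition universal_level ::
  "('g, 'm) monoid_scheme \<Rightarrow> ('g, 'x) g_operad_data \<Rightarrow> nat \<Rightarrow> ('g \<times> (nat \<Rightarrow> nat)) set set \<Rightarrow> bool" where
  "universal_level G Q n F \<longleftrightarrow>
     (\<forall>\<Phi>. subgroup \<Phi> (G \<times>\<times> sym_group n) \<longrightarrow>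
        (if \<Phi> \<in> F then nonempty_contractible (k_subtopology (level Q n) (fixed_points Q n \<Phi>))
         else fixed_points Q n \<Phi> = {}))"

definition N_infty_operad :: "('g, 'm) monoid_scheme \<Rightarrow> ('g, 'x) g_operad_data \<Rightarrow> bool" where
  "N_infty_operad G Q \<longleftrightarrow> g_operad G Q \<and> nonempty_contractible (level Q 0) \<and>
     (\<forall>n. sigma_free G Q n) \<and>
     (\<forall>n. \<exists>F. family_of_subgroups (G \<times>\<times> sym_group n) F \<and>
            (\<forall>H. subgroup H G \<longrightarrow> H \<times> {id} \<in> F) \<and> universal_level G Q n F)"


section \<open>Transfer systems and their realization\<close>

definition transfer_system :: "('g, 'm) monoid_scheme \<Rightarrow> ('g set \<times> 'g set) set \<Rightarrow> bool" where
  "transfer_system G \<tau> \<longleftrightarrow>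
     partial_order_on {H. subgroup H G} \<tau> \<and>
     (\<forall>(K, H) \<in> \<tau>. K \<subseteq> H) \<and>
     (\<forall>(K, H) \<in> \<tau>. \<forall>g \<in> carrier G.
        ((\<lambda>k. inv\<^bsub>G\<^esub> g \<otimes>\<^bsub>G\<^esub> k \<otimes>\<^bsub>G\<^esub> g) ` K, (\<lambda>h. inv\<^bsub>G\<^esub> g \<otimes>\<^bsub>G\<^esub> h \<otimes>\<^bsub>G\<^esub> g) ` H) \<in> \<tau>) \<and>
     (\<forall>(K, H) \<in> \<tau>. \<forall>H'. subgroup H' G \<and> H' \<subseteq> H \<longrightarrow> (K \<inter> H', H') \<in> \<tau>)"

text \<open>
  The graph subgroup \<open>\<Gamma>\<^sub>T\<close> of a finite \<open>H\<close>-set \<open>T\<close> with action \<open>\<phi>\<close>, along the ordering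
  \<open>e\<close> of \<open>T\<close> (a bijection from \<open>{1..card T}\<close>).
\<close>

definition graph_subgroup ::
  "'g set \<Rightarrow> 'a set \<Rightarrow> ('g \<Rightarrow> 'a \<Rightarrow> 'a) \<Rightarrow> (nat \<Rightarrow> 'a) \<Rightarrow> ('g \<times> (nat \<Rightarrow> nat)) set" where
  "graph_subgroup H T \<phi> e =
     (\<lambda>h. (h, \<lambda>i. if i \<in> {1..card T} then inv_into {1..card T} e (\<phi> h (e i)) else i)) ` H"

text \<open>
  Two orderings of \<open>T\<close> give \<open>\<Sigma>\<^sub>n\<close>-conjugate graph subgroups, so the choice is immaterial.
\<close>

definition admissible ::
  "('g, 'x) g_operad_data \<Rightarrow> 'g set \<Rightarrow> 'a set \<Rightarrow> ('g \<Rightarrow> 'a \<Rightarrow> 'a) \<Rightarrow> bool" where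
  "admissible Q H T \<phi> \<longleftrightarrow>
     (\<exists>e. bij_betw e {1..card T} T \<and> fixed_points Q (card T) (graph_subgroup H T \<phi> e) \<noteq> {})"

definition realizes ::
  "('g, 'm) monoid_scheme \<Rightarrow> ('g, 'x) g_operad_data \<Rightarrow> ('g set \<times> 'g set) set \<Rightarrow> bool" where
  "realizes G Q \<tau> \<longleftrightarrow>
     (\<forall>n. sigma_free G Q n) \<and>
     (\<forall>H. subgroup H G \<longrightarrow> fixed_points Q 2 (H \<times> {id}) \<noteq> {}) \<and>
     (\<forall>K H. subgroup K G \<and> subgroup H G \<and> K \<subseteq> H \<longrightarrow>
        (admissible Q H ((\<lambda>h. h <#\<^bsub>G\<^esub> K) ` H) (\<lambda>h C. h <#\<^bsub>G\<^esub> C) \<longleftrightarrow> (K, H) \<in> \<tau>))"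


section \<open>Intersection monoids and the operads built from them\<close>

record 'm top_monoid = "'m monoid" +
  mtop :: "'m topology"
  meets :: "'m \<Rightarrow> 'm \<Rightarrow> bool"

locale intersection_monoid = monoid M for M :: "'m top_monoid" (structure) +
  assumes topspace_mtop: "topspace (mtop M) = carrier M"
    and cgwh_mtop: "cgwh_space (mtop M)"
    and mult_continuous:
      "continuous_map (k_prod_topology (mtop M) (mtop M)) (mtop M) (\<lambda>(x, y). x \<otimes> y)"
    and meets_refl: "x \<in> carrier M \<Longrightarrow> meets M x x"
    and meets_sym: "\<lbrakk>x \<in> carrier M; y \<in> carrier M; meets M x y\<rbrakk> \<Longrightarrow> meets M y x"
    and meets_prefix:
      "\<lbrakk>x1 \<in> carrier M; y1 \<in> carrier M; x2 \<in> carrier M; y2 \<in> carrier M;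
        meets M (x1 \<otimes> y1) (x2 \<otimes> y2)\<rbrakk> \<Longrightarrow> meets M x1 x2"
    and meets_cancel:
      "\<lbrakk>x \<in> carrier M; y1 \<in> carrier M; y2 \<in> carrier M; meets M (x \<otimes> y1) (x \<otimes> y2)\<rbrakk>
        \<Longrightarrow> meets M y1 y2"

definition O_operad ::
  "('g, 'b) monoid_scheme \<Rightarrow> 'm top_monoid \<Rightarrow> ('g, 'g \<times> nat \<Rightarrow> 'm) g_operad_data" where
  "O_operad G M =
     \<lparr>level = (\<lambda>n. kification (product_topology (\<lambda>_. mtop M) (carrier G \<times> {1..n}))),
      act = (\<lambda>n (g, \<sigma>). \<lambda>x \<in> (carrier G \<times> {1..n} \<rightarrow>\<^sub>E topspace (mtop M)).
               \<lambda>(k, i) \<in> carrier G \<times> {1..n}. x (inv\<^bsub>G\<^esub> g \<otimes>\<^bsub>G\<^esub> k, (inv\<^bsub>sym_group n\<^esub> \<sigma>) i)),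
      opunit = (\<lambda>_ \<in> carrier G \<times> {1..1}. \<one>\<^bsub>M\<^esub>),
      pcomp = (\<lambda>n m i x y. \<lambda>(g, k) \<in> carrier G \<times> {1..n + m - 1}.
                 if k < i then x (g, k)
                 else if k < i + m then x (g, i) \<otimes>\<^bsub>M\<^esub> y (g, k - i + 1)
                 else x (g, k + 1 - m))\<rparr>"

definition R_points ::
  "('g, 'b) monoid_scheme \<Rightarrow> 'm top_monoid \<Rightarrow> nat \<Rightarrow> ('g \<times> nat \<Rightarrow> 'm) set" where
  "R_points G M n = {x \<in> topspace (level (O_operad G M) n).
     (\<forall>g \<in> carrier G. \<forall>i \<in> {1..n}. \<forall>j \<in> {1..n}. i \<noteq> j \<longrightarrow> \<not> meets M (x (g, i)) (x (g, j))) \<and>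
     (\<forall>i \<in> {1..n}. \<forall>g1 \<in> carrier G. \<forall>g2 \<in> carrier G.
        x (g1, i) = x (g2, i) \<or> \<not> meets M (x (g1, i)) (x (g2, i)))}"

definition R_operad ::
  "('g, 'b) monoid_scheme \<Rightarrow> 'm top_monoid \<Rightarrow> ('g, 'g \<times> nat \<Rightarrow> 'm) g_operad_data" where
  "R_operad G M = suboperad (O_operad G M) (R_points G M)"

definition intersection_operad :: "(unit, unit \<times> nat \<Rightarrow> 'm) g_operad_data \<Rightarrow> bool" where
  "intersection_operad P \<longleftrightarrow>
     (\<exists>M :: 'm top_monoid. intersection_monoid M \<and> P = R_operad (singleton_group ()) M)"

definition twist_map :: "('g, 'b) monoid_scheme \<Rightarrow> nat \<Rightarrow> 'g set \<Rightarrow> ('g \<Rightarrow> nat) \<Rightarrow> bool" where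
  "twist_map G n S \<alpha> \<longleftrightarrow> S \<subseteq> carrier G \<and> \<alpha> ` S \<subseteq> {1..n} \<and>
     (\<exists>g0 \<in> carrier G. subgroup (S #>\<^bsub>G\<^esub> g0) G)"

definition structures_transfer ::
  "('g, 'b) monoid_scheme \<Rightarrow> 'g set \<Rightarrow> ('g \<Rightarrow> nat) \<Rightarrow> nat \<Rightarrow> 'g set \<Rightarrow> 'g set \<Rightarrow> bool" where
  "structures_transfer G S \<alpha> i K H \<longleftrightarrow> i \<in> \<alpha> ` S \<and>
     (\<exists>g0 \<in> carrier G. S #>\<^bsub>G\<^esub> g0 = H \<and>
        (let F = {s \<in> S. \<alpha> s = i} #>\<^bsub>G\<^esub> g0 in
           subgroup K G \<and> K \<subseteq> F \<and>
           (\<forall>L. subgroup L G \<and> L \<subseteq> F \<and> K \<subseteq> L \<longrightarrow> L = K)))"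

definition supports_transfer ::
  "('g, 'b) monoid_scheme \<Rightarrow> 'm top_monoid \<Rightarrow> nat \<Rightarrow> ('g \<times> nat \<Rightarrow> 'm) \<Rightarrow> 'g set \<Rightarrow> 'g set \<Rightarrow> bool"
  where
  "supports_transfer G M n x K H \<longleftrightarrow>
     (\<exists>S \<alpha> i. twist_map G n S \<alpha> \<and> structures_transfer G S \<alpha> i K H \<and>
        (\<forall>g1 \<in> S. \<forall>g2 \<in> S. meets M (x (g1, \<alpha> g1)) (x (g2, \<alpha> g2))))"

text \<open>
  \<open>incomplete_coinduction G \<tau> M\<close> is the operad \<open>\<R>\<^sup>\<tau>(M)\<close>, that is, the \<open>\<tau>\<close>-incomplete coinduction
  of the intersection operad \<open>R_operad (singleton_group ()) M\<close>.
\<close>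

definition incomplete_coinduction ::
  "('g, 'b) monoid_scheme \<Rightarrow> ('g set \<times> 'g set) set \<Rightarrow> 'm top_monoid
     \<Rightarrow> ('g, 'g \<times> nat \<Rightarrow> 'm) g_operad_data" where
  "incomplete_coinduction G \<tau> M = suboperad (R_operad G M)
     (\<lambda>n. {x \<in> R_points G M n. \<forall>K H. supports_transfer G M n x K H \<longrightarrow> (K, H) \<in> \<tau>})"


section \<open>The fat dyadic intervals monoid\<close>

datatype letter = La | Lb

definition word_disjoint :: "letter list \<Rightarrow> letter list \<Rightarrow> bool" where
  "word_disjoint w w' \<longleftrightarrow> (\<exists>k < min (length w) (length w'). w ! k \<noteq> w' ! k)"

text \<open>
  A point of \<open>\<Coprod>\<^sub>n \<D>\<^sub>n \<times> I\<^sup>n\<close> is a triple \<open>(n, w, t)\<close>; coordinates are numbered from \<open>0\<close>, and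
  \<open>t\<close> is extensional on \<open>{..<n}\<close>.
\<close>

type_synonym fat_word = "nat \<times> letter list \<times> (nat \<Rightarrow> real)"

definition cube_topology :: "nat \<Rightarrow> (nat \<Rightarrow> real) topology" where
  "cube_topology n = product_topology (\<lambda>_. top_of_set {0..1}) {..<n}"

definition fat_word_topology :: "fat_word topology" where
  "fat_word_topology =
     sum_topology (\<lambda>n. prod_topology (discrete_topology {w. length w = n}) (cube_topology n)) UNIV"

definition Inj_hom :: "nat \<Rightarrow> nat \<Rightarrow> (nat \<Rightarrow> nat) set" where
  "Inj_hom m n = {\<delta>. \<delta> ` {..<m} \<subseteq> {..<n} \<and> strict_mono_on {..<m} \<delta>}"

definition insert_zeros :: "nat \<Rightarrow> nat \<Rightarrow> (nat \<Rightarrow> nat) \<Rightarrow> (nat \<Rightarrow> real) \<Rightarrow> nat \<Rightarrow> real" where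
  "insert_zeros m n \<delta> t =
     (\<lambda>j \<in> {..<n}. if j \<in> \<delta> ` {..<m} then t (inv_into {..<m} \<delta> j) else 0)"

definition select_letters :: "nat \<Rightarrow> (nat \<Rightarrow> nat) \<Rightarrow> letter list \<Rightarrow> letter list" where
  "select_letters m \<delta> w = map (\<lambda>i. w ! \<delta> i) [0..<m]"

text \<open>The relation generating the coend over \<open>Inj\<close>.\<close>

inductive coend_step :: "fat_word \<Rightarrow> fat_word \<Rightarrow> bool" where
  "\<lbrakk>\<delta> \<in> Inj_hom m n; length w = n; t \<in> topspace (cube_topology m)\<rbrakk>
    \<Longrightarrow> coend_step (n, w, insert_zeros m n \<delta> t) (m, select_letters m \<delta> w, t)"

definition fat_class :: "fat_word \<Rightarrow> fat_word set" where
  "fat_class p = {q. equivclp coend_step p q}"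

fun fat_concat :: "fat_word \<Rightarrow> fat_word \<Rightarrow> fat_word" where
  "fat_concat (n, w, t) (n', w', t') =
     (n + n', w @ w', \<lambda>j \<in> {..<n + n'}. if j < n then t j else t' (j - n))"

fun reduced :: "fat_word \<Rightarrow> bool" where
  "reduced (n, w, t) \<longleftrightarrow> (\<forall>k < n. t k \<noteq> 0)"

definition omega :: "fat_word set \<Rightarrow> letter list" where
  "omega X = fst (snd (THE p. p \<in> X \<and> reduced p))"

text \<open>
  The quotient below is already weak Hausdorff, so the coend in compactly generated weak Hausdorff
  spaces is the ordinary topological quotient.
\<close>

definition WD :: "fat_word set top_monoid" where
  "WD =
     \<lparr>carrier = fat_class ` topspace fat_word_topology,
      monoid.mult = (\<lambda>X Y. \<Union>p \<in> X. \<Union>q \<in> Y. fat_class (fat_concat p q)),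
      one = fat_class (0, [], \<lambda>_ \<in> {..<0}. 0),
      mtop = quotient_topology fat_word_topology fat_class,
      meets = (\<lambda>X Y. \<not> word_disjoint (omega X) (omega Y))\<rparr>"

definition dyadic_Barratt_Eccles :: "(unit, unit \<times> nat \<Rightarrow> fat_word set) g_operad_data" where
  "dyadic_Barratt_Eccles = R_operad (singleton_group ()) WD"

end

theory Submission
  imports Defs
begin

text \<open>
  A point of \<^const>\<open>WD\<close> is a word in two letters, each letter carrying a thickness in \<open>(0, 1]\<close>; a
  letter disappears when its thickness tends to \<open>0\<close>.  Two points are disjoint if their words
  differ at a common position, so disjointness ignores thickness.

  Every level of the operads below is contractible as soon as it is nonempty, and so is every
  fixed point space, for the same reason.  Let \<open>s \<cdot> z\<close> be \<open>z\<close> with all thicknesses multiplied by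
  \<open>s\<close>, entry by entry.  For a fixed point \<open>z\<close> the two homotopies
    \<open>x = x (0 \<cdot> z) \<leadsto> x (1 \<cdot> z) = (1 \<cdot> x) z \<leadsto> (0 \<cdot> x) z = z\<close>
  contract the space onto \<open>z\<close>.  They stay inside it: the axioms of an intersection monoid say
  that multiplying on the right by \<open>z\<close> keeps disjoint entries disjoint, keeps equal entries equal or
  makes them disjoint, and creates no new transfer, while rescaling by \<open>s > 0\<close> changes no word
  (\<open>contractible_stable\<close>).  Universality of the levels then holds for the family of all subgroups
  that have a fixed point.

  What remains is the following.

  \<^item> \<^const>\<open>WD\<close> is an intersection monoid.  Its quotient topology is Hausdorff because the sums
    over subwords in \<open>subseq_sum\<close> separate points, and a compact subset meets only words
    of bounded length (\<open>compactin_WD_bounded_length\<close>), so that multiplication and rescaling are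
    continuous because they are so on cubes.

  \<^item> The tables that support only transfers of \<open>\<tau>\<close> are closed under composition
    (\<open>R_tau_pcomp\<close>): a transfer \<open>K \<rightarrow> H\<close> supported by \<open>x \<circ>\<^sub>i y\<close> either is one of \<open>x\<close>, or factors as
    \<open>K \<rightarrow> L\<close> supported by \<open>y\<close> and \<open>L \<rightarrow> H\<close> supported by \<open>x\<close>; transitivity of \<open>\<tau>\<close> concludes.

  \<^item> The orbit \<open>H/K\<close> is admissible if and only if \<open>K \<rightarrow> H\<close> is in \<open>\<tau>\<close>.  An invariant table takes
    the same value at all \<open>(h, hK)\<close>, hence supports \<open>K \<rightarrow> H\<close> (\<open>transfer_if_fixed\<close>).  Conversely, the
    invariant table with as many pairwise disjoint values as possible supports
    only the conjugates and restrictions of \<open>K \<rightarrow> H\<close> (\<open>fixed_if_transfer\<close>).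
\<close>

section \<open>Hausdorff k-spaces\<close>

lemma openin_kification_if_openin: "openin X U \<Longrightarrow> openin (kification X) U"
  by (auto simp: openin_kification openin_subset openin_subtopology_Int2)

lemma continuous_map_from_kification:
  assumes "continuous_map X Y f" shows "continuous_map (kification X) Y f"
proof -
  have "{x \<in> topspace (kification X). f x \<in> U} = {x \<in> topspace X. f x \<in> U}" for U
    by simp
  with assms show ?thesis
    unfolding continuous_map_def by (auto intro: openin_kification_if_openin)
qed

lemma Hausdorff_space_kification: "Hausdorff_space X \<Longrightarrow> Hausdorff_space (kification X)"
  by (rule Hausdorff_space_injective_preimage[of X _ "\<lambda>x. x"])
     (auto intro: continuous_map_from_kification)

lemma subtopology_kification_compact:
  assumes "Hausdorff_space X" "compactin X K"
  shows "subtopology (kification X) K = subtopology X K"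
proof -
  have "openin (subtopology (kification X) K) U \<longleftrightarrow> openin (subtopology X K) U" for U
  proof
    assume "openin (subtopology (kification X) K) U"
    then obtain V where V: "openin (kification X) V" "U = V \<inter> K"
      by (auto simp: openin_subtopology)
    have "Hausdorff_space (subtopology X K)"
      using assms(1) by (rule Hausdorff_space_subtopology)
    with V assms have "openin (subtopology X K) (K \<inter> V)"
      by (auto simp: openin_kification)
    with V show "openin (subtopology X K) U"
      by (simp add: Int_commute)
  next
    assume "openin (subtopology X K) U"
    then show "openin (subtopology (kification X) K) U"
      by (auto simp: openin_subtopology intro: openin_kification_if_openin)
  qed
  then show ?thesis by (simp add: topology_eq)
qed

lemma compactin_kification_iff:
  assumes "Hausdorff_space X"
  shows "compactin (kification X) K \<longleftrightarrow> compactin X K"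
proof
  assume "compactin (kification X) K"
  then have "compactin X ((\<lambda>x. x) ` K)"
    by (rule image_compactin) (simp add: continuous_map_from_kification)
  then show "compactin X K" by simp
next
  assume "compactin X K"
  with subtopology_kification_compact[OF assms this] show "compactin (kification X) K"
    by (metis compactin_subspace topspace_kification)
qed

lemma k_space_kification:
  assumes "Hausdorff_space X" shows "k_space (kification X)"
  unfolding k_space_open
proof (intro allI impI, elim conjE)
  fix S assume S: "S \<subseteq> topspace (kification X)"
    and K: "\<forall>K. compactin (kification X) K \<longrightarrow> openin (subtopology (kification X) K) (K \<inter> S)"
  have "openin (subtopology X K) (K \<inter> S)" if "compactin X K" for K
    using K that compactin_kification_iff[OF assms] subtopology_kification_compact[OF assms] by metis
  with S show "openin (kification X) S"
    by (auto simp: openin_kification)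
qed

lemma kification_k_space:
  assumes "Hausdorff_space X" "k_space X" shows "kification X = X"
proof -
  have "openin (kification X) S \<longleftrightarrow> openin X S" for S
    using assms unfolding openin_kification k_space_alt
    by (metis Hausdorff_space_subtopology openin_subset)
  then show ?thesis by (simp add: topology_eq)
qed

text \<open>On Hausdorff spaces k-ification is right adjoint to the inclusion of the k-spaces: a compact
  subset of \<open>Z\<close> has compact image, and compact sets have the same subspace topology in \<open>Y\<close>
  and in its k-ification.\<close>

lemma continuous_map_into_kification:
  assumes Z: "k_space Z" and Y: "Hausdorff_space Y" and f: "continuous_map Z Y f"
  shows "continuous_map Z (kification Y) f"
  using Z
proof (rule continuous_map_from_k_space)
  fix K assume K: "compactin Z K"
  have "compactin Y (f ` K)"
    using K f by (rule image_compactin)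
  then have eq: "subtopology (kification Y) (f ` K) = subtopology Y (f ` K)"
    by (rule subtopology_kification_compact[OF Y])
  have "continuous_map (subtopology Z K) (subtopology Y (f ` K)) f"
    using f by (auto simp: continuous_map_in_subtopology continuous_map_from_subtopology)
  then show "continuous_map (subtopology Z K) (kification Y) f"
    unfolding eq[symmetric] by (simp add: continuous_map_in_subtopology)
qed

lemma cgwh_space_if_Hausdorff:
  assumes "Hausdorff_space X" "k_space X" shows "cgwh_space X"
  unfolding cgwh_space_def weak_Hausdorff_space_def
proof (intro conjI allI impI)
  show "kification X = X" using assms by (rule kification_k_space)
  fix C :: "'a set set topology" and u
  assume "compact_space C \<and> Hausdorff_space C \<and> continuous_map C X u"
  then have "compactin X (u ` topspace C)"
    by (metis compact_space_def image_compactin)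
  then show "closedin X (u ` topspace C)"
    using assms(1) by (simp add: compactin_imp_closedin)
qed

lemma topology_eqI_continuous_id:
  assumes "topspace X = topspace Y" "continuous_map X Y (\<lambda>x. x)" "continuous_map Y X (\<lambda>x. x)"
  shows "X = Y"
proof -
  have *: "openin A U" if "topspace A = topspace B" "continuous_map A B (\<lambda>x. x)" "openin B U"
    for A B :: "'a topology" and U
  proof -
    have "openin A {x \<in> topspace A. x \<in> U}"
      using that by (simp add: continuous_map_def)
    moreover have "{x \<in> topspace A. x \<in> U} = U"
      using openin_subset[OF that(3)] that(1) by auto
    ultimately show ?thesis by simp
  qed
  show ?thesis
    using *[of X Y] *[of Y X] assms by (auto simp: topology_eq)
qed

lemma topspace_k_subtopology [simp]: "topspace (k_subtopology X S) = topspace X \<inter> S"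
  by (simp add: k_subtopology_def)

lemma Hausdorff_space_k_subtopology: "Hausdorff_space X \<Longrightarrow> Hausdorff_space (k_subtopology X S)"
  by (simp add: k_subtopology_def Hausdorff_space_kification Hausdorff_space_subtopology)

lemma k_space_k_subtopology: "Hausdorff_space X \<Longrightarrow> k_space (k_subtopology X S)"
  by (simp add: k_subtopology_def k_space_kification Hausdorff_space_subtopology)

lemma continuous_map_from_k_subtopology:
  "continuous_map X Y f \<Longrightarrow> continuous_map (k_subtopology X S) Y f"
  unfolding k_subtopology_def
  by (intro continuous_map_from_kification continuous_map_from_subtopology)

lemma continuous_map_into_k_subtopology:
  assumes "k_space Z" "Hausdorff_space Y" "continuous_map Z Y f" "f \<in> topspace Z \<rightarrow> S"
  shows "continuous_map Z (k_subtopology Y S) f"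
  unfolding k_subtopology_def
  by (rule continuous_map_into_kification)
     (use assms in \<open>auto simp: Hausdorff_space_subtopology continuous_map_in_subtopology\<close>)

text \<open>Both sides are k-spaces, and the identity is continuous both ways by the universal property.
  So nested suboperads have the levels of a single suboperad.\<close>

lemma k_subtopology_kification:
  assumes X: "Hausdorff_space X"
  shows "k_subtopology (kification X) S = k_subtopology X S"
proof (rule topology_eqI_continuous_id)
  have "continuous_map (kification X) X (\<lambda>x. x)"
    by (simp add: continuous_map_from_kification)
  then show "continuous_map (k_subtopology (kification X) S) (k_subtopology X S) (\<lambda>x. x)"
    using X by (intro continuous_map_into_k_subtopology continuous_map_from_k_subtopology
        k_space_k_subtopology Hausdorff_space_kification) auto
  show "continuous_map (k_subtopology X S) (k_subtopology (kification X) S) (\<lambda>x. x)"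
    using X by (intro continuous_map_into_k_subtopology continuous_map_into_kification
        continuous_map_from_k_subtopology k_space_k_subtopology Hausdorff_space_kification) auto
qed simp

lemma k_subtopology_k_subtopology:
  assumes X: "Hausdorff_space X"
  shows "k_subtopology (k_subtopology X S) T = k_subtopology X (S \<inter> T)"
  using k_subtopology_kification[OF Hausdorff_space_subtopology[OF X], of S T]
  by (simp add: k_subtopology_def subtopology_subtopology)

lemma topspace_k_prod_topology [simp]:
  "topspace (k_prod_topology X Y) = topspace X \<times> topspace Y"
  by (simp add: k_prod_topology_def)

lemma k_space_k_prod_topology:
  "Hausdorff_space X \<Longrightarrow> Hausdorff_space Y \<Longrightarrow> k_space (k_prod_topology X Y)"
  by (simp add: k_prod_topology_def k_space_kification Hausdorff_space_prod_topology)

lemma continuous_map_into_k_prod: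
  assumes "k_space Z" "Hausdorff_space X" "Hausdorff_space Y"
    and "continuous_map Z X f" "continuous_map Z Y g"
  shows "continuous_map Z (k_prod_topology X Y) (\<lambda>z. (f z, g z))"
  unfolding k_prod_topology_def
  by (rule continuous_map_into_kification)
     (use assms in \<open>auto simp: Hausdorff_space_prod_topology continuous_map_pairwise o_def\<close>)

lemma continuous_map_from_k_prod:
  "continuous_map (prod_topology X Y) Z f \<Longrightarrow> continuous_map (k_prod_topology X Y) Z f"
  unfolding k_prod_topology_def by (rule continuous_map_from_kification)

section \<open>Reduced words\<close>

text \<open>The points of the unquotiented space, as lists of letters with their thickness.\<close>

definition fat_lists :: "(letter \<times> real) list set" where
  "fat_lists = lists (UNIV \<times> {0..1})"

definition fat_of_list :: "(letter \<times> real) list \<Rightarrow> fat_word" where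
  "fat_of_list xs = (length xs, map fst xs, \<lambda>k \<in> {..<length xs}. snd (xs ! k))"

fun list_of_fat :: "fat_word \<Rightarrow> (letter \<times> real) list" where
  "list_of_fat (n, w, t) = map (\<lambda>k. (w ! k, t k)) [0..<n]"

definition reduce :: "(letter \<times> real) list \<Rightarrow> (letter \<times> real) list" where
  "reduce xs = filter (\<lambda>x. snd x \<noteq> 0) xs"

definition wd :: "(letter \<times> real) list \<Rightarrow> fat_word set" where
  "wd xs = fat_class (fat_of_list xs)"

lemma in_topspace_fat_word_topology:
  "(n, w, t) \<in> topspace fat_word_topology \<longleftrightarrow> length w = n \<and> t \<in> {..<n} \<rightarrow>\<^sub>E {0..1}"
  by (auto simp: fat_word_topology_def cube_topology_def)

lemma list_of_fat_of_list [simp]: "list_of_fat (fat_of_list xs) = xs"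
  by (rule nth_equalityI) (auto simp: fat_of_list_def)

lemma fat_of_list_of_fat:
  assumes "p \<in> topspace fat_word_topology" shows "fat_of_list (list_of_fat p) = p"
proof -
  obtain n w t where p: "p = (n, w, t)" by (cases p)
  with assms have w: "length w = n" and t: "t \<in> {..<n} \<rightarrow>\<^sub>E {0..1}"
    by (auto simp: in_topspace_fat_word_topology)
  have "map fst (list_of_fat p) = w"
    using w map_nth[of w] by (simp add: p comp_def)
  moreover have "(\<lambda>k \<in> {..<n}. snd (list_of_fat p ! k)) = t"
    using t by (auto simp: p fun_eq_iff PiE_def extensional_def)
  ultimately show ?thesis by (simp add: fat_of_list_def p)
qed

lemma fat_of_list_in_topspace:
  "fat_of_list xs \<in> topspace fat_word_topology \<longleftrightarrow> xs \<in> fat_lists"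
proof -
  have "fat_of_list xs \<in> topspace fat_word_topology \<longleftrightarrow> (\<forall>k < length xs. snd (xs ! k) \<in> {0..1})"
    by (auto simp: fat_of_list_def in_topspace_fat_word_topology Pi_iff)
  also have "\<dots> \<longleftrightarrow> xs \<in> fat_lists"
    unfolding fat_lists_def in_lists_conv_set all_set_conv_all_nth by (simp add: mem_Times_iff)
  finally show ?thesis .
qed

lemma list_of_fat_in_fat_lists:
  "p \<in> topspace fat_word_topology \<Longrightarrow> list_of_fat p \<in> fat_lists"
  by (metis fat_of_list_in_topspace fat_of_list_of_fat)

lemma topspace_fat_word_topology: "topspace fat_word_topology = fat_of_list ` fat_lists"
proof
  show "topspace fat_word_topology \<subseteq> fat_of_list ` fat_lists"
  proof
    fix p assume "p \<in> topspace fat_word_topology"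
    then have "p = fat_of_list (list_of_fat p)" "list_of_fat p \<in> fat_lists"
      by (simp_all only: fat_of_list_of_fat list_of_fat_in_fat_lists)
    then show "p \<in> fat_of_list ` fat_lists" by (rule image_eqI)
  qed
qed (auto simp only: fat_of_list_in_topspace)

lemma filter_image_Inj_hom:
  assumes "\<delta> \<in> Inj_hom m n"
  shows "filter (\<lambda>j. j \<in> \<delta> ` {..<m}) [0..<n] = map \<delta> [0..<m]"
proof (rule sorted_distinct_set_unique)
  have \<delta>: "\<delta> ` {..<m} \<subseteq> {..<n}" "strict_mono_on {..<m} \<delta>"
    using assms by (auto simp: Inj_hom_def)
  show "sorted (map \<delta> [0..<m])"
    using \<delta>(2) by (auto simp: sorted_iff_nth_mono strict_mono_on_leD)
  show "distinct (map \<delta> [0..<m])"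
    using strict_mono_on_imp_inj_on[OF \<delta>(2)] by (simp add: distinct_map atLeast0LessThan)
  show "set (filter (\<lambda>j. j \<in> \<delta> ` {..<m}) [0..<n]) = set (map \<delta> [0..<m])"
    using \<delta>(1) by (force simp: subset_iff)
qed (auto intro: sorted_wrt_filter)

text \<open>Inserting zeros along \<open>\<delta>\<close> only adds letters that reduction deletes again.\<close>

lemma coend_step_reduce:
  assumes "coend_step p q"
  shows "p \<in> topspace fat_word_topology" "q \<in> topspace fat_word_topology"
    and "reduce (list_of_fat p) = reduce (list_of_fat q)"
proof -
  obtain \<delta> m n w t where \<delta>: "\<delta> \<in> Inj_hom m n" and w: "length w = n"
    and t: "t \<in> topspace (cube_topology m)"
    and p: "p = (n, w, insert_zeros m n \<delta> t)" and q: "q = (m, select_letters m \<delta> w, t)"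
    using assms by (auto elim: coend_step.cases)
  have t': "t \<in> {..<m} \<rightarrow>\<^sub>E {0..1}"
    using t by (simp add: cube_topology_def)
  have inj: "inj_on \<delta> {..<m}" and sub: "\<delta> ` {..<m} \<subseteq> {..<n}"
    using \<delta> strict_mono_on_imp_inj_on by (auto simp: Inj_hom_def)
  show "q \<in> topspace fat_word_topology"
    using t' by (simp add: q in_topspace_fat_word_topology select_letters_def)
  have "insert_zeros m n \<delta> t j \<in> {0..1}" if "j < n" for j
    using t' inv_into_into[of j \<delta> "{..<m}"] that by (auto simp: insert_zeros_def PiE_iff)
  then have "insert_zeros m n \<delta> t \<in> {..<n} \<rightarrow>\<^sub>E {0..1}"
    by (auto simp: PiE_iff insert_zeros_def)
  then show "p \<in> topspace fat_word_topology"
    using w by (simp add: p in_topspace_fat_word_topology)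
  have ins: "insert_zeros m n \<delta> t (\<delta> i) = t i" if "i < m" for i
    using that inj sub by (auto simp: insert_zeros_def)
  have nz: "insert_zeros m n \<delta> t j \<noteq> 0 \<longleftrightarrow>
      j \<in> \<delta> ` {..<m} \<and> insert_zeros m n \<delta> t j \<noteq> 0" if "j < n" for j
    using that by (auto simp: insert_zeros_def)
  have "filter (\<lambda>j. insert_zeros m n \<delta> t j \<noteq> 0) [0..<n]
      = filter (\<lambda>j. insert_zeros m n \<delta> t j \<noteq> 0) (filter (\<lambda>j. j \<in> \<delta> ` {..<m}) [0..<n])"
    unfolding filter_filter by (rule filter_cong) (use nz in auto)
  also have "\<dots> = map \<delta> (filter (\<lambda>i. t i \<noteq> 0) [0..<m])"
    unfolding filter_image_Inj_hom[OF \<delta>] filter_map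
    by (rule arg_cong[of _ _ "map \<delta>"], rule filter_cong) (auto simp: ins)
  finally have "filter (\<lambda>j. insert_zeros m n \<delta> t j \<noteq> 0) [0..<n]
      = map \<delta> (filter (\<lambda>i. t i \<noteq> 0) [0..<m])" .
  then show "reduce (list_of_fat p) = reduce (list_of_fat q)"
    by (simp add: p q reduce_def filter_map o_def select_letters_def ins)
qed

lemma reduce_in_fat_lists: "xs \<in> fat_lists \<Longrightarrow> reduce xs \<in> fat_lists"
  by (auto simp: fat_lists_def reduce_def)

text \<open>Conversely a word reduces in a single step, along the inclusion of the positions whose
  coordinate is not zero.\<close>

lemma coend_step_to_reduced:
  assumes xs: "xs \<in> fat_lists"
  shows "coend_step (fat_of_list xs) (fat_of_list (reduce xs))"
proof -
  define n where "n = length xs"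
  define js where "js = filter (\<lambda>j. snd (xs ! j) \<noteq> 0) [0..<n]"
  define m where "m = length js"
  define \<delta> where "\<delta> = (\<lambda>i. js ! i)"
  define t where "t = (\<lambda>k \<in> {..<m}. snd (xs ! (js ! k)))"
  have red: "reduce xs = map (\<lambda>j. xs ! j) js"
  proof -
    have "reduce xs = reduce (map (\<lambda>j. xs ! j) [0..<n])"
      by (simp add: n_def map_nth)
    then show ?thesis by (simp add: reduce_def js_def filter_map o_def)
  qed
  have set_js: "set js = {j. j < n \<and> snd (xs ! j) \<noteq> 0}"
    by (auto simp: js_def)
  have img: "\<delta> ` {..<m} = set js"
    by (auto simp: \<delta>_def m_def set_conv_nth)
  have "sorted_wrt (<) js"
    unfolding js_def by (rule sorted_wrt_filter) simp
  then have mono: "strict_mono_on {..<m} \<delta>"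
    by (auto simp: strict_mono_on_def \<delta>_def m_def sorted_wrt_iff_nth_less)
  have \<delta>: "\<delta> \<in> Inj_hom m n"
    using mono img set_js by (auto simp: Inj_hom_def)
  have inv: "js ! inv_into {..<m} \<delta> j = j" if "j \<in> set js" for j
    using f_inv_into_f[of j \<delta> "{..<m}"] that unfolding img by (simp add: \<delta>_def)
  have inv_less: "inv_into {..<m} \<delta> j < m" if "j \<in> set js" for j
    using that by (metis img inv_into_into lessThan_iff)
  have "insert_zeros m n \<delta> t = (\<lambda>k \<in> {..<n}. snd (xs ! k))"
  proof
    fix j
    show "insert_zeros m n \<delta> t j = (\<lambda>k \<in> {..<n}. snd (xs ! k)) j"
      using inv[of j] inv_less[of j] set_js
      by (auto simp: insert_zeros_def img t_def)
  qed
  then have p: "fat_of_list xs = (n, map fst xs, insert_zeros m n \<delta> t)"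
    by (simp add: fat_of_list_def n_def)
  have sel: "select_letters m \<delta> (map fst xs) = map fst (reduce xs)"
  proof -
    have "select_letters m \<delta> (map fst xs) = map ((!) (map fst xs)) (map \<delta> [0..<m])"
      by (simp add: select_letters_def)
    also have "map \<delta> [0..<m] = js"
      by (simp add: \<delta>_def m_def map_nth)
    also have "map ((!) (map fst xs)) js = map fst (reduce xs)"
      using set_js by (auto simp: red n_def)
    finally show ?thesis .
  qed
  have q: "fat_of_list (reduce xs) = (m, select_letters m \<delta> (map fst xs), t)"
    unfolding sel by (auto simp: fat_of_list_def red m_def t_def)
  have "fat_of_list (reduce xs) \<in> topspace fat_word_topology"
    using reduce_in_fat_lists[OF xs] by (simp add: fat_of_list_in_topspace)
  then have t: "t \<in> topspace (cube_topology m)"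
    by (simp add: q in_topspace_fat_word_topology cube_topology_def)
  have "length (map fst xs) = n" by (simp add: n_def)
  from coend_step.intros[OF \<delta> this t] show ?thesis
    unfolding p q .
qed

text \<open>Reduction is a normal form for the generated equivalence: no step changes it, and every word is
  one step away from it.\<close>

lemma fat_class_eq:
  assumes p: "p \<in> topspace fat_word_topology"
  shows "fat_class p =
    {q \<in> topspace fat_word_topology. reduce (list_of_fat q) = reduce (list_of_fat p)}"
proof -
  have 1: "q \<in> topspace fat_word_topology \<and> reduce (list_of_fat q) = reduce (list_of_fat p)"
    if "equivclp coend_step p q" for q
    using that
  proof (induction rule: equivclp_induct)
    case base then show ?case using p by simp
  next
    case (step y z) then show ?case using coend_step_reduce by metis
  qed
  have to_red: "equivclp coend_step q (fat_of_list (reduce (list_of_fat q)))"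
    if "q \<in> topspace fat_word_topology" for q
    using coend_step_to_reduced[OF list_of_fat_in_fat_lists[OF that]] fat_of_list_of_fat[OF that]
    by (auto intro: r_into_equivclp)
  have 2: "equivclp coend_step p q"
    if "q \<in> topspace fat_word_topology" "reduce (list_of_fat q) = reduce (list_of_fat p)" for q
    using to_red[OF p] to_red[OF that(1)] that(2) by (metis equivclp_sym equivclp_trans)
  show ?thesis
    unfolding fat_class_def using 1 2 by blast
qed

lemma wd_eq:
  "xs \<in> fat_lists \<Longrightarrow>
    wd xs = {q \<in> topspace fat_word_topology. reduce (list_of_fat q) = reduce xs}"
  unfolding wd_def by (simp add: fat_class_eq fat_of_list_in_topspace)

lemma wd_eq_iff:
  assumes "xs \<in> fat_lists" "ys \<in> fat_lists"
  shows "wd xs = wd ys \<longleftrightarrow> reduce xs = reduce ys"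
proof
  assume "wd xs = wd ys"
  moreover have "fat_of_list xs \<in> wd xs"
    using assms by (simp add: wd_eq fat_of_list_in_topspace)
  ultimately show "reduce xs = reduce ys"
    using assms by (simp add: wd_eq)
qed (use assms in \<open>simp add: wd_eq\<close>)

lemma fat_class_eq_wd:
  "p \<in> topspace fat_word_topology \<Longrightarrow> fat_class p = wd (list_of_fat p)"
  by (simp add: wd_def fat_of_list_of_fat)

lemma reduce_reduce [simp]: "reduce (reduce xs) = reduce xs"
  by (simp add: reduce_def)

lemma reduce_append [simp]: "reduce (xs @ ys) = reduce xs @ reduce ys"
  by (simp add: reduce_def)

lemma wd_reduce: "xs \<in> fat_lists \<Longrightarrow> wd (reduce xs) = wd xs"
  by (simp add: wd_eq_iff reduce_in_fat_lists)

lemma fat_lists_append [simp]: "xs @ ys \<in> fat_lists \<longleftrightarrow> xs \<in> fat_lists \<and> ys \<in> fat_lists"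
  by (simp add: fat_lists_def)

lemma Nil_in_fat_lists [simp]: "[] \<in> fat_lists"
  by (simp add: fat_lists_def)

lemma list_of_fat_concat:
  assumes "p \<in> topspace fat_word_topology"
  shows "list_of_fat (fat_concat p q) = list_of_fat p @ list_of_fat q"
proof -
  obtain n w t n' w' t' where pq: "p = (n, w, t)" "q = (n', w', t')"
    by (cases p, cases q)
  then have w: "length w = n"
    using assms by (simp add: in_topspace_fat_word_topology)
  show ?thesis
  proof (rule nth_equalityI)
    fix i assume "i < length (list_of_fat (fat_concat p q))"
    then show "list_of_fat (fat_concat p q) ! i = (list_of_fat p @ list_of_fat q) ! i"
      using w by (auto simp: pq nth_append)
  qed (simp add: pq)
qed

lemma fat_concat_in_topspace:
  assumes "p \<in> topspace fat_word_topology" "q \<in> topspace fat_word_topology"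
  shows "fat_concat p q \<in> topspace fat_word_topology"
proof -
  obtain n w t n' w' t' where "p = (n, w, t)" "q = (n', w', t')"
    by (cases p, cases q)
  with assms show ?thesis
    by (auto simp: in_topspace_fat_word_topology PiE_iff)
qed

lemma carrier_WD: "carrier WD = wd ` fat_lists"
  by (auto simp: WD_def wd_def topspace_fat_word_topology)

lemma wd_in_carrier [simp]: "xs \<in> fat_lists \<Longrightarrow> wd xs \<in> carrier WD"
  by (simp add: carrier_WD)

lemma mult_WD:
  assumes "xs \<in> fat_lists" "ys \<in> fat_lists"
  shows "wd xs \<otimes>\<^bsub>WD\<^esub> wd ys = wd (xs @ ys)"
proof -
  have "fat_class (fat_concat p q) = wd (xs @ ys)" if "p \<in> wd xs" "q \<in> wd ys" for p q
  proof -
    have p: "p \<in> topspace fat_word_topology" "reduce (list_of_fat p) = reduce xs"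
      and q: "q \<in> topspace fat_word_topology" "reduce (list_of_fat q) = reduce ys"
      using that assms by (auto simp: wd_eq)
    then show ?thesis
      using assms by (simp add: fat_class_eq_wd fat_concat_in_topspace list_of_fat_concat wd_eq_iff
          list_of_fat_in_fat_lists)
  qed
  moreover have "fat_of_list xs \<in> wd xs" "fat_of_list ys \<in> wd ys"
    using assms by (auto simp: wd_eq fat_of_list_in_topspace)
  ultimately have "(\<Union>p \<in> wd xs. \<Union>q \<in> wd ys. fat_class (fat_concat p q)) = wd (xs @ ys)"
    by blast
  then show ?thesis by (simp add: WD_def)
qed

lemma one_WD: "\<one>\<^bsub>WD\<^esub> = wd []"
  by (simp add: WD_def wd_def fat_of_list_def lessThan_0 restrict_def)

lemma monoid_WD: "monoid WD"
  by (rule monoidI) (auto simp: carrier_WD one_WD mult_WD)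

lemma reduced_iff: "reduced p \<longleftrightarrow> reduce (list_of_fat p) = list_of_fat p"
  by (cases p) (auto simp: reduce_def filter_id_conv)

lemma omega_wd:
  assumes xs: "xs \<in> fat_lists"
  shows "omega (wd xs) = map fst (reduce xs)"
proof -
  have "(THE p. p \<in> wd xs \<and> reduced p) = fat_of_list (reduce xs)"
  proof (rule the_equality)
    show "fat_of_list (reduce xs) \<in> wd xs \<and> reduced (fat_of_list (reduce xs))"
      using xs by (simp add: wd_eq fat_of_list_in_topspace reduce_in_fat_lists reduced_iff)
    fix p assume "p \<in> wd xs \<and> reduced p"
    then show "p = fat_of_list (reduce xs)"
      using xs fat_of_list_of_fat by (fastforce simp: wd_eq reduced_iff)
  qed
  then show ?thesis by (simp add: omega_def fat_of_list_def)
qed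

lemma meets_wd:
  assumes "xs \<in> fat_lists" "ys \<in> fat_lists"
  shows "meets WD (wd xs) (wd ys) \<longleftrightarrow>
    \<not> word_disjoint (map fst (reduce xs)) (map fst (reduce ys))"
  using assms by (simp add: WD_def omega_wd)

lemma word_disjoint_append:
  "word_disjoint u v \<Longrightarrow> word_disjoint (u @ u') (v @ v')"
  by (force simp: word_disjoint_def nth_append)

lemma word_disjoint_append_left:
  "word_disjoint v v' \<Longrightarrow> word_disjoint (u @ v) (u @ v')"
  unfolding word_disjoint_def
  by (elim exE, rule_tac x = "length u + k" in exI) (auto simp: nth_append)

subsection \<open>Scaling\<close>

definition scale_list :: "real \<Rightarrow> (letter \<times> real) list \<Rightarrow> (letter \<times> real) list" where
  "scale_list s = map (map_prod id ((*) s))"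

lemma reduce_scale_list:
  "reduce (scale_list s xs) = (if s = 0 then [] else scale_list s (reduce xs))"
  by (auto simp: reduce_def scale_list_def filter_map o_def)

lemma scale_list_in_fat_lists:
  "s \<in> {0..1} \<Longrightarrow> xs \<in> fat_lists \<Longrightarrow> scale_list s xs \<in> fat_lists"
  by (force simp: scale_list_def fat_lists_def mult_le_one)

text \<open>The letters and thicknesses of the reduced representative.\<close>

definition word_of :: "fat_word set \<Rightarrow> (letter \<times> real) list" where
  "word_of X = reduce (SOME xs. xs \<in> fat_lists \<and> wd xs = X)"

lemma word_of_wd:
  assumes xs: "xs \<in> fat_lists"
  shows "word_of (wd xs) = reduce xs"
proof -
  define ys where "ys = (SOME ys. ys \<in> fat_lists \<and> wd ys = wd xs)"
  have ys: "ys \<in> fat_lists" "wd ys = wd xs"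
    unfolding ys_def using someI[of "\<lambda>ys. ys \<in> fat_lists \<and> wd ys = wd xs" xs] xs by auto
  then show ?thesis
    using xs by (simp add: word_of_def ys_def[symmetric] wd_eq_iff)
qed

definition wd_scale :: "real \<Rightarrow> fat_word set \<Rightarrow> fat_word set" where
  "wd_scale s X = wd (scale_list s (word_of X))"

lemma wd_scale_wd:
  assumes s: "s \<in> {0..1}" and xs: "xs \<in> fat_lists"
  shows "wd_scale s (wd xs) = wd (scale_list s xs)"
  using assms by (simp add: wd_scale_def word_of_wd wd_eq_iff scale_list_in_fat_lists
      reduce_in_fat_lists reduce_scale_list)

lemma scale_list_one: "scale_list 1 xs = xs"
  unfolding scale_list_def by (rule map_idI) (simp add: map_prod_def case_prod_unfold)

lemma map_fst_scale_list [simp]: "map fst (scale_list s xs) = map fst xs"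
  by (simp add: scale_list_def)

section \<open>The topology of fat words\<close>

lemma openin_prod_discrete:
  "openin (prod_topology (discrete_topology D) Y) S \<longleftrightarrow>
     S \<subseteq> D \<times> topspace Y \<and> (\<forall>d \<in> D. openin Y {y. (d, y) \<in> S})"
proof
  assume S: "openin (prod_topology (discrete_topology D) Y) S"
  then have sub: "S \<subseteq> D \<times> topspace Y"
    using openin_subset by fastforce
  have "openin Y {y. (d, y) \<in> S}" if "d \<in> D" for d
  proof -
    have "continuous_map Y (prod_topology (discrete_topology D) Y) (\<lambda>y. (d, y))"
      using that by (simp add: continuous_map_pairwise o_def)
    then have "openin Y {y \<in> topspace Y. (d, y) \<in> S}"
      using S by (rule openin_continuous_map_preimage)
    moreover have "{y \<in> topspace Y. (d, y) \<in> S} = {y. (d, y) \<in> S}"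
      using sub by auto
    ultimately show ?thesis by simp
  qed
  with sub show "S \<subseteq> D \<times> topspace Y \<and> (\<forall>d \<in> D. openin Y {y. (d, y) \<in> S})"
    by blast
next
  assume S: "S \<subseteq> D \<times> topspace Y \<and> (\<forall>d \<in> D. openin Y {y. (d, y) \<in> S})"
  then have "S = (\<Union>d \<in> D. {d} \<times> {y. (d, y) \<in> S})"
    by auto
  moreover have "openin (prod_topology (discrete_topology D) Y) (\<Union>d \<in> D. {d} \<times> {y. (d, y) \<in> S})"
    using S by (intro openin_Union) (auto simp: openin_prod_Times_iff)
  ultimately show "openin (prod_topology (discrete_topology D) Y) S"
    by simp
qed

abbreviation cube_of :: "letter list \<Rightarrow> (nat \<Rightarrow> real) topology" where
  "cube_of w \<equiv> cube_topology (length w)"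

definition thicken :: "letter list \<Rightarrow> (nat \<Rightarrow> real) \<Rightarrow> (letter \<times> real) list" where
  "thicken w t = map (\<lambda>k. (w ! k, t k)) [0..<length w]"

definition wd_cell :: "letter list \<Rightarrow> (nat \<Rightarrow> real) \<Rightarrow> fat_word set" where
  "wd_cell w t = wd (thicken w t)"

lemma topspace_cube_topology [simp]: "topspace (cube_topology n) = ({..<n} \<rightarrow>\<^sub>E {0..1})"
  by (simp add: cube_topology_def)

lemma compact_space_cube: "compact_space (cube_topology n)"
  unfolding cube_topology_def by (simp add: compact_space_product_topology compact_space_subtopology)

lemma thicken_in_fat_lists [simp]: "t \<in> topspace (cube_of w) \<Longrightarrow> thicken w t \<in> fat_lists"
  by (auto simp: thicken_def fat_lists_def PiE_iff)

lemma fat_class_eq_wd_cell: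
  "t \<in> topspace (cube_of w) \<Longrightarrow> fat_class (length w, w, t) = wd_cell w t"
  by (simp add: fat_class_eq_wd in_topspace_fat_word_topology wd_cell_def thicken_def)

lemma wd_cell_in_carrier: "t \<in> topspace (cube_of w) \<Longrightarrow> wd_cell w t \<in> carrier WD"
  by (simp add: wd_cell_def)

lemma fat_list_is_thickening:
  assumes "xs \<in> fat_lists"
  shows "thicken (map fst xs) (\<lambda>k \<in> {..<length xs}. snd (xs ! k)) = xs"
    and "(\<lambda>k \<in> {..<length xs}. snd (xs ! k)) \<in> topspace (cube_of (map fst xs))"
proof -
  show "thicken (map fst xs) (\<lambda>k \<in> {..<length xs}. snd (xs ! k)) = xs"
    by (rule nth_equalityI) (auto simp: thicken_def)
  have "snd (xs ! k) \<in> {0..1}" if "k < length xs" for k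
    using assms nth_mem[OF that] by (auto simp: fat_lists_def mem_Times_iff)
  then show "(\<lambda>k \<in> {..<length xs}. snd (xs ! k)) \<in> topspace (cube_of (map fst xs))"
    by auto
qed

lemma topspace_mtop_WD [simp]: "topspace (mtop WD) = carrier WD"
  by (simp add: WD_def)

lemma openin_fat_word_topology:
  assumes S: "S \<subseteq> topspace fat_word_topology"
  shows "openin fat_word_topology S \<longleftrightarrow> (\<forall>w. openin (cube_of w) {t. (length w, w, t) \<in> S})"
proof -
  have slice: "{x. (n, x) \<in> S} \<subseteq> {w. length w = n} \<times> topspace (cube_topology n)" for n
    using S by (auto simp: in_topspace_fat_word_topology simp del: topspace_cube_topology
        simp: fat_word_topology_def)
  have "openin fat_word_topology S \<longleftrightarrow> (\<forall>n. openin
      (prod_topology (discrete_topology {w. length w = n}) (cube_topology n)) {x. (n, x) \<in> S})"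
    unfolding fat_word_topology_def openin_sum_topology
    using S by (simp add: fat_word_topology_def)
  also have "\<dots> \<longleftrightarrow> (\<forall>n. \<forall>w \<in> {w. length w = n}. openin (cube_topology n) {t. (n, w, t) \<in> S})"
    unfolding openin_prod_discrete using slice by simp
  also have "\<dots> \<longleftrightarrow> (\<forall>w. openin (cube_of w) {t. (length w, w, t) \<in> S})"
    by simp
  finally show ?thesis .
qed

text \<open>The quotient is glued from the cubes \<^term>\<open>cube_of w\<close> along the cell maps, and its topology is
  detected on them.\<close>

lemma openin_mtop_WD:
  "openin (mtop WD) U \<longleftrightarrow> U \<subseteq> carrier WD \<and>
     (\<forall>w. openin (cube_of w) {t \<in> topspace (cube_of w). wd_cell w t \<in> U})"
proof -
  let ?S = "{x \<in> topspace fat_word_topology. fat_class x \<in> U}"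
  have "(length w, w, t) \<in> ?S \<longleftrightarrow> t \<in> topspace (cube_of w) \<and> wd_cell w t \<in> U" for w t
    using fat_class_eq_wd_cell[of t w] by (auto simp: in_topspace_fat_word_topology)
  then have "openin fat_word_topology ?S \<longleftrightarrow>
     (\<forall>w. openin (cube_of w) {t \<in> topspace (cube_of w). wd_cell w t \<in> U})"
    using openin_fat_word_topology[of ?S] by auto
  moreover have "openin (mtop WD) U \<longleftrightarrow> U \<subseteq> carrier WD \<and> openin fat_word_topology ?S"
    by (simp add: WD_def openin_quotient_topology)
  ultimately show ?thesis by simp
qed

lemma continuous_map_wd_cell: "continuous_map (cube_of w) (mtop WD) (wd_cell w)"
  unfolding continuous_map_def
  using wd_cell_in_carrier by (auto simp: openin_mtop_WD simp del: topspace_cube_topology)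

lemma continuous_map_wd_cell_compose:
  "continuous_map X (cube_of w) f \<Longrightarrow> continuous_map X (mtop WD) (\<lambda>x. wd_cell w (f x))"
  using continuous_map_compose[OF _ continuous_map_wd_cell] by (simp add: o_def)

lemma continuous_map_from_WD:
  assumes "\<And>w. continuous_map (cube_of w) Y (\<lambda>t. f (wd_cell w t))"
  shows "continuous_map (mtop WD) Y f"
proof -
  have "f (wd xs) \<in> topspace Y" if "xs \<in> fat_lists" for xs
    using continuous_map_image_subset_topspace[OF assms] fat_list_is_thickening[OF that]
    unfolding wd_cell_def by (metis image_subset_iff)
  then have 1: "f \<in> carrier WD \<rightarrow> topspace Y"
    by (auto simp: carrier_WD)
  have 2: "openin (mtop WD) {x \<in> carrier WD. f x \<in> U}" if "openin Y U" for U
  proof -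
    have "openin (cube_of w) {t \<in> topspace (cube_of w). wd_cell w t \<in> {x \<in> carrier WD. f x \<in> U}}"
      for w
    proof -
      have "{t \<in> topspace (cube_of w). wd_cell w t \<in> {x \<in> carrier WD. f x \<in> U}}
          = {t \<in> topspace (cube_of w). f (wd_cell w t) \<in> U}"
        using wd_cell_in_carrier by blast
      then show ?thesis
        using openin_continuous_map_preimage[OF assms that] by simp
    qed
    then show ?thesis by (auto simp: openin_mtop_WD)
  qed
  from 1 2 show ?thesis by (simp add: continuous_map_def)
qed

subsection \<open>Separating points\<close>

text \<open>The sum of the products \<open>f\<^sub>1 (y\<^sub>1) \<cdots> f\<^sub>k (y\<^sub>k)\<close> over all subsequences \<open>y\<^sub>1, \<dots>, y\<^sub>k\<close> of the word.  If
  the \<open>f\<^sub>j\<close> vanish on letters of thickness \<open>0\<close>, deleting such a letter does not change the sum, which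
  therefore is defined on the quotient; and it is continuous there.\<close>

fun subseq_sum :: "(letter \<times> real \<Rightarrow> real) list \<Rightarrow> (letter \<times> real) list \<Rightarrow> real" where
  "subseq_sum [] xs = 1"
| "subseq_sum (f # fs) [] = 0"
| "subseq_sum (f # fs) (x # xs) = f x * subseq_sum fs xs + subseq_sum (f # fs) xs"

definition separator :: "(letter \<times> real \<Rightarrow> real) \<Rightarrow> bool" where
  "separator f \<longleftrightarrow> (\<forall>l. f (l, 0) = 0 \<and> continuous_on {0..1} (\<lambda>t. f (l, t)))"

lemma subseq_sum_reduce:
  "\<forall>f \<in> set fs. separator f \<Longrightarrow> subseq_sum fs (reduce xs) = subseq_sum fs xs"
proof (induction fs xs rule: subseq_sum.induct)
  case (3 f fs x xs)
  have "snd x = 0 \<Longrightarrow> f x = 0"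
    using 3 by (cases x) (auto simp: separator_def)
  with 3 show ?case by (auto simp: reduce_def)
qed (auto simp: reduce_def)

lemma subseq_sum_short: "length xs < length fs \<Longrightarrow> subseq_sum fs xs = 0"
  by (induction fs xs rule: subseq_sum.induct) auto

lemma subseq_sum_nonzero_iff:
  "length fs = length xs \<Longrightarrow> subseq_sum fs xs \<noteq> 0 \<longleftrightarrow> (\<forall>i < length xs. (fs ! i) (xs ! i) \<noteq> 0)"
proof (induction fs xs rule: list_induct2)
  case (Cons f fs x xs)
  then show ?case by (auto simp: subseq_sum_short less_Suc_eq_0_disj)
qed simp

lemma continuous_map_subseq_sum:
  assumes "\<forall>f \<in> set fs. separator f" "set ks \<subseteq> {..<n}"
  shows "continuous_map (cube_topology n) euclideanreal
           (\<lambda>t. subseq_sum fs (map (\<lambda>k. (w ! k, t k)) ks))"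
  using assms
proof (induction fs arbitrary: ks)
  case (Cons f fs)
  note IH = Cons.IH
  have fs: "\<forall>f \<in> set fs. separator f" and f: "separator f"
    using Cons.prems(1) by auto
  from Cons.prems(2) show ?case
  proof (induction ks)
    case (Cons k ks)
    have "continuous_map (cube_topology n) (top_of_set {0..1}) (\<lambda>t. t k)"
      using Cons.prems unfolding cube_topology_def
      by (auto intro: continuous_map_product_projection)
    moreover have "continuous_map (top_of_set {0..1}) euclideanreal (\<lambda>r. f (w ! k, r))"
      using f by (auto simp: separator_def)
    ultimately have "continuous_map (cube_topology n) euclideanreal (\<lambda>t. f (w ! k, t k))"
      using continuous_map_compose[of _ _ "\<lambda>t. t k" _ "\<lambda>r. f (w ! k, r)"] by (simp add: o_def)
    with Cons IH[OF fs, of ks] show ?case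
      by (auto intro!: continuous_map_add continuous_map_real_mult)
  qed simp
qed simp

text \<open>For reduced words of different lengths, take the longer length as \<open>k\<close> and the thickness for each
  \<open>f\<^sub>i\<close>: the shorter word has no subsequence of this length.  For equal lengths the only
  subsequence of length \<open>k\<close> is the word itself, so one factor that vanishes at a single letter of
  one of the two words is enough.\<close>

lemma WD_separated:
  assumes X: "X \<in> carrier WD" and Y: "Y \<in> carrier WD" and "X \<noteq> Y"
    and le: "length (word_of Y) \<le> length (word_of X)"
  obtains F where "continuous_map (mtop WD) euclideanreal F" "F X \<noteq> F Y"
proof -
  define u where "u = word_of X"
  define v where "v = word_of Y"
  obtain xs ys where xs: "xs \<in> fat_lists" "X = wd xs" and ys: "ys \<in> fat_lists" "Y = wd ys"
    using X Y by (auto simp: carrier_WD)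
  have u: "u = reduce xs" and v: "v = reduce ys"
    using xs ys by (simp_all add: u_def v_def word_of_wd)
  have "u \<noteq> v"
    using \<open>X \<noteq> Y\<close> xs ys by (simp add: u v wd_eq_iff)
  have snd_u: "snd (u ! i) \<noteq> 0" if "i < length u" for i
    using nth_mem[OF that] by (auto simp: u reduce_def)
  have sep_snd: "separator snd"
    by (auto simp: separator_def intro: continuous_intros)
  obtain fs where fs: "\<forall>f \<in> set fs. separator f" and neq: "subseq_sum fs u \<noteq> subseq_sum fs v"
  proof (cases "length v = length u")
    case False
    define fs where "fs = replicate (length u) (snd :: letter \<times> real \<Rightarrow> real)"
    have "subseq_sum fs u \<noteq> 0"
      using snd_u by (subst subseq_sum_nonzero_iff) (auto simp: fs_def)
    moreover have "subseq_sum fs v = 0"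
      using False le by (intro subseq_sum_short) (simp add: fs_def u_def v_def)
    ultimately show ?thesis
      using that[of fs] sep_snd by (auto simp: fs_def)
  next
    case True
    with \<open>u \<noteq> v\<close> obtain j where j: "j < length u" "u ! j \<noteq> v ! j"
      by (metis nth_equalityI)
    \<comment> \<open>It vanishes at \<open>v ! j\<close> and at thickness \<open>0\<close>, and nowhere else.\<close>
    define g :: "letter \<times> real \<Rightarrow> real" where
      "g = (\<lambda>x. snd x * (\<bar>snd x - snd (v ! j)\<bar> + (if fst x = fst (v ! j) then 0 else 1)))"
    define fs where "fs = (replicate (length u) snd)[j := g]"
    have "separator g"
      by (auto simp: separator_def g_def intro!: continuous_intros)
    then have sep: "\<forall>f \<in> set fs. separator f"
      using set_update_subset_insert[of "replicate (length u) snd" j g] sep_snd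
      by (auto simp: fs_def)
    have "\<bar>snd (u ! j) - snd (v ! j)\<bar> + (if fst (u ! j) = fst (v ! j) then 0 else 1) \<noteq> 0"
      using j(2) by (auto simp: prod_eq_iff abs_if split: if_splits)
    then have "subseq_sum fs u \<noteq> 0"
      using snd_u j by (subst subseq_sum_nonzero_iff) (auto simp: fs_def nth_list_update g_def)
    moreover have "g (v ! j) = 0" by (simp add: g_def)
    then have "subseq_sum fs v = 0"
      using subseq_sum_nonzero_iff[of fs v] j True by (auto simp: fs_def)
    ultimately show ?thesis
      using that[of fs] sep by auto
  qed
  have F: "subseq_sum fs (word_of (wd zs)) = subseq_sum fs zs" if "zs \<in> fat_lists" for zs
    using that fs by (simp add: word_of_wd subseq_sum_reduce)
  have "continuous_map (mtop WD) euclideanreal (\<lambda>Z. subseq_sum fs (word_of Z))"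
  proof (rule continuous_map_from_WD)
    fix w
    have "continuous_map (cube_of w) euclideanreal (\<lambda>t. subseq_sum fs (thicken w t))"
      unfolding thicken_def by (rule continuous_map_subseq_sum[OF fs]) auto
    then show "continuous_map (cube_of w) euclideanreal (\<lambda>t. subseq_sum fs (word_of (wd_cell w t)))"
      by (rule continuous_map_eq) (metis F thicken_in_fat_lists wd_cell_def)
  qed
  with neq show thesis
    using that by (auto simp: u_def v_def)
qed

lemma Hausdorff_space_WD: "Hausdorff_space (mtop WD)"
  unfolding Hausdorff_space_def
proof (intro allI impI, elim conjE)
  fix X Y assume "X \<in> topspace (mtop WD)" "Y \<in> topspace (mtop WD)" and "X \<noteq> Y"
  then have XY: "X \<in> carrier WD" "Y \<in> carrier WD" by auto
  obtain F where F: "continuous_map (mtop WD) euclideanreal F" "F X \<noteq> F Y"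
    using WD_separated[OF XY \<open>X \<noteq> Y\<close>] WD_separated[OF XY(2,1)] \<open>X \<noteq> Y\<close>
    by (metis linorder_le_cases)
  obtain A B :: "real set" where AB: "open A" "open B" "F X \<in> A" "F Y \<in> B" "A \<inter> B = {}"
    using hausdorff[OF F(2)] by auto
  show "\<exists>U V. openin (mtop WD) U \<and> openin (mtop WD) V \<and> X \<in> U \<and> Y \<in> V \<and> disjnt U V"
  proof (intro exI conjI)
    show "openin (mtop WD) {Z \<in> topspace (mtop WD). F Z \<in> A}"
      "openin (mtop WD) {Z \<in> topspace (mtop WD). F Z \<in> B}"
      using AB F(1) by (auto intro!: openin_continuous_map_preimage simp del: topspace_mtop_WD)
  qed (use AB XY in \<open>auto simp: disjnt_def\<close>)
qed

subsection \<open>Compact sets\<close>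

lemma k_space_WD: "k_space (mtop WD)"
  unfolding k_space_open
proof (intro allI impI, elim conjE)
  fix S assume S: "S \<subseteq> topspace (mtop WD)"
    and K: "\<forall>K. compactin (mtop WD) K \<longrightarrow> openin (subtopology (mtop WD) K) (K \<inter> S)"
  have "openin (cube_of w) {t \<in> topspace (cube_of w). wd_cell w t \<in> S}" for w
  proof -
    let ?K = "wd_cell w ` topspace (cube_of w)"
    have "compactin (mtop WD) ?K"
      using continuous_map_wd_cell compact_space_cube by (metis compact_space_def image_compactin)
    with K have "openin (subtopology (mtop WD) ?K) (?K \<inter> S)" by blast
    moreover have "continuous_map (cube_of w) (subtopology (mtop WD) ?K) (wd_cell w)"
      using continuous_map_wd_cell by (auto simp: continuous_map_in_subtopology)
    ultimately have "openin (cube_of w) {t \<in> topspace (cube_of w). wd_cell w t \<in> ?K \<inter> S}"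
      by (rule openin_continuous_map_preimage[rotated])
    moreover have "{t \<in> topspace (cube_of w). wd_cell w t \<in> ?K \<inter> S}
        = {t \<in> topspace (cube_of w). wd_cell w t \<in> S}"
      by blast
    ultimately show ?thesis by simp
  qed
  with S show "openin (mtop WD) S"
    by (simp add: openin_mtop_WD)
qed

lemma length_word_of_wd_cell:
  "t \<in> topspace (cube_of w) \<Longrightarrow> length (word_of (wd_cell w t)) \<le> length w"
  unfolding wd_cell_def word_of_wd[OF thicken_in_fat_lists] reduce_def
  using length_filter_le[of "\<lambda>x. snd x \<noteq> 0" "thicken w t"] by (simp add: thicken_def)

text \<open>A sequence of points of \<open>K\<close> with unbounded lengths would be closed and discrete, as
  each cell meets it in a finite set.\<close>

lemma compactin_WD_bounded_length:
  assumes K: "compactin (mtop WD) K"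
  shows "\<exists>N. \<forall>X \<in> K. length (word_of X) \<le> N"
proof (rule ccontr)
  assume "\<not> ?thesis"
  then have "\<forall>N. \<exists>X. X \<in> K \<and> N < length (word_of X)"
    by (auto simp: not_le)
  then obtain x where x: "\<And>N. x N \<in> K" "\<And>N. N < length (word_of (x N))"
    by metis
  have KC: "K \<subseteq> carrier WD"
    using compactin_subset_topspace[OF K] by simp
  \<comment> \<open>An increasing open cover of the whole space, none of whose members contains \<open>K\<close>.\<close>
  define W where "W = (\<lambda>N. carrier WD - x ` {N..})"
  have "openin (mtop WD) (W N)" for N
    unfolding openin_mtop_WD
  proof (intro conjI allI)
    fix w :: "letter list"
    let ?F = "x ` {N..<length w}"
    have "closedin (mtop WD) ?F"
      using x(1) KC Hausdorff_space_WD by (intro closedin_Hausdorff_finite) auto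
    then have "closedin (cube_of w) {t \<in> topspace (cube_of w). wd_cell w t \<in> ?F}"
      by (rule closedin_continuous_map_preimage[OF continuous_map_wd_cell])
    then have "openin (cube_of w)
        (topspace (cube_of w) - {t \<in> topspace (cube_of w). wd_cell w t \<in> ?F})"
      by blast
    moreover have "wd_cell w t \<in> x ` {N..} \<longleftrightarrow> wd_cell w t \<in> ?F"
      if "t \<in> topspace (cube_of w)" for t
    proof
      assume "wd_cell w t \<in> x ` {N..}"
      then obtain k where k: "N \<le> k" "wd_cell w t = x k" by auto
      with x(2)[of k] length_word_of_wd_cell[OF that] have "k < length w" by simp
      with k show "wd_cell w t \<in> ?F" by auto
    qed auto
    then have "{t \<in> topspace (cube_of w). wd_cell w t \<in> W N}
        = topspace (cube_of w) - {t \<in> topspace (cube_of w). wd_cell w t \<in> ?F}"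
      using wd_cell_in_carrier by (auto simp: W_def simp del: topspace_cube_topology)
    ultimately show "openin (cube_of w) {t \<in> topspace (cube_of w). wd_cell w t \<in> W N}"
      by simp
  qed (auto simp: W_def)
  moreover have "K \<subseteq> \<Union> (range W)"
  proof
    fix X assume "X \<in> K"
    moreover have "X \<notin> x ` {length (word_of X)..}"
      using x(2) by (metis atLeast_iff image_iff leD)
    ultimately show "X \<in> \<Union> (range W)"
      using KC unfolding W_def by blast
  qed
  ultimately obtain \<F> where \<F>: "finite \<F>" "\<F> \<subseteq> range W" "K \<subseteq> \<Union>\<F>"
    using K unfolding compactin_def by (metis (no_types, lifting) imageE)
  then obtain I where I: "finite I" "\<F> = W ` I"
    by (metis finite_subset_image)
  define M where "M = Max (insert 0 I)"
  have "W N \<subseteq> W M" if "N \<in> I" for N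
    using I(1) that by (auto simp: W_def M_def)
  then have "K \<subseteq> W M"
    using \<F>(3) I(2) by blast
  with x(1)[of M] show False
    by (auto simp: W_def)
qed

lemma finite_short_words: "finite {w :: letter list. length w \<le> N}"
proof -
  have "UNIV = {La, Lb}"
    by (auto intro: letter.exhaust)
  then have "finite (UNIV :: letter set)"
    by (metis finite.emptyI finite.insertI)
  then show ?thesis
    using finite_lists_length_le[of "UNIV :: letter set" N] by simp
qed

lemma compactin_WD_finite_cells:
  assumes K: "compactin (mtop WD) K"
  obtains W where "finite W" "K \<subseteq> (\<Union>w \<in> W. wd_cell w ` topspace (cube_of w))"
proof -
  obtain N where N: "\<And>X. X \<in> K \<Longrightarrow> length (word_of X) \<le> N"
    using compactin_WD_bounded_length[OF K] by blast
  show thesis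
  proof (rule that[OF finite_short_words])
    show "K \<subseteq> (\<Union>w \<in> {w. length w \<le> N}. wd_cell w ` topspace (cube_of w))"
    proof
      fix X assume X: "X \<in> K"
      then obtain xs where xs: "xs \<in> fat_lists" "X = wd xs"
        using compactin_subset_topspace[OF K] by (auto simp: carrier_WD)
      let ?ys = "reduce xs"
      let ?t = "\<lambda>k \<in> {..<length ?ys}. snd (?ys ! k)"
      have ys: "?ys \<in> fat_lists"
        using xs by (simp add: reduce_in_fat_lists)
      have "X = wd_cell (map fst ?ys) ?t"
        unfolding wd_cell_def fat_list_is_thickening(1)[OF ys] using xs by (simp add: wd_reduce)
      moreover have "length (map fst ?ys) \<le> N"
        using N[OF X] xs by (simp add: word_of_wd)
      ultimately show "X \<in> (\<Union>w \<in> {w. length w \<le> N}. wd_cell w ` topspace (cube_of w))"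
        using fat_list_is_thickening(2)[OF ys] by blast
    qed
  qed
qed

text \<open>On a compact set covered by finitely many compact pieces, continuity may be tested on the pieces:
  preimages of closed sets are finite unions of compact sets.\<close>

lemma continuous_map_finite_compact_cover:
  assumes Z: "Hausdorff_space Z" and K: "K \<subseteq> topspace Z" and I: "finite I"
    and P: "\<And>i. i \<in> I \<Longrightarrow> compact_space (P i)"
    and c: "\<And>i. i \<in> I \<Longrightarrow> continuous_map (P i) Z (c i)"
    and cover: "K \<subseteq> (\<Union>i \<in> I. c i ` topspace (P i))"
    and f: "\<And>i. i \<in> I \<Longrightarrow> continuous_map (P i) Y (\<lambda>p. f (c i p))"
  shows "continuous_map (subtopology Z K) Y f"
  unfolding continuous_map_closedin
proof (intro conjI allI impI)
  show "f \<in> topspace (subtopology Z K) \<rightarrow> topspace Y"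
  proof
    fix z assume "z \<in> topspace (subtopology Z K)"
    then obtain i p where "i \<in> I" "p \<in> topspace (P i)" "z = c i p"
      using cover by auto
    then show "f z \<in> topspace Y"
      using f[of i] by (auto simp: continuous_map_def)
  qed
  fix A assume A: "closedin Y A"
  let ?B = "\<Union>i \<in> I. c i ` {p \<in> topspace (P i). f (c i p) \<in> A}"
  have "closedin Z (c i ` {p \<in> topspace (P i). f (c i p) \<in> A})" if "i \<in> I" for i
    using closedin_compact_space[OF P[OF that] closedin_continuous_map_preimage[OF f[OF that] A]]
    by (intro compactin_imp_closedin[OF Z] image_compactin[OF _ c[OF that]])
  then have "closedin Z ?B"
    using I by (intro closedin_Union) auto
  then have "closedin (subtopology Z K) (?B \<inter> K)"
    by (auto simp: closedin_subtopology)
  moreover have "z \<in> ?B" if "z \<in> K" "f z \<in> A" for z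
    using subsetD[OF cover that(1)] that(2) by blast
  then have "{z \<in> topspace (subtopology Z K). f z \<in> A} = ?B \<inter> K"
    using K by auto
  ultimately show "closedin (subtopology Z K) {z \<in> topspace (subtopology Z K). f z \<in> A}"
    by simp
qed

subsection \<open>Continuity of the operations\<close>

lemma continuous_map_into_cube:
  "continuous_map X (cube_topology n) f \<longleftrightarrow>
     f \<in> topspace X \<rightarrow> ({..<n} \<rightarrow>\<^sub>E {0..1}) \<and>
     (\<forall>k < n. continuous_map X euclideanreal (\<lambda>x. f x k))"
  unfolding cube_topology_def continuous_map_componentwise
  by (auto simp: continuous_map_in_subtopology PiE_iff Pi_iff image_subset_iff)

lemma continuous_map_cube_coordinate:
  "k < n \<Longrightarrow> continuous_map (cube_topology n) euclideanreal (\<lambda>t. t k)"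
  using continuous_map_into_cube[of "cube_topology n" n "\<lambda>t. t"] by simp

text \<open>A compact subset of the product lies over finitely many pairs of cells, and on a pair of cells the
  multiplication is concatenation of coordinates.\<close>

lemma continuous_map_mult_WD:
  "continuous_map (k_prod_topology (mtop WD) (mtop WD)) (mtop WD) (\<lambda>(x, y). x \<otimes>\<^bsub>WD\<^esub> y)"
proof (rule continuous_map_from_k_space)
  let ?Z = "k_prod_topology (mtop WD) (mtop WD)"
  note H = Hausdorff_space_WD
  show "k_space ?Z" using H H by (rule k_space_k_prod_topology)
  fix K assume K: "compactin ?Z K"
  have "continuous_map ?Z (mtop WD) fst" "continuous_map ?Z (mtop WD) snd"
    by (auto intro: continuous_map_from_k_prod continuous_map_fst continuous_map_snd)
  then have "compactin (mtop WD) (fst ` K)" "compactin (mtop WD) (snd ` K)"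
    using K image_compactin by blast+
  then obtain W1 W2 where W: "finite W1" "finite W2"
    "fst ` K \<subseteq> (\<Union>w \<in> W1. wd_cell w ` topspace (cube_of w))"
    "snd ` K \<subseteq> (\<Union>w \<in> W2. wd_cell w ` topspace (cube_of w))"
    by (elim compactin_WD_finite_cells) blast
  let ?P = "\<lambda>i. prod_topology (cube_of (fst i)) (cube_of (snd i))"
  let ?c = "\<lambda>i t. (wd_cell (fst i) (fst t), wd_cell (snd i) (snd t))"
  show "continuous_map (subtopology ?Z K) (mtop WD) (\<lambda>(x, y). x \<otimes>\<^bsub>WD\<^esub> y)"
    unfolding case_prod_unfold
  proof (rule continuous_map_finite_compact_cover[where I = "W1 \<times> W2" and P = ?P and c = ?c])
    show "Hausdorff_space ?Z"
      using H by (simp add: k_prod_topology_def Hausdorff_space_kification Hausdorff_space_prod_topology)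
    show "K \<subseteq> topspace ?Z"
      using K by (rule compactin_subset_topspace)
    show "K \<subseteq> (\<Union>i \<in> W1 \<times> W2. ?c i ` topspace (?P i))"
    proof
      fix z assume z: "z \<in> K"
      then have "fst z \<in> (\<Union>w \<in> W1. wd_cell w ` topspace (cube_of w))"
        "snd z \<in> (\<Union>w \<in> W2. wd_cell w ` topspace (cube_of w))"
        using W(3,4) by blast+
      then obtain w1 t1 w2 t2 where "w1 \<in> W1" "t1 \<in> topspace (cube_of w1)" "fst z = wd_cell w1 t1"
        "w2 \<in> W2" "t2 \<in> topspace (cube_of w2)" "snd z = wd_cell w2 t2"
        by blast
      then show "z \<in> (\<Union>i \<in> W1 \<times> W2. ?c i ` topspace (?P i))"
        by (intro UN_I[of "(w1, w2)"] image_eqI[of _ _ "(t1, t2)"])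
           (simp_all add: prod_eq_iff del: topspace_cube_topology)
    qed
    fix i :: "letter list \<times> letter list"
    obtain w1 w2 where i: "i = (w1, w2)" by (cases i)
    let ?P = "prod_topology (cube_of w1) (cube_of w2)"
    have P: "compact_space ?P"
      by (simp add: compact_space_prod_topology compact_space_cube)
    then show "compact_space (prod_topology (cube_of (fst i)) (cube_of (snd i)))"
      by (simp add: i)
    have 1: "continuous_map ?P (mtop WD) (\<lambda>t. wd_cell w1 (fst t))"
      by (intro continuous_map_wd_cell_compose continuous_map_fst)
    have 2: "continuous_map ?P (mtop WD) (\<lambda>t. wd_cell w2 (snd t))"
      by (intro continuous_map_wd_cell_compose continuous_map_snd)
    show "continuous_map (prod_topology (cube_of (fst i)) (cube_of (snd i))) ?Z (?c i)"
      using continuous_map_into_k_prod[OF compact_imp_k_space[OF P] H H 1 2]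
      by (simp add: i)
    let ?cat = "\<lambda>t. \<lambda>k \<in> {..<length (w1 @ w2)}. if k < length w1 then fst t k else snd t (k - length w1)"
    have cat: "thicken w1 (fst t) @ thicken w2 (snd t) = thicken (w1 @ w2) (?cat t)" for t
      by (rule nth_equalityI) (auto simp: thicken_def nth_append)
    have "continuous_map ?P euclideanreal (\<lambda>t. ?cat t k)" if "k < length (w1 @ w2)" for k
    proof (cases "k < length w1")
      case True
      with continuous_map_compose[OF continuous_map_fst continuous_map_cube_coordinate[OF True]]
      show ?thesis by (simp add: o_def)
    next
      case False
      with that have "k - length w1 < length w2" by auto
      from continuous_map_compose[OF continuous_map_snd continuous_map_cube_coordinate[OF this]]
      show ?thesis using False that by (simp add: o_def)
    qed
    then have "continuous_map ?P (cube_of (w1 @ w2)) ?cat"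
      unfolding continuous_map_into_cube by (auto simp: PiE_iff)
    then have 3: "continuous_map ?P (mtop WD) (\<lambda>t. wd_cell (w1 @ w2) (?cat t))"
      by (rule continuous_map_wd_cell_compose)
    have "continuous_map ?P (mtop WD) (\<lambda>t. wd_cell w1 (fst t) \<otimes>\<^bsub>WD\<^esub> wd_cell w2 (snd t))"
    proof (rule continuous_map_eq[OF 3])
      fix t assume "t \<in> topspace ?P"
      then have "thicken w1 (fst t) \<in> fat_lists" "thicken w2 (snd t) \<in> fat_lists"
        by (auto simp del: topspace_cube_topology)
      then show "wd_cell (w1 @ w2) (?cat t) = wd_cell w1 (fst t) \<otimes>\<^bsub>WD\<^esub> wd_cell w2 (snd t)"
        by (simp only: wd_cell_def mult_WD cat)
    qed
    then show "continuous_map (prod_topology (cube_of (fst i)) (cube_of (snd i))) (mtop WD)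
        (\<lambda>p. fst (?c i p) \<otimes>\<^bsub>WD\<^esub> snd (?c i p))"
      by (simp add: i)
  qed (use W in auto)
qed

lemma continuous_map_wd_scale:
  "continuous_map (prod_topology (top_of_set {0..1}) (mtop WD)) (mtop WD) (\<lambda>(s, x). wd_scale s x)"
proof (rule continuous_map_from_k_space)
  let ?Z = "prod_topology (top_of_set {0..1::real}) (mtop WD)"
  have I: "compact_space (top_of_set {0..1::real})" "Hausdorff_space (top_of_set {0..1::real})"
    by (auto simp: compact_space_subtopology Hausdorff_space_subtopology)
  show "k_space ?Z"
    using I k_space_WD by (intro k_space_prod_topology_left compact_imp_locally_compact_space) auto
  fix K assume K: "compactin ?Z K"
  have "compactin (mtop WD) (snd ` K)"
    using K continuous_map_snd image_compactin by blast
  then obtain W where W: "finite W" "snd ` K \<subseteq> (\<Union>w \<in> W. wd_cell w ` topspace (cube_of w))"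
    by (rule compactin_WD_finite_cells)
  show "continuous_map (subtopology ?Z K) (mtop WD) (\<lambda>(s, x). wd_scale s x)"
  proof (rule continuous_map_finite_compact_cover[where I = W
        and P = "\<lambda>w. prod_topology (top_of_set {0..1}) (cube_of w)"
        and c = "\<lambda>w (s, t). (s, wd_cell w t)"])
    show "Hausdorff_space ?Z"
      using I Hausdorff_space_WD by (simp add: Hausdorff_space_prod_topology)
    show KZ: "K \<subseteq> topspace ?Z"
      using K by (rule compactin_subset_topspace)
    show "K \<subseteq> (\<Union>w \<in> W. (\<lambda>(s, t). (s, wd_cell w t)) `
        topspace (prod_topology (top_of_set {0..1}) (cube_of w)))"
    proof
      fix z assume z: "z \<in> K"
      then obtain w t where "w \<in> W" "t \<in> topspace (cube_of w)" "snd z = wd_cell w t"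
        using W(2) by blast
      moreover have "fst z \<in> {0..1}"
        using z KZ by auto
      ultimately show "z \<in> (\<Union>w \<in> W. (\<lambda>(s, t). (s, wd_cell w t)) `
        topspace (prod_topology (top_of_set {0..1}) (cube_of w)))"
        by (intro UN_I[of w] image_eqI[of _ _ "(fst z, t)"])
           (auto simp: prod_eq_iff simp del: topspace_cube_topology)
    qed
    fix w :: "letter list"
    let ?P = "prod_topology (top_of_set {0..1::real}) (cube_of w)"
    show P: "compact_space ?P"
      using I by (simp add: compact_space_prod_topology compact_space_cube)
    have "continuous_map ?P (mtop WD) (\<lambda>t. wd_cell w (snd t))"
      by (intro continuous_map_wd_cell_compose continuous_map_snd)
    then show "continuous_map ?P ?Z (\<lambda>(s, t). (s, wd_cell w t))"
      using continuous_map_fst by (auto simp: case_prod_unfold continuous_map_pairwise o_def)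
    let ?mul = "\<lambda>p. \<lambda>k \<in> {..<length w}. fst p * snd p k"
    have mul: "scale_list (fst p) (thicken w (snd p)) = thicken w (?mul p)" for p
      by (rule nth_equalityI) (auto simp: thicken_def scale_list_def)
    have "continuous_map ?P euclideanreal (\<lambda>p. ?mul p k)" if "k < length w" for k
    proof -
      have "continuous_map ?P euclideanreal fst"
        using continuous_map_fst[of "top_of_set {0..1::real}" "cube_of w"]
        by (simp add: continuous_map_in_subtopology)
      moreover have "continuous_map ?P euclideanreal (\<lambda>p. snd p k)"
        using continuous_map_compose[OF continuous_map_snd continuous_map_cube_coordinate[OF that]]
        by (simp add: o_def)
      ultimately show ?thesis
        using that by (simp add: continuous_map_real_mult)
    qed
    then have "continuous_map ?P (cube_of w) ?mul"
      unfolding continuous_map_into_cube by (auto simp: PiE_iff mult_le_one)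
    then have 3: "continuous_map ?P (mtop WD) (\<lambda>p. wd_cell w (?mul p))"
      by (rule continuous_map_wd_cell_compose)
    have "continuous_map ?P (mtop WD) (\<lambda>p. wd_scale (fst p) (wd_cell w (snd p)))"
    proof (rule continuous_map_eq[OF 3])
      fix p assume "p \<in> topspace ?P"
      then have "thicken w (snd p) \<in> fat_lists" "fst p \<in> {0..1}"
        by (auto simp del: topspace_cube_topology)
      then show "wd_cell w (?mul p) = wd_scale (fst p) (wd_cell w (snd p))"
        by (simp only: wd_cell_def wd_scale_wd mul)
    qed
    then show "continuous_map ?P (mtop WD)
        (\<lambda>p. case case p of (s, t) \<Rightarrow> (s, wd_cell w t) of (s, x) \<Rightarrow> wd_scale s x)"
      by (simp add: case_prod_unfold)
  qed (use W in auto)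
qed

lemma intersection_monoid_WD: "intersection_monoid WD"
proof (intro intersection_monoid.intro intersection_monoid_axioms.intro)
  show "monoid WD" by (rule monoid_WD)
  show "cgwh_space (mtop WD)"
    using Hausdorff_space_WD k_space_WD by (rule cgwh_space_if_Hausdorff)
  show "continuous_map (k_prod_topology (mtop WD) (mtop WD)) (mtop WD) (\<lambda>(x, y). x \<otimes>\<^bsub>WD\<^esub> y)"
    by (rule continuous_map_mult_WD)
next
  fix x assume "x \<in> carrier WD"
  then show "meets WD x x"
    by (auto simp: carrier_WD meets_wd word_disjoint_def)
next
  fix x y assume "x \<in> carrier WD" "y \<in> carrier WD" "meets WD x y"
  then show "meets WD y x"
    by (auto simp: carrier_WD meets_wd word_disjoint_def)
next
  fix x1 y1 x2 y2
  assume "x1 \<in> carrier WD" "y1 \<in> carrier WD" "x2 \<in> carrier WD" "y2 \<in> carrier WD"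
    and "meets WD (x1 \<otimes>\<^bsub>WD\<^esub> y1) (x2 \<otimes>\<^bsub>WD\<^esub> y2)"
  then show "meets WD x1 x2"
    using word_disjoint_append by (fastforce simp: carrier_WD mult_WD meets_wd)
next
  fix x y1 y2
  assume "x \<in> carrier WD" "y1 \<in> carrier WD" "y2 \<in> carrier WD"
    and "meets WD (x \<otimes>\<^bsub>WD\<^esub> y1) (x \<otimes>\<^bsub>WD\<^esub> y2)"
  then show "meets WD y1 y2"
    using word_disjoint_append_left by (fastforce simp: carrier_WD mult_WD meets_wd)
qed simp

section \<open>Operads of tables\<close>

lemma group_actionI:
  assumes "group H"
    and ext: "\<And>h. h \<in> carrier H \<Longrightarrow> \<phi> h \<in> extensional E"
    and closed: "\<And>h x. h \<in> carrier H \<Longrightarrow> x \<in> E \<Longrightarrow> \<phi> h x \<in> E"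
    and one: "\<And>x. x \<in> E \<Longrightarrow> \<phi> \<one>\<^bsub>H\<^esub> x = x"
    and mult: "\<And>h k x. h \<in> carrier H \<Longrightarrow> k \<in> carrier H \<Longrightarrow> x \<in> E \<Longrightarrow>
      \<phi> (h \<otimes>\<^bsub>H\<^esub> k) x = \<phi> h (\<phi> k x)"
  shows "group_action H E \<phi>"
proof -
  interpret H: group H by fact
  have Bij: "\<phi> h \<in> Bij E" if h: "h \<in> carrier H" for h
  proof -
    have "bij_betw (\<phi> h) E E"
    proof (rule bij_betwI[where g = "\<phi> (inv\<^bsub>H\<^esub> h)"])
      fix x assume "x \<in> E"
      then show "\<phi> (inv\<^bsub>H\<^esub> h) (\<phi> h x) = x" "\<phi> h (\<phi> (inv\<^bsub>H\<^esub> h) x) = x"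
        using h by (simp_all add: mult[symmetric] one)
    qed (use h closed in auto)
    with ext[OF h] show ?thesis by (simp add: Bij_def)
  qed
  have "\<phi> (h \<otimes>\<^bsub>H\<^esub> k) = compose E (\<phi> h) (\<phi> k)" if "h \<in> carrier H" "k \<in> carrier H" for h k
  proof (rule extensionalityI[of _ E])
    show "\<phi> (h \<otimes>\<^bsub>H\<^esub> k) \<in> extensional E"
      using ext that by simp
  qed (use that mult in \<open>auto simp: compose_def\<close>)
  with Bij have "\<phi> \<in> hom H (BijGroup E)"
    by (auto simp: hom_def BijGroup_def)
  then show ?thesis
    by (intro group_action.intro group_hom.intro group_hom_axioms.intro \<open>group H\<close> group_BijGroup)
qed

subsection \<open>Suboperads\<close>

text \<open>The levels stay compactly generated because the subspaces are given their k-ification;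
  continuity is inherited through its universal property.\<close>

lemma g_operad_suboperad:
  fixes G (structure)
  assumes Q: "g_operad G Q" and H: "\<And>n. Hausdorff_space (level Q n)"
    and act: "\<And>n p x. p \<in> carrier (G \<times>\<times> sym_group n) \<Longrightarrow> x \<in> topspace (level Q n) \<Longrightarrow> x \<in> S n \<Longrightarrow>
      act Q n p x \<in> S n"
    and unit: "opunit Q \<in> S 1"
    and pcomp: "\<And>n m i x y. i \<in> {1..n} \<Longrightarrow> x \<in> topspace (level Q n) \<Longrightarrow> x \<in> S n \<Longrightarrow>
      y \<in> topspace (level Q m) \<Longrightarrow> y \<in> S m \<Longrightarrow> pcomp Q n m i x y \<in> S (n + m - 1)"
  shows "g_operad G (suboperad Q S)"
proof -
  interpret Q: g_operad G Q by (rule Q)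
  let ?R = "suboperad Q S"
  have lev: "level ?R n = k_subtopology (level Q n) (S n)" for n
    by (simp add: suboperad_def)
  have top: "topspace (level ?R n) = topspace (level Q n) \<inter> S n" for n
    by (simp add: lev)
  have act_eq: "act ?R n p x = act Q n p x" if "x \<in> topspace (level Q n)" "x \<in> S n" for n p x
    using that by (simp add: suboperad_def)
  have comp_eq: "pcomp ?R = pcomp Q" "opunit ?R = opunit Q"
    by (simp_all add: suboperad_def)
  have act_in: "act Q n p x \<in> topspace (level Q n)"
    if "p \<in> carrier (G \<times>\<times> sym_group n)" "x \<in> topspace (level Q n)" for n p x
    using group_action.element_image[OF Q.action that] by simp
  have HR: "Hausdorff_space (level ?R n)" "k_space (level ?R n)" for n
    using H by (simp_all add: lev Hausdorff_space_k_subtopology k_space_k_subtopology)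
  have pcomp_in: "pcomp Q n m i x y \<in> topspace (level Q (n + m - 1))"
    if "i \<in> {1..n}" "x \<in> topspace (level Q n)" "y \<in> topspace (level Q m)" for n m i x y
    using funcset_mem[OF continuous_map_funspace[OF Q.pcomp_continuous[OF that(1), of m]],
        of "(x, y)"] that by simp
  show ?thesis
  proof (intro g_operad.intro g_operad_axioms.intro)
    show "group G" by (rule Q.is_group)
    show "cgwh_space (level ?R n)" for n
      using HR by (rule cgwh_space_if_Hausdorff)
    show "group_action (G \<times>\<times> sym_group n) (topspace (level ?R n)) (act ?R n)" for n
    proof (rule group_actionI)
      show "group (G \<times>\<times> sym_group n)"
        by (intro DirProd_group Q.is_group sym_group_is_group)
      then have one: "\<one>\<^bsub>G \<times>\<times> sym_group n\<^esub> \<in> carrier (G \<times>\<times> sym_group n)"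
        by (simp add: group.is_monoid monoid.one_closed del: carrier_DirProd one_DirProd)
      fix p x assume x: "x \<in> topspace (level ?R n)"
      then show "act ?R n \<one>\<^bsub>G \<times>\<times> sym_group n\<^esub> x = x"
        using group_action.id_eq_one[OF Q.action, of n] by (metis IntE act_eq restrict_apply' top)
      assume p: "p \<in> carrier (G \<times>\<times> sym_group n)"
      then show px: "act ?R n p x \<in> topspace (level ?R n)"
        using x act_in act by (simp add: top act_eq del: carrier_DirProd)
      fix q assume q: "q \<in> carrier (G \<times>\<times> sym_group n)"
      show "act ?R n (q \<otimes>\<^bsub>G \<times>\<times> sym_group n\<^esub> p) x = act ?R n q (act ?R n p x)"
        using x px p q group_action.composition_rule[OF Q.action]
        by (simp add: top act_eq del: carrier_DirProd)
    qed (auto simp: suboperad_def)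
    show "continuous_map (level ?R n) (level ?R n) (act ?R n p)"
      if p: "p \<in> carrier (G \<times>\<times> sym_group n)" for n p
    proof -
      have "continuous_map (level ?R n) (level Q n) (act Q n p)"
        unfolding lev using p by (intro continuous_map_from_k_subtopology Q.act_continuous)
      then have "continuous_map (level ?R n) (level ?R n) (act Q n p)"
        using HR H act p unfolding lev
        by (intro continuous_map_into_k_subtopology) (auto simp del: carrier_DirProd)
      then show ?thesis
        by (rule continuous_map_eq) (simp add: top act_eq)
    qed
    show "continuous_map (k_prod_topology (level ?R n) (level ?R m)) (level ?R (n + m - 1))
        (\<lambda>(x, y). pcomp ?R n m i x y)" if i: "i \<in> {1..n}" for n m i
    proof -
      let ?Z = "k_prod_topology (level ?R n) (level ?R m)"
      have Z: "k_space ?Z"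
        using HR by (simp add: k_space_k_prod_topology)
      have 1: "continuous_map (level ?R k) (level Q k) (\<lambda>x. x)" for k
        unfolding lev by (intro continuous_map_from_k_subtopology) simp
      have "continuous_map ?Z (level Q n) fst" "continuous_map ?Z (level Q m) snd"
        using continuous_map_compose[OF continuous_map_fst 1[of n]]
          continuous_map_compose[OF continuous_map_snd 1[of m]]
        by (auto intro!: continuous_map_from_k_prod simp: o_def)
      then have "continuous_map ?Z (k_prod_topology (level Q n) (level Q m)) (\<lambda>z. (fst z, snd z))"
        using Z H by (intro continuous_map_into_k_prod)
      then have "continuous_map ?Z (level Q (n + m - 1)) (\<lambda>(x, y). pcomp Q n m i x y)"
        by (rule continuous_map_eq[OF continuous_map_compose[OF _ Q.pcomp_continuous[OF i, of m]]]) auto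
      then show ?thesis
        unfolding comp_eq lev[of "n + m - 1"] using i pcomp Z H
        by (intro continuous_map_into_k_subtopology) (auto simp: top)
    qed
    show "opunit ?R \<in> topspace (level ?R 1)"
      using Q.unit_in unit by (simp add: top comp_eq)
    show "act ?R 1 (g, id) (opunit ?R) = opunit ?R" if "g \<in> carrier G" for g
      using Q.unit_in unit Q.unit_fixed that by (simp add: act_eq comp_eq)
  next
    fix x y n m i g \<sigma> \<rho>
    assume x: "x \<in> topspace (level ?R n)" and y: "y \<in> topspace (level ?R m)"
      and "i \<in> {1..n}" "g \<in> carrier G" "\<sigma> \<in> carrier (sym_group n)" "\<rho> \<in> carrier (sym_group m)"
    then show "pcomp ?R n m (\<sigma> i) (act ?R n (g, \<sigma>) x) (act ?R m (g, \<rho>) y)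
        = act ?R (n + m - 1) (g, perm_pcomp n m i \<sigma> \<rho>) (pcomp ?R n m i x y)"
      using Q.pcomp_equivariant pcomp pcomp_in by (simp add: top act_eq comp_eq)
  qed (simp_all only: top comp_eq Int_iff Q.pcomp_unit_left Q.pcomp_unit_right Q.pcomp_assoc_seq
      Q.pcomp_assoc_par)
qed

subsection \<open>Block permutations\<close>

text \<open>The inserted block goes onto the block starting at \<open>\<sigma> i\<close> and every other position outside of
  that block, so it suffices to prove injectivity on each of the two parts.\<close>

lemma perm_pcomp_permutes:
  assumes i: "i \<in> {1..n}" and \<sigma>: "\<sigma> permutes {1..n}" and \<rho>: "\<rho> permutes {1..m}"
  shows "perm_pcomp n m i \<sigma> \<rho> permutes {1..n + m - 1}"
proof -
  let ?\<pi> = "perm_pcomp n m i \<sigma> \<rho>"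
  have \<sigma>_in: "\<sigma> k \<in> {1..n} \<longleftrightarrow> k \<in> {1..n}" and \<rho>_in: "\<rho> k \<in> {1..m} \<longleftrightarrow> k \<in> {1..m}" for k
    using permutes_in_image[OF \<sigma>] permutes_in_image[OF \<rho>] by auto
  have \<sigma>_inj: "\<sigma> k = \<sigma> l \<longleftrightarrow> k = l" and \<rho>_inj: "\<rho> k = \<rho> l \<longleftrightarrow> k = l" for k l
    using permutes_inj[OF \<sigma>] permutes_inj[OF \<rho>] by (auto simp: inj_eq)
  define c where "c j = (if j < i then j else j + 1 - m)" for j
  have block: "?\<pi> j = \<sigma> i + \<rho> (j + 1 - i) - 1 \<and> \<rho> (j + 1 - i) \<in> {1..m}"
    if "j \<in> {1..n + m - 1}" "i \<le> j" "j < i + m" for j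
    using that \<rho>_in[of "j + 1 - i"] by (auto simp: perm_pcomp_def)
  have outer: "?\<pi> j = (if \<sigma> (c j) < \<sigma> i then \<sigma> (c j) else \<sigma> (c j) + m - 1) \<and>
      \<sigma> (c j) \<noteq> \<sigma> i \<and> \<sigma> (c j) \<in> {1..n} "
    if "j \<in> {1..n + m - 1}" "\<not> (i \<le> j \<and> j < i + m)" for j
  proof -
    have "c j \<in> {1..n}" "c j \<noteq> i"
      using that i by (auto simp: c_def)
    then have "\<sigma> (c j) \<noteq> \<sigma> i" "\<sigma> (c j) \<in> {1..n}"
      using \<sigma>_in \<sigma>_inj by blast+
    moreover have "?\<pi> j = (if \<sigma> (c j) < \<sigma> i then \<sigma> (c j) else \<sigma> (c j) + m - 1)"
      using that by (auto simp: perm_pcomp_def c_def Let_def)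
    ultimately show ?thesis by blast
  qed
  have i': "\<sigma> i \<in> {1..n}" using \<sigma>_in i by blast
  have block_range: "\<sigma> i \<le> ?\<pi> j \<and> ?\<pi> j < \<sigma> i + m"
    if j: "j \<in> {1..n + m - 1}" "i \<le> j \<and> j < i + m" for j
  proof -
    obtain r where "?\<pi> j = \<sigma> i + r - 1" "r \<in> {1..m}"
      using block[of j] j by blast
    then show ?thesis by auto
  qed
  have outer_range: "?\<pi> j < \<sigma> i \<or> \<sigma> i + m \<le> ?\<pi> j"
    if "j \<in> {1..n + m - 1}" "\<not> (i \<le> j \<and> j < i + m)" for j
    using outer[OF that] by auto
  have inj: "inj_on ?\<pi> {1..n + m - 1}"
  proof (rule inj_onI)
    fix j k assume j: "j \<in> {1..n + m - 1}" and k: "k \<in> {1..n + m - 1}" and eq: "?\<pi> j = ?\<pi> k"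
    consider "i \<le> j \<and> j < i + m" "i \<le> k \<and> k < i + m"
      | "i \<le> j \<and> j < i + m" "\<not> (i \<le> k \<and> k < i + m)"
      | "\<not> (i \<le> j \<and> j < i + m)" "i \<le> k \<and> k < i + m"
      | "\<not> (i \<le> j \<and> j < i + m)" "\<not> (i \<le> k \<and> k < i + m)"
      by blast
    then show "j = k"
    proof cases
      case 1
      have *: "a = b" if "s + a - 1 = s + b - 1" "a \<in> {1..m}" "b \<in> {1..m}" for s a b :: nat
        using that by auto
      have "\<rho> (j + 1 - i) = \<rho> (k + 1 - i)"
        by (rule *[of "\<sigma> i"]) (use 1 block[OF j] block[OF k] eq in metis)+
      with 1 show ?thesis by (auto simp: \<rho>_inj)
    next
      case 2
      then show ?thesis
        using block_range[OF j] outer_range[OF k] eq by simp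
    next
      case 3
      then show ?thesis
        using block_range[OF k] outer_range[OF j] eq by simp
    next
      case 4
      then have "\<sigma> (c j) = \<sigma> (c k)"
        using outer[OF j] outer[OF k] eq by (auto split: if_splits)
      then have "c j = c k" by (simp add: \<sigma>_inj)
      with 4 i show ?thesis by (auto simp: c_def split: if_splits)
    qed
  qed
  have "?\<pi> j \<in> {1..n + m - 1}" if j: "j \<in> {1..n + m - 1}" for j
  proof (cases "i \<le> j \<and> j < i + m")
    case True
    then show ?thesis using block_range[OF j] i' by auto
  next
    case False
    then show ?thesis using outer[OF j] i' by (auto split: if_splits)
  qed
  then have "?\<pi> ` {1..n + m - 1} = {1..n + m - 1}"
    using inj by (intro endo_inj_surj) auto
  with inj have "bij_betw ?\<pi> {1..n + m - 1} {1..n + m - 1}"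
    by (simp add: bij_betw_def)
  then show ?thesis
    by (rule bij_imp_permutes) (simp add: perm_pcomp_def)
qed

subsection \<open>The operad of all tables\<close>

text \<open>Hausdorffness makes every space of tables Hausdorff, so that k-ification has its universal property
  throughout.\<close>

locale coinduction_context = G: group G + M: intersection_monoid M
  for G :: "('g, 'b) monoid_scheme" (structure) and M :: "'m top_monoid" +
  assumes Hausdorff_mtop: "Hausdorff_space (mtop M)"
begin

definition tables :: "nat \<Rightarrow> ('g \<times> nat \<Rightarrow> 'm) set" where
  "tables n = carrier G \<times> {1..n} \<rightarrow>\<^sub>E carrier M"

definition table_space :: "nat \<Rightarrow> ('g \<times> nat \<Rightarrow> 'm) topology" where
  "table_space n = product_topology (\<lambda>_. mtop M) (carrier G \<times> {1..n})"

abbreviation Op where "Op \<equiv> O_operad G M"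

lemma topspace_table_space [simp]: "topspace (table_space n) = tables n"
  by (simp add: table_space_def tables_def M.topspace_mtop)

lemma level_O: "level Op n = kification (table_space n)"
  by (simp add: O_operad_def table_space_def)

lemma topspace_level_O [simp]: "topspace (level Op n) = tables n"
  by (simp add: level_O)

lemma Hausdorff_table_space: "Hausdorff_space (table_space n)"
  unfolding table_space_def Hausdorff_space_product_topology using Hausdorff_mtop by blast

lemma Hausdorff_level_O: "Hausdorff_space (level Op n)"
  by (simp add: level_O Hausdorff_space_kification Hausdorff_table_space)

lemma k_space_level_O: "k_space (level Op n)"
  by (simp add: level_O k_space_kification Hausdorff_table_space)

lemma table_in: "x \<in> tables n \<Longrightarrow> g \<in> carrier G \<Longrightarrow> i \<in> {1..n} \<Longrightarrow> x (g, i) \<in> carrier M"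
  by (auto simp: tables_def)

lemma table_eqI:
  assumes "x \<in> tables n" "y \<in> tables n"
    and "\<And>g i. g \<in> carrier G \<Longrightarrow> i \<in> {1..n} \<Longrightarrow> x (g, i) = y (g, i)"
  shows "x = y"
  by (rule extensionalityI[of _ "carrier G \<times> {1..n}"]) (use assms in \<open>auto simp: tables_def PiE_def\<close>)

lemma restrict_in_tables:
  "(\<And>g i. g \<in> carrier G \<Longrightarrow> i \<in> {1..n} \<Longrightarrow> f (g, i) \<in> carrier M) \<Longrightarrow>
    restrict f (carrier G \<times> {1..n}) \<in> tables n"
  by (auto simp: tables_def)

lemma continuous_map_entry:
  assumes "g \<in> carrier G" "i \<in> {1..n}"
  shows "continuous_map (level Op n) (mtop M) (\<lambda>x. x (g, i))"
  unfolding level_O table_space_def using assms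
  by (intro continuous_map_from_kification continuous_map_product_projection) auto

lemma continuous_map_into_table_space:
  assumes "f \<in> topspace Z \<rightarrow> tables n"
    and "\<And>g i. g \<in> carrier G \<Longrightarrow> i \<in> {1..n} \<Longrightarrow> continuous_map Z (mtop M) (\<lambda>z. f z (g, i))"
  shows "continuous_map Z (table_space n) f"
  unfolding table_space_def continuous_map_componentwise using assms
  by (auto simp: tables_def PiE_def)

lemma continuous_map_into_level_O:
  assumes "k_space Z" "f \<in> topspace Z \<rightarrow> tables n"
    and "\<And>g i. g \<in> carrier G \<Longrightarrow> i \<in> {1..n} \<Longrightarrow> continuous_map Z (mtop M) (\<lambda>z. f z (g, i))"
  shows "continuous_map Z (level Op n) f"
  unfolding level_O using assms Hausdorff_table_space
  by (intro continuous_map_into_kification continuous_map_into_table_space)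

lemma continuous_map_mult:
  assumes "k_space Z" "continuous_map Z (mtop M) f" "continuous_map Z (mtop M) h"
  shows "continuous_map Z (mtop M) (\<lambda>z. f z \<otimes>\<^bsub>M\<^esub> h z)"
  using continuous_map_compose[OF continuous_map_into_k_prod[OF assms(1) Hausdorff_mtop Hausdorff_mtop
        assms(2,3)] M.mult_continuous]
  by (simp add: o_def)

lemma act_O:
  assumes "x \<in> tables n" "\<sigma> permutes {1..n}"
  shows "act Op n (g, \<sigma>) x = (\<lambda>(k, i) \<in> carrier G \<times> {1..n}. x (inv g \<otimes> k, inv' \<sigma> i))"
  using assms by (simp add: O_operad_def tables_def M.topspace_mtop sym_group_carrier)

lemma permutes_inv_in:
  assumes "\<sigma> permutes {1..n::nat}" "i \<in> {1..n}" shows "inv' \<sigma> i \<in> {1..n}"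
  using permutes_in_image[OF permutes_inv[OF assms(1)], of i] assms(2) by simp

lemma permutes_in: "\<sigma> permutes {1..n::nat} \<Longrightarrow> i \<in> {1..n} \<Longrightarrow> \<sigma> i \<in> {1..n}"
  by (simp add: permutes_in_image del: atLeastAtMost_iff)

lemma act_O_apply:
  assumes "x \<in> tables n" "\<sigma> permutes {1..n}" "g \<in> carrier G" "k \<in> carrier G" "i \<in> {1..n}"
  shows "act Op n (g, \<sigma>) x (g \<otimes> k, \<sigma> i) = x (k, i)"
proof -
  have "\<sigma> i \<in> {1..n}" using assms(2,5) by (rule permutes_in)
  moreover have "inv g \<otimes> (g \<otimes> k) = k"
    using assms by (simp add: G.m_assoc[symmetric])
  ultimately show ?thesis
    using assms by (simp add: act_O permutes_inverses)
qed

lemma act_O_in: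
  assumes "x \<in> tables n" "\<sigma> permutes {1..n}" "g \<in> carrier G"
  shows "act Op n (g, \<sigma>) x \<in> tables n"
  unfolding act_O[OF assms(1,2)]
proof (rule restrict_in_tables)
  fix k i assume "k \<in> carrier G" "i \<in> {1..n}"
  then show "(case (k, i) of (k, i) \<Rightarrow> x (inv g \<otimes> k, inv' \<sigma> i)) \<in> carrier M"
    using assms permutes_inv_in[OF assms(2)] by (simp add: table_in)
qed

text \<open>Every row and every position is of the form \<open>g k\<close>, \<open>\<sigma> i\<close>, so that no inverses are needed.\<close>

lemma act_O_unique:
  assumes x: "x \<in> tables n" and \<sigma>: "\<sigma> permutes {1..n}" and g: "g \<in> carrier G" and y: "y \<in> tables n"
    and eq: "\<And>k i. k \<in> carrier G \<Longrightarrow> i \<in> {1..n} \<Longrightarrow> y (g \<otimes> k, \<sigma> i) = x (k, i)"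
  shows "act Op n (g, \<sigma>) x = y"
proof (rule table_eqI[OF act_O_in[OF x \<sigma> g] y])
  fix k i assume k: "k \<in> carrier G" and i: "i \<in> {1..n}"
  define k' i' where "k' = inv g \<otimes> k" and "i' = inv' \<sigma> i"
  have "k' \<in> carrier G" "k = g \<otimes> k'"
    using g k by (simp_all add: k'_def G.m_assoc[symmetric])
  moreover have "i' \<in> {1..n}" "i = \<sigma> i'"
    using i \<sigma> permutes_inv_in[OF \<sigma>] by (simp_all add: i'_def permutes_inverses)
  ultimately show "act Op n (g, \<sigma>) x (k, i) = y (k, i)"
    using act_O_apply[OF x \<sigma> g] eq by simp
qed

lemma group_action_O: "group_action (G \<times>\<times> sym_group n) (tables n) (act Op n)"
proof (rule group_actionI)
  show "group (G \<times>\<times> sym_group n)"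
    by (intro DirProd_group G.is_group sym_group_is_group)
  fix p assume "p \<in> carrier (G \<times>\<times> sym_group n)"
  then obtain g \<sigma> where p: "p = (g, \<sigma>)" and g: "g \<in> carrier G" and \<sigma>: "\<sigma> permutes {1..n}"
    by (auto simp: sym_group_carrier)
  show "act Op n p \<in> extensional (tables n)"
    by (simp add: p O_operad_def tables_def M.topspace_mtop)
  fix x assume x: "x \<in> tables n"
  then show px: "act Op n p x \<in> tables n"
    unfolding p using act_O_in \<sigma> g by blast
  fix q assume "q \<in> carrier (G \<times>\<times> sym_group n)"
  then obtain h \<rho> where q: "q = (h, \<rho>)" and h: "h \<in> carrier G" and \<rho>: "\<rho> permutes {1..n}"
    by (auto simp: sym_group_carrier)
  have "act Op n (h \<otimes> g, \<rho> \<circ> \<sigma>) x = act Op n (h, \<rho>) (act Op n (g, \<sigma>) x)"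
  proof (rule act_O_unique[OF x permutes_compose[OF \<sigma> \<rho>]])
    fix k i assume k: "k \<in> carrier G" and i: "i \<in> {1..n}"
    have "\<sigma> i \<in> {1..n}" using \<sigma> i by (rule permutes_in)
    then show "act Op n (h, \<rho>) (act Op n (g, \<sigma>) x) (h \<otimes> g \<otimes> k, (\<rho> \<circ> \<sigma>) i) = x (k, i)"
      using act_O_apply[OF act_O_in[OF x \<sigma> g] \<rho> h, of "g \<otimes> k" "\<sigma> i"] act_O_apply[OF x \<sigma> g k i]
        h g k by (simp add: G.m_assoc)
  qed (use h g act_O_in[OF act_O_in[OF x \<sigma> g] \<rho> h] in auto)
  then show "act Op n (q \<otimes>\<^bsub>G \<times>\<times> sym_group n\<^esub> p) x = act Op n q (act Op n p x)"
    by (simp add: p q sym_group_mult)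
next
  fix x assume x: "x \<in> tables n"
  have "act Op n (\<one>, id) x = x"
    by (rule act_O_unique[OF x permutes_id _ x]) auto
  then show "act Op n \<one>\<^bsub>G \<times>\<times> sym_group n\<^esub> x = x"
    by (simp add: sym_group_one)
qed

lemma pcomp_O_apply:
  "g \<in> carrier G \<Longrightarrow> k \<in> {1..n + m - 1} \<Longrightarrow> pcomp Op n m i x y (g, k) =
    (if k < i then x (g, k) else if k < i + m then x (g, i) \<otimes>\<^bsub>M\<^esub> y (g, k - i + 1)
     else x (g, k + 1 - m))"
  by (simp add: O_operad_def)

lemma pcomp_O_left:
  assumes "g \<in> carrier G" "i \<in> {1..n}" "1 \<le> k" "k < i"
  shows "pcomp Op n m i x y (g, k) = x (g, k)"
proof -
  have "k \<in> {1..n + m - 1}" using assms by auto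
  with assms show ?thesis by (simp only: pcomp_O_apply if_True)
qed

lemma pcomp_O_mid:
  assumes "g \<in> carrier G" "i \<in> {1..n}" "i \<le> k" "k < i + m"
  shows "pcomp Op n m i x y (g, k) = x (g, i) \<otimes>\<^bsub>M\<^esub> y (g, k - i + 1)"
proof -
  have "k \<in> {1..n + m - 1}" using assms by auto
  with assms show ?thesis by (simp only: pcomp_O_apply if_True if_False not_less[symmetric])
qed

lemma pcomp_O_right:
  assumes "g \<in> carrier G" "i \<in> {1..n}" "i + m \<le> k" "k \<le> n + m - 1"
  shows "pcomp Op n m i x y (g, k) = x (g, k + 1 - m)"
proof -
  have "k \<in> {1..n + m - 1}" "\<not> k < i" "\<not> k < i + m" using assms by auto
  with assms(1) show ?thesis by (simp only: pcomp_O_apply if_False)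
qed

lemma pcomp_O_in:
  assumes "x \<in> tables n" "y \<in> tables m" "i \<in> {1..n}"
  shows "pcomp Op n m i x y \<in> tables (n + m - 1)"
proof -
  have "(if k < i then x (g, k) else if k < i + m then x (g, i) \<otimes>\<^bsub>M\<^esub> y (g, k - i + 1)
     else x (g, k + 1 - m)) \<in> carrier M" if "g \<in> carrier G" "k \<in> {1..n + m - 1}" for g k
  proof -
    have "k < i \<Longrightarrow> k \<in> {1..n}" "\<not> k < i \<Longrightarrow> k < i + m \<Longrightarrow> k - i + 1 \<in> {1..m}"
      "\<not> k < i \<Longrightarrow> \<not> k < i + m \<Longrightarrow> k + 1 - m \<in> {1..n}"
      using that assms(3) by auto
    then show ?thesis
      using that assms by (simp add: table_in del: atLeastAtMost_iff)
  qed
  then show ?thesis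
    unfolding O_operad_def g_operad_data.simps
    by (intro restrict_in_tables) (simp only: prod.case)
qed

lemma g_operad_O: "g_operad G Op"
proof (intro g_operad.intro g_operad_axioms.intro)
  show "group G" by (rule G.is_group)
  show "cgwh_space (level Op n)" for n
    using Hausdorff_level_O k_space_level_O by (rule cgwh_space_if_Hausdorff)
  show "group_action (G \<times>\<times> sym_group n) (topspace (level Op n)) (act Op n)" for n
    by (simp add: group_action_O)
  show "continuous_map (level Op n) (level Op n) (act Op n p)"
    if pc: "p \<in> carrier (G \<times>\<times> sym_group n)" for n p
  proof -
    obtain g \<sigma> where p: "p = (g, \<sigma>)" and g: "g \<in> carrier G" and \<sigma>: "\<sigma> permutes {1..n}"
      using pc by (auto simp: sym_group_carrier)
    show ?thesis
    proof (rule continuous_map_into_level_O[OF k_space_level_O])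
      show "act Op n p \<in> topspace (level Op n) \<rightarrow> tables n"
        using act_O_in \<sigma> g by (auto simp: p)
      fix k i assume k: "k \<in> carrier G" and i: "i \<in> {1..n}"
      have "continuous_map (level Op n) (mtop M) (\<lambda>x. x (inv g \<otimes> k, inv' \<sigma> i))"
        using k g permutes_inv_in[OF \<sigma> i] by (intro continuous_map_entry) auto
      then show "continuous_map (level Op n) (mtop M) (\<lambda>x. act Op n p x (k, i))"
        by (rule continuous_map_eq) (use k i \<sigma> in \<open>simp add: p act_O\<close>)
    qed
  qed
  show "opunit Op \<in> topspace (level Op 1)"
    by (auto simp: O_operad_def M.topspace_mtop)
  show "act Op 1 (g, id) (opunit Op) = opunit Op" if "g \<in> carrier G" for g
    using that by (intro act_O_unique permutes_id) (auto simp: O_operad_def tables_def)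
  show "continuous_map (k_prod_topology (level Op n) (level Op m)) (level Op (n + m - 1))
      (\<lambda>(x, y). pcomp Op n m i x y)" if i: "i \<in> {1..n}" for n m i
  proof (rule continuous_map_into_level_O)
    let ?Z = "k_prod_topology (level Op n) (level Op m)"
    show Z: "k_space ?Z"
      by (intro k_space_k_prod_topology Hausdorff_level_O)
    show "(\<lambda>(x, y). pcomp Op n m i x y) \<in> topspace ?Z \<rightarrow> tables (n + m - 1)"
      using pcomp_O_in i by auto
    fix g k assume g: "g \<in> carrier G" and k: "k \<in> {1..n + m - 1}"
    have x: "continuous_map ?Z (mtop M) (\<lambda>z. fst z (g, j))" if "j \<in> {1..n}" for j
      using continuous_map_compose[OF continuous_map_fst continuous_map_entry[OF g that]]
      by (auto intro!: continuous_map_from_k_prod simp: o_def)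
    have y: "continuous_map ?Z (mtop M) (\<lambda>z. snd z (g, j))" if "j \<in> {1..m}" for j
      using continuous_map_compose[OF continuous_map_snd continuous_map_entry[OF g that]]
      by (auto intro!: continuous_map_from_k_prod simp: o_def)
    have "k < i \<Longrightarrow> k \<in> {1..n}" "\<not> k < i \<Longrightarrow> k < i + m \<Longrightarrow> k - i + 1 \<in> {1..m}"
      "\<not> k < i \<Longrightarrow> \<not> k < i + m \<Longrightarrow> k + 1 - m \<in> {1..n}"
      using k i by auto
    then show "continuous_map ?Z (mtop M) (\<lambda>z. (case z of (x, y) \<Rightarrow> pcomp Op n m i x y) (g, k))"
      unfolding case_prod_unfold pcomp_O_apply[OF g k]
      using x y i Z by (auto intro!: continuous_map_mult simp del: atLeastAtMost_iff)
  qed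
next
  fix x n assume "x \<in> topspace (level Op n)"
  then have x: "x \<in> tables n" by simp
  have u: "opunit Op \<in> tables 1" by (auto simp: O_operad_def tables_def)
  have u1: "g \<in> carrier G \<Longrightarrow> opunit Op (g, Suc 0) = \<one>\<^bsub>M\<^esub>" for g by (simp add: O_operad_def)
  show "pcomp Op 1 n 1 (opunit Op) x = x"
    by (rule table_eqI[OF _ x])
       (use pcomp_O_in[OF u x, of 1] table_in[OF x] u1 in \<open>auto simp: pcomp_O_apply\<close>)
  fix i assume i: "i \<in> {1..n}"
  show "pcomp Op n 1 i x (opunit Op) = x"
    by (intro table_eqI[OF _ x])
       (use pcomp_O_in[OF x u i] table_in[OF x] u1 in \<open>auto simp: pcomp_O_apply less_Suc_eq\<close>)
next
  fix x n y m z l i j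
  assume "x \<in> topspace (level Op n)" "y \<in> topspace (level Op m)" "z \<in> topspace (level Op l)"
    and i: "i \<in> {1..n}" and j: "j \<in> {1..m}"
  then have x: "x \<in> tables n" and y: "y \<in> tables m" and z: "z \<in> tables l" by auto
  have ij: "i + j - 1 \<in> {1..n + m - 1}" using i j by auto
  have ar: "n + m - 1 + l - 1 = n + (m + l - 1) - 1" using i j by auto
  let ?xy = "pcomp Op n m i x y" and ?yz = "pcomp Op m l j y z"
  show "pcomp Op (n + m - 1) l (i + j - 1) (pcomp Op n m i x y) z =
      pcomp Op n (m + l - 1) i x (pcomp Op m l j y z)" (is "?L = ?R")
  proof (rule table_eqI)
    show "?L \<in> tables (n + m - 1 + l - 1)"
      by (intro pcomp_O_in x y z i ij)
    show "?R \<in> tables (n + m - 1 + l - 1)"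
      unfolding ar by (intro pcomp_O_in x y z i j)
    fix g k assume g: "g \<in> carrier G" and k: "k \<in> {1..n + m - 1 + l - 1}"
    consider "k < i" | "i \<le> k" "k < i + j - 1" | "i + j - 1 \<le> k" "k < i + j - 1 + l"
      | "i + j - 1 + l \<le> k" "k < i + m + l - 1" | "i + m + l - 1 \<le> k"
      by linarith
    then show "?L (g, k) = ?R (g, k)"
    proof cases
      case 1
      have "?L (g, k) = ?xy (g, k)"
        by (rule pcomp_O_left[OF g ij]) (use 1 j k in auto)
      moreover have "?xy (g, k) = x (g, k)" "?R (g, k) = x (g, k)"
        by (rule pcomp_O_left[OF g i]; use 1 k in auto)+
      ultimately show ?thesis by simp
    next
      case 2
      have "?L (g, k) = ?xy (g, k)"
        by (rule pcomp_O_left[OF g ij]) (use 2 j k in auto)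
      moreover have "?xy (g, k) = x (g, i) \<otimes>\<^bsub>M\<^esub> y (g, k - i + 1)"
        "?R (g, k) = x (g, i) \<otimes>\<^bsub>M\<^esub> ?yz (g, k - i + 1)"
        by (rule pcomp_O_mid[OF g i]; use 2 j in auto)+
      moreover have "?yz (g, k - i + 1) = y (g, k - i + 1)"
        by (rule pcomp_O_left[OF g j]) (use 2 in auto)
      ultimately show ?thesis by simp
    next
      case 3
      have "?L (g, k) = ?xy (g, i + j - 1) \<otimes>\<^bsub>M\<^esub> z (g, k - (i + j - 1) + 1)"
        by (rule pcomp_O_mid[OF g ij]) (use 3 in auto)
      moreover have "?xy (g, i + j - 1) = x (g, i) \<otimes>\<^bsub>M\<^esub> y (g, i + j - 1 - i + 1)"
        "?R (g, k) = x (g, i) \<otimes>\<^bsub>M\<^esub> ?yz (g, k - i + 1)"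
        by (rule pcomp_O_mid[OF g i]; use 3 j in auto)+
      moreover have "?yz (g, k - i + 1) = y (g, j) \<otimes>\<^bsub>M\<^esub> z (g, k - i + 1 - j + 1)"
        by (rule pcomp_O_mid[OF g j]) (use 3 i j in auto)
      moreover have "k - i + 1 - j + 1 = k - (i + j - 1) + 1" "i + j - 1 - i + 1 = j"
        using 3 i j by auto
      moreover have "k - (i + j - 1) + 1 \<in> {1..l}" using 3 by auto
      ultimately show ?thesis
        using table_in[OF x g i] table_in[OF y g j] table_in[OF z g]
        by (simp only: M.m_assoc)
    next
      case 4
      have "?L (g, k) = ?xy (g, k + 1 - l)"
        by (rule pcomp_O_right[OF g ij]) (use 4 k in auto)
      moreover have "?xy (g, k + 1 - l) = x (g, i) \<otimes>\<^bsub>M\<^esub> y (g, k + 1 - l - i + 1)"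
        "?R (g, k) = x (g, i) \<otimes>\<^bsub>M\<^esub> ?yz (g, k - i + 1)"
        by (rule pcomp_O_mid[OF g i]; use 4 j in auto)+
      moreover have "?yz (g, k - i + 1) = y (g, k - i + 1 + 1 - l)"
        by (rule pcomp_O_right[OF g j]) (use 4 i j in auto)
      moreover have "k + 1 - l - i + 1 = k - i + 1 + 1 - l" using 4 i j by auto
      ultimately show ?thesis by simp
    next
      case 5
      have "?L (g, k) = ?xy (g, k + 1 - l)"
        by (rule pcomp_O_right[OF g ij]) (use 5 j k in auto)
      moreover have "?xy (g, k + 1 - l) = x (g, k + 1 - l + 1 - m)"
        by (rule pcomp_O_right[OF g i]) (use 5 i j k in auto)
      moreover have "?R (g, k) = x (g, k + 1 - (m + l - 1))"
        by (rule pcomp_O_right[OF g i]) (use 5 i j k in auto)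
      moreover have "k + 1 - l + 1 - m = k + 1 - (m + l - 1)" using 5 i j by auto
      ultimately show ?thesis by simp
    qed
  qed
next
  fix x n y m z l i k
  assume "x \<in> topspace (level Op n)" "y \<in> topspace (level Op m)" "z \<in> topspace (level Op l)"
    and i: "i \<in> {1..n}" and k: "k \<in> {1..n}" and ik: "i < k"
  then have x: "x \<in> tables n" and y: "y \<in> tables m" and z: "z \<in> tables l" by auto
  have k': "k + m - 1 \<in> {1..n + m - 1}" and i': "i \<in> {1..n + l - 1}" using i k ik by auto
  have ar: "n + m - 1 + l - 1 = n + l - 1 + m - 1" using i k by auto
  let ?xy = "pcomp Op n m i x y" and ?xz = "pcomp Op n l k x z"
  show "pcomp Op (n + m - 1) l (k + m - 1) (pcomp Op n m i x y) z =
      pcomp Op (n + l - 1) m i (pcomp Op n l k x z) y" (is "?L = ?R")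
  proof (rule table_eqI)
    show "?L \<in> tables (n + m - 1 + l - 1)"
      by (intro pcomp_O_in x y z i k')
    show "?R \<in> tables (n + m - 1 + l - 1)"
      unfolding ar by (intro pcomp_O_in x y z i' k)
    fix g j assume g: "g \<in> carrier G" and j: "j \<in> {1..n + m - 1 + l - 1}"
    consider "j < i" | "i \<le> j" "j < i + m" | "i + m \<le> j" "j < k + m - 1"
      | "k + m - 1 \<le> j" "j < k + m - 1 + l" | "k + m - 1 + l \<le> j"
      by linarith
    then show "?L (g, j) = ?R (g, j)"
    proof cases
      case 1
      have "?L (g, j) = ?xy (g, j)"
        by (rule pcomp_O_left[OF g k']) (use 1 ik j in auto)
      moreover have "?xy (g, j) = x (g, j)"
        by (rule pcomp_O_left[OF g i]) (use 1 j in auto)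
      moreover have "?R (g, j) = ?xz (g, j)"
        by (rule pcomp_O_left[OF g i']) (use 1 j in auto)
      moreover have "?xz (g, j) = x (g, j)"
        by (rule pcomp_O_left[OF g k]) (use 1 ik j in auto)
      ultimately show ?thesis by simp
    next
      case 2
      have "?L (g, j) = ?xy (g, j)"
        by (rule pcomp_O_left[OF g k']) (use 2 ik j in auto)
      moreover have "?xy (g, j) = x (g, i) \<otimes>\<^bsub>M\<^esub> y (g, j - i + 1)"
        by (rule pcomp_O_mid[OF g i]) (use 2 in auto)
      moreover have "?R (g, j) = ?xz (g, i) \<otimes>\<^bsub>M\<^esub> y (g, j - i + 1)"
        by (rule pcomp_O_mid[OF g i']) (use 2 in auto)
      moreover have "?xz (g, i) = x (g, i)"
        by (rule pcomp_O_left[OF g k]) (use ik i in auto)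
      ultimately show ?thesis by simp
    next
      case 3
      have "?L (g, j) = ?xy (g, j)"
        by (rule pcomp_O_left[OF g k']) (use 3 j in auto)
      moreover have "?xy (g, j) = x (g, j + 1 - m)"
        by (rule pcomp_O_right[OF g i]) (use 3 k in auto)
      moreover have "?R (g, j) = ?xz (g, j + 1 - m)"
        by (rule pcomp_O_right[OF g i']) (use 3 j ar in auto)
      moreover have "?xz (g, j + 1 - m) = x (g, j + 1 - m)"
        by (rule pcomp_O_left[OF g k]) (use 3 ik i in auto)
      ultimately show ?thesis by simp
    next
      case 4
      have "?L (g, j) = ?xy (g, k + m - 1) \<otimes>\<^bsub>M\<^esub> z (g, j - (k + m - 1) + 1)"
        by (rule pcomp_O_mid[OF g k']) (use 4 in auto)
      moreover have "?xy (g, k + m - 1) = x (g, k + m - 1 + 1 - m)"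
        by (rule pcomp_O_right[OF g i]) (use k ik in auto)
      moreover have "?R (g, j) = ?xz (g, j + 1 - m)"
        by (rule pcomp_O_right[OF g i']) (use 4 ik j ar in auto)
      moreover have "?xz (g, j + 1 - m) = x (g, k) \<otimes>\<^bsub>M\<^esub> z (g, j + 1 - m - k + 1)"
        by (rule pcomp_O_mid[OF g k]) (use 4 ik i in auto)
      moreover have "j + 1 - m - k + 1 = j - (k + m - 1) + 1" "k + m - 1 + 1 - m = k"
        using 4 i k ik by auto
      ultimately show ?thesis by simp
    next
      case 5
      have "?L (g, j) = ?xy (g, j + 1 - l)"
        by (rule pcomp_O_right[OF g k']) (use 5 j in auto)
      moreover have "?xy (g, j + 1 - l) = x (g, j + 1 - l + 1 - m)"
        by (rule pcomp_O_right[OF g i]) (use 5 i k ik j in auto)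
      moreover have "?R (g, j) = ?xz (g, j + 1 - m)"
        by (rule pcomp_O_right[OF g i']) (use 5 ik j ar in auto)
      moreover have "?xz (g, j + 1 - m) = x (g, j + 1 - m + 1 - l)"
        by (rule pcomp_O_right[OF g k]) (use 5 i k ik j in auto)
      moreover have "j + 1 - l + 1 - m = j + 1 - m + 1 - l" using 5 i k ik by auto
      ultimately show ?thesis by simp
    qed
  qed
next
  fix x n y m i g \<sigma> \<rho>
  assume "x \<in> topspace (level Op n)" "y \<in> topspace (level Op m)" and i: "i \<in> {1..n}"
    and g: "g \<in> carrier G" and "\<sigma> \<in> carrier (sym_group n)" "\<rho> \<in> carrier (sym_group m)"
  then have x: "x \<in> tables n" and y: "y \<in> tables m"
    and \<sigma>: "\<sigma> permutes {1..n}" and \<rho>: "\<rho> permutes {1..m}"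
    by (auto simp: sym_group_carrier)
  let ?\<pi> = "perm_pcomp n m i \<sigma> \<rho>"
  note \<pi> = perm_pcomp_permutes[OF i \<sigma> \<rho>]
  have \<sigma>i: "\<sigma> i \<in> {1..n}" using \<sigma> i by (rule permutes_in)
  have "act Op (n + m - 1) (g, ?\<pi>) (pcomp Op n m i x y)
      = pcomp Op n m (\<sigma> i) (act Op n (g, \<sigma>) x) (act Op m (g, \<rho>) y)"
  proof (rule act_O_unique[OF pcomp_O_in[OF x y i] \<pi> g])
    show "pcomp Op n m (\<sigma> i) (act Op n (g, \<sigma>) x) (act Op m (g, \<rho>) y) \<in> tables (n + m - 1)"
      by (intro pcomp_O_in act_O_in x y \<sigma> \<rho> g \<sigma>i)
    fix k j assume k: "k \<in> carrier G" and j: "j \<in> {1..n + m - 1}"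
    have gk: "g \<otimes> k \<in> carrier G" using g k by simp
    have \<pi>j: "?\<pi> j \<in> {1..n + m - 1}" using \<pi> j by (rule permutes_in)
    note ap = act_O_apply[OF x \<sigma> g k] act_O_apply[OF y \<rho> g k]
    show "pcomp Op n m (\<sigma> i) (act Op n (g, \<sigma>) x) (act Op m (g, \<rho>) y) (g \<otimes> k, ?\<pi> j)
        = pcomp Op n m i x y (k, j)"
    proof (cases "i \<le> j \<and> j < i + m")
      case True
      then have jm: "j + 1 - i \<in> {1..m}" by auto
      from \<rho> jm have \<rho>j: "\<rho> (j + 1 - i) \<in> {1..m}" by (rule permutes_in)
      have eq: "?\<pi> j = \<sigma> i + \<rho> (j + 1 - i) - 1"
        using True j by (simp add: perm_pcomp_def)
      have "\<not> ?\<pi> j < \<sigma> i" "?\<pi> j < \<sigma> i + m" "?\<pi> j - \<sigma> i + 1 = \<rho> (j + 1 - i)"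
        using \<rho>j by (auto simp: eq)
      moreover have "\<not> j < i" "j - i + 1 = j + 1 - i" using True by auto
      ultimately show ?thesis
        unfolding pcomp_O_apply[OF gk \<pi>j] pcomp_O_apply[OF k j]
        using True ap(1)[OF i] ap(2)[OF jm] by simp
    next
      case False
      define c where "c = (if j < i then j else j + 1 - m)"
      have c: "c \<in> {1..n}" "c \<noteq> i" using False i j by (auto simp: c_def)
      have eq: "?\<pi> j = (if \<sigma> c < \<sigma> i then \<sigma> c else \<sigma> c + m - 1)"
        using False j by (auto simp: perm_pcomp_def c_def Let_def)
      have neq: "\<sigma> c \<noteq> \<sigma> i" using c(2) injD[OF permutes_inj[OF \<sigma>]] by blast
      have "pcomp Op n m (\<sigma> i) (act Op n (g, \<sigma>) x) (act Op m (g, \<rho>) y) (g \<otimes> k, ?\<pi> j)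
          = act Op n (g, \<sigma>) x (g \<otimes> k, \<sigma> c)"
        unfolding pcomp_O_apply[OF gk \<pi>j] using neq by (auto simp: eq)
      moreover have "pcomp Op n m i x y (k, j) = x (k, c)"
        unfolding pcomp_O_apply[OF k j] using False by (auto simp: c_def)
      ultimately show ?thesis
        using ap(1)[OF c(1)] by simp
    qed
  qed
  then show "pcomp Op n m (\<sigma> i) (act Op n (g, \<sigma>) x) (act Op m (g, \<rho>) y)
      = act Op (n + m - 1) (g, ?\<pi>) (pcomp Op n m i x y)" by simp
qed

end

section \<open>Disjointness and transfers\<close>

subsection \<open>Conjugate subgroups\<close>

lemma (in group) subgroup_conjugate:
  assumes H: "subgroup H G" and g: "g \<in> carrier G"
  shows "subgroup ((\<lambda>h. inv g \<otimes> h \<otimes> g) ` H) G"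
proof -
  have "(\<lambda>h. inv g \<otimes> h \<otimes> g) \<in> hom G G"
  proof (rule homI)
    fix h k assume hk: "h \<in> carrier G" "k \<in> carrier G"
    have "g \<otimes> (inv g \<otimes> (k \<otimes> g)) = k \<otimes> g"
      using hk g by (simp add: m_assoc[symmetric])
    then show "inv g \<otimes> (h \<otimes> k) \<otimes> g
        = inv g \<otimes> h \<otimes> g \<otimes> (inv g \<otimes> k \<otimes> g)"
      using hk g by (simp add: m_assoc)
  qed (use g in simp)
  then have "group_hom G G (\<lambda>h. inv g \<otimes> h \<otimes> g)"
    by (intro group_hom.intro group_hom_axioms.intro is_group)
  then show ?thesis
    using H by (rule group_hom.subgroup_img_is_subgroup)
qed

lemma (in group) conjugate_conjugate:
  "g \<in> carrier G \<Longrightarrow> h \<in> carrier G \<Longrightarrow> inv g \<otimes> (g \<otimes> h \<otimes> inv g) \<otimes> g = h"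
  "g \<in> carrier G \<Longrightarrow> h \<in> carrier G \<Longrightarrow> g \<otimes> (inv g \<otimes> h \<otimes> g) \<otimes> inv g = h"
proof -
  assume gh: "g \<in> carrier G" "h \<in> carrier G"
  then have "g \<otimes> (inv g \<otimes> h) = h" "inv g \<otimes> (g \<otimes> h) = h"
    by (simp_all add: m_assoc[symmetric])
  with gh show "inv g \<otimes> (g \<otimes> h \<otimes> inv g) \<otimes> g = h"
    "g \<otimes> (inv g \<otimes> h \<otimes> g) \<otimes> inv g = h"
    by (simp_all add: m_assoc)
qed

context coinduction_context
begin

lemma R_points_iff:
  "x \<in> R_points G M n \<longleftrightarrow> x \<in> tables n \<and>
     (\<forall>g \<in> carrier G. \<forall>i \<in> {1..n}. \<forall>j \<in> {1..n}. i \<noteq> j \<longrightarrow> \<not> meets M (x (g, i)) (x (g, j))) \<and>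
     (\<forall>i \<in> {1..n}. \<forall>g1 \<in> carrier G. \<forall>g2 \<in> carrier G.
        x (g1, i) = x (g2, i) \<or> \<not> meets M (x (g1, i)) (x (g2, i)))"
  by (simp add: R_points_def)

lemma R_points_tables: "x \<in> R_points G M n \<Longrightarrow> x \<in> tables n"
  by (simp add: R_points_iff)

lemma R_disjoint:
  "x \<in> R_points G M n \<Longrightarrow> g \<in> carrier G \<Longrightarrow> i \<in> {1..n} \<Longrightarrow> j \<in> {1..n} \<Longrightarrow> i \<noteq> j \<Longrightarrow>
    \<not> meets M (x (g, i)) (x (g, j))"
  by (auto simp: R_points_iff)

lemma R_strict:
  "x \<in> R_points G M n \<Longrightarrow> i \<in> {1..n} \<Longrightarrow> g1 \<in> carrier G \<Longrightarrow> g2 \<in> carrier G \<Longrightarrow>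
    meets M (x (g1, i)) (x (g2, i)) \<Longrightarrow> x (g1, i) = x (g2, i)"
  unfolding R_points_iff by blast

text \<open>The two axioms of an intersection monoid combined: if the first factors are strict, that is equal
  or disjoint, then products meet only if the first factors agree and the second ones meet.\<close>

lemma meets_mult_strict:
  assumes "x1 \<in> carrier M" "y1 \<in> carrier M" "x2 \<in> carrier M" "y2 \<in> carrier M"
    and "meets M (x1 \<otimes>\<^bsub>M\<^esub> y1) (x2 \<otimes>\<^bsub>M\<^esub> y2)" and "meets M x1 x2 \<Longrightarrow> x1 = x2"
  shows "x1 = x2" "meets M y1 y2"
proof -
  show "x1 = x2" using M.meets_prefix[OF assms(1-5)] assms(6) by blast
  with assms show "meets M y1 y2" using M.meets_cancel[of x1 y1 y2] by simp
qed

text \<open>The positions \<open>1, \<dots>, n + m - 1\<close> of \<open>x \<circ>\<^sub>i y\<close>, traced back to the positions of \<open>x\<close>.\<close>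

definition collapse :: "nat \<Rightarrow> nat \<Rightarrow> nat \<Rightarrow> nat" where
  "collapse m i k = (if k < i then k else if k < i + m then i else k + 1 - m)"

lemma collapse_in: "i \<in> {1..n} \<Longrightarrow> k \<in> {1..n + m - 1} \<Longrightarrow> collapse m i k \<in> {1..n}"
  by (auto simp: collapse_def)

lemma collapse_eq_iff: "collapse m i k = i \<longleftrightarrow> i \<le> k \<and> k < i + m"
  by (auto simp: collapse_def)

lemma collapse_inj: "collapse m i k = collapse m i l \<Longrightarrow> collapse m i k \<noteq> i \<Longrightarrow> k = l"
  by (auto simp: collapse_def split: if_splits)

lemma pcomp_O_collapse:
  assumes x: "x \<in> tables n" and y: "y \<in> tables m" and i: "i \<in> {1..n}"
    and g: "g \<in> carrier G" and k: "k \<in> {1..n + m - 1}"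
  obtains u where "u \<in> carrier M" "pcomp Op n m i x y (g, k) = x (g, collapse m i k) \<otimes>\<^bsub>M\<^esub> u"
    "collapse m i k = i \<Longrightarrow> u = y (g, k - i + 1)"
proof (cases "collapse m i k = i")
  case True
  then have ik: "i \<le> k" "k < i + m" by (simp_all add: collapse_eq_iff)
  then have "k - i + 1 \<in> {1..m}" by auto
  with y g have "y (g, k - i + 1) \<in> carrier M" by (rule table_in)
  with that pcomp_O_mid[OF g i ik] True show thesis by simp
next
  case False
  have "pcomp Op n m i x y (g, k) = x (g, collapse m i k)"
  proof (cases "k < i")
    case True
    then show ?thesis using pcomp_O_left[OF g i] k by (simp add: collapse_def)
  next
    case False
    with \<open>collapse m i k \<noteq> i\<close> have "i + m \<le> k" by (simp add: collapse_eq_iff)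
    with False show ?thesis using pcomp_O_right[OF g i] k by (simp add: collapse_def)
  qed
  moreover have "x (g, collapse m i k) \<in> carrier M"
    using x g collapse_in[OF i k] by (rule table_in)
  ultimately show thesis using that[of "\<one>\<^bsub>M\<^esub>"] False by simp
qed

text \<open>Entries of \<open>x \<circ>\<^sub>i y\<close> meet only where the entries of \<open>x\<close> underneath do; inside the inserted
  block strictness of the column \<open>i\<close> of \<open>x\<close> lets the common factor be cancelled.\<close>

lemma meets_pcomp:
  assumes x: "x \<in> R_points G M n" and y: "y \<in> tables m" and i: "i \<in> {1..n}"
    and g: "g \<in> carrier G" "g' \<in> carrier G" and k: "k \<in> {1..n + m - 1}" "k' \<in> {1..n + m - 1}"
    and meets: "meets M (pcomp Op n m i x y (g, k)) (pcomp Op n m i x y (g', k'))"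
  shows "meets M (x (g, collapse m i k)) (x (g', collapse m i k'))"
    and "collapse m i k = i \<Longrightarrow> collapse m i k' = i \<Longrightarrow> x (g, i) = x (g', i)"
    and "collapse m i k = i \<Longrightarrow> collapse m i k' = i \<Longrightarrow>
      meets M (y (g, k - i + 1)) (y (g', k' - i + 1))"
proof -
  note xt = R_points_tables[OF x]
  obtain u where u: "u \<in> carrier M" "pcomp Op n m i x y (g, k) = x (g, collapse m i k) \<otimes>\<^bsub>M\<^esub> u"
    "collapse m i k = i \<Longrightarrow> u = y (g, k - i + 1)"
    using pcomp_O_collapse[OF xt y i g(1) k(1)] by blast
  obtain u' where u': "u' \<in> carrier M"
    "pcomp Op n m i x y (g', k') = x (g', collapse m i k') \<otimes>\<^bsub>M\<^esub> u'"
    "collapse m i k' = i \<Longrightarrow> u' = y (g', k' - i + 1)"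
    using pcomp_O_collapse[OF xt y i g(2) k(2)] by blast
  have c: "x (g, collapse m i k) \<in> carrier M" "x (g', collapse m i k') \<in> carrier M"
    using table_in[OF xt] g collapse_in[OF i] k by auto
  show "meets M (x (g, collapse m i k)) (x (g', collapse m i k'))"
    using M.meets_prefix[OF c(1) u(1) c(2) u'(1)] meets u u' by simp
  assume "collapse m i k = i" "collapse m i k' = i"
  with meets_mult_strict[OF c(1) u(1) c(2) u'(1)] R_strict[OF x i g] meets u u'
  show "x (g, i) = x (g', i)" "meets M (y (g, k - i + 1)) (y (g', k' - i + 1))"
    by auto
qed

lemma R_points_pcomp:
  assumes x: "x \<in> R_points G M n" and y: "y \<in> R_points G M m" and i: "i \<in> {1..n}"
  shows "pcomp Op n m i x y \<in> R_points G M (n + m - 1)"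
proof -
  note xt = R_points_tables[OF x] and yt = R_points_tables[OF y]
  let ?z = "pcomp Op n m i x y"
  have "\<not> meets M (?z (g, k)) (?z (g, l))"
    if g: "g \<in> carrier G" and kl: "k \<in> {1..n + m - 1}" "l \<in> {1..n + m - 1}" "k \<noteq> l" for g k l
  proof
    assume "meets M (?z (g, k)) (?z (g, l))"
    note * = meets_pcomp[OF x yt i g g kl(1,2) this]
    have eq: "collapse m i k = collapse m i l"
      using *(1) R_disjoint[OF x g collapse_in[OF i kl(1)] collapse_in[OF i kl(2)]] by blast
    then have i_eq: "collapse m i k = i" using collapse_inj kl(3) by blast
    with eq have "collapse m i l = i" by simp
    with i_eq have "k - i + 1 \<in> {1..m}" "l - i + 1 \<in> {1..m}" "k - i + 1 \<noteq> l - i + 1"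
      using kl(3) by (auto simp: collapse_eq_iff)
    then show False
      using *(3)[OF i_eq \<open>collapse m i l = i\<close>] R_disjoint[OF y g] by blast
  qed
  moreover have "?z (g, k) = ?z (g', k) \<or> \<not> meets M (?z (g, k)) (?z (g', k))"
    if g: "g \<in> carrier G" "g' \<in> carrier G" and k: "k \<in> {1..n + m - 1}" for g g' k
  proof (rule disjCI)
    assume "\<not> \<not> meets M (?z (g, k)) (?z (g', k))"
    then have "meets M (?z (g, k)) (?z (g', k))" by simp
    note * = meets_pcomp[OF x yt i g k k this]
    have x_eq: "x (g, collapse m i k) = x (g', collapse m i k)"
      using R_strict[OF x collapse_in[OF i k] g *(1)] .
    show "?z (g, k) = ?z (g', k)"
    proof (cases "collapse m i k = i")
      case True
      then have "k - i + 1 \<in> {1..m}" by (auto simp: collapse_eq_iff)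
      then have "y (g, k - i + 1) = y (g', k - i + 1)"
        using R_strict[OF y _ g *(3)[OF True True]] by blast
      with x_eq True show ?thesis
        using pcomp_O_mid[OF g(1) i] pcomp_O_mid[OF g(2) i] by (simp add: collapse_eq_iff)
    next
      case False
      with x_eq k g show ?thesis
        by (auto simp: pcomp_O_apply collapse_def split: if_splits)
    qed
  qed
  ultimately show ?thesis
    using pcomp_O_in[OF xt yt i] unfolding R_points_iff by blast
qed

lemma R_points_act:
  assumes x: "x \<in> R_points G M n" and \<sigma>: "\<sigma> permutes {1..n}" and g: "g \<in> carrier G"
  shows "act Op n (g, \<sigma>) x \<in> R_points G M n"
proof -
  note xt = R_points_tables[OF x]
  have *: "act Op n (g, \<sigma>) x (k, i) = x (inv g \<otimes> k, inv' \<sigma> i)"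
    if "k \<in> carrier G" "i \<in> {1..n}" for k i
    using that by (simp add: act_O[OF xt \<sigma>])
  have inj: "inv' \<sigma> i = inv' \<sigma> j \<Longrightarrow> i = j" for i j
    using permutes_inj[OF permutes_inv[OF \<sigma>]] by (simp add: inj_eq)
  have gk: "inv g \<otimes> k \<in> carrier G" if "k \<in> carrier G" for k
    using that g by simp
  show ?thesis
    unfolding R_points_iff
  proof (intro conjI ballI impI act_O_in[OF xt \<sigma> g])
    fix k i j assume k: "k \<in> carrier G" and i: "i \<in> {1..n}" and j: "j \<in> {1..n}" and "i \<noteq> j"
    then have "inv' \<sigma> i \<noteq> inv' \<sigma> j" using inj by blast
    then show "\<not> meets M (act Op n (g, \<sigma>) x (k, i)) (act Op n (g, \<sigma>) x (k, j))"
      unfolding *[OF k i] *[OF k j]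
      by (rule R_disjoint[OF x gk[OF k] permutes_inv_in[OF \<sigma> i] permutes_inv_in[OF \<sigma> j]])
  next
    fix i k l assume i: "i \<in> {1..n}" and k: "k \<in> carrier G" and l: "l \<in> carrier G"
    show "act Op n (g, \<sigma>) x (k, i) = act Op n (g, \<sigma>) x (l, i) \<or>
        \<not> meets M (act Op n (g, \<sigma>) x (k, i)) (act Op n (g, \<sigma>) x (l, i))"
      unfolding *[OF k i] *[OF l i]
      using R_strict[OF x permutes_inv_in[OF \<sigma> i] gk[OF k] gk[OF l]] by blast
  qed
qed

lemma opunit_in_R_points: "opunit Op \<in> R_points G M 1"
  by (auto simp: R_points_iff O_operad_def tables_def)

lemma level_R: "level (R_operad G M) n = k_subtopology (level Op n) (R_points G M n)"
  by (simp add: R_operad_def suboperad_def)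

lemma topspace_level_R [simp]: "topspace (level (R_operad G M) n) = R_points G M n"
  using R_points_tables by (auto simp: level_R)

lemma act_R: "x \<in> R_points G M n \<Longrightarrow> act (R_operad G M) n p x = act Op n p x"
  using R_points_tables by (simp add: R_operad_def suboperad_def)

lemma Hausdorff_level_R: "Hausdorff_space (level (R_operad G M) n)"
  unfolding level_R by (intro Hausdorff_space_k_subtopology Hausdorff_level_O)

lemma g_operad_R: "g_operad G (R_operad G M)"
  unfolding R_operad_def
proof (rule g_operad_suboperad[OF g_operad_O Hausdorff_level_O])
  fix n p x assume "p \<in> carrier (G \<times>\<times> sym_group n)" "x \<in> R_points G M n"
  then show "act Op n p x \<in> R_points G M n"
    by (cases p) (simp add: R_points_act sym_group_carrier)
qed (simp_all only: opunit_in_R_points R_points_pcomp)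

subsection \<open>Transfers\<close>

text \<open>A twist map \<open>S \<rightarrow> {1..n}\<close> with \<open>S g\<^sub>0 = H\<close> amounts to the map \<open>\<beta>\<close> on \<open>H\<close> that sends \<open>h\<close> to the
  value at \<open>h a\<close>, where \<open>a\<close> is the inverse of \<open>g\<^sub>0\<close>.  In this form restriction to a subgroup of \<open>H\<close>
  does not affect \<open>a\<close>.\<close>

definition coherent :: "nat \<Rightarrow> ('g \<times> nat \<Rightarrow> 'm) \<Rightarrow> 'g set \<Rightarrow> 'g \<Rightarrow> ('g \<Rightarrow> nat) \<Rightarrow> bool" where
  "coherent n x H a \<beta> \<longleftrightarrow> subgroup H G \<and> a \<in> carrier G \<and> \<beta> ` H \<subseteq> {1..n} \<and>
     (\<forall>h1 \<in> H. \<forall>h2 \<in> H. meets M (x (h1 \<otimes> a, \<beta> h1)) (x (h2 \<otimes> a, \<beta> h2)))"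

lemma coherentD:
  assumes "coherent n x H a \<beta>"
  shows "subgroup H G" "a \<in> carrier G" "\<And>h. h \<in> H \<Longrightarrow> h \<otimes> a \<in> carrier G"
    "\<And>h. h \<in> H \<Longrightarrow> \<beta> h \<in> {1..n}"
    "\<And>h1 h2. h1 \<in> H \<Longrightarrow> h2 \<in> H \<Longrightarrow> meets M (x (h1 \<otimes> a, \<beta> h1)) (x (h2 \<otimes> a, \<beta> h2))"
  using assms subgroup.mem_carrier[of H G] by (auto simp: coherent_def image_subset_iff)

lemma coherentI:
  assumes "subgroup H G" "a \<in> carrier G" "\<And>h. h \<in> H \<Longrightarrow> \<beta> h \<in> {1..n}"
    "\<And>h1 h2. h1 \<in> H \<Longrightarrow> h2 \<in> H \<Longrightarrow> meets M (x (h1 \<otimes> a, \<beta> h1)) (x (h2 \<otimes> a, \<beta> h2))"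
  shows "coherent n x H a \<beta>"
  using assms by (simp add: coherent_def image_subset_iff)

definition maximal_in :: "'g set \<Rightarrow> 'g set \<Rightarrow> bool" where
  "maximal_in K F \<longleftrightarrow> subgroup K G \<and> K \<subseteq> F \<and> (\<forall>L. subgroup L G \<and> L \<subseteq> F \<and> K \<subseteq> L \<longrightarrow> L = K)"

text \<open>A right translate of a coset of a subgroup is the subgroup itself once it contains \<open>\<one>\<close>.\<close>

lemma rcos_subset_subgroup:
  assumes S: "S \<subseteq> carrier G" and g: "g \<in> carrier G" and h: "h \<in> carrier G"
    and sub: "subgroup (S #> g) G" and one: "\<one> \<in> S #> h"
  shows "subgroup (S #> h) G"
proof -
  let ?H = "S #> g"
  have "S #> h = ?H #> (inv g \<otimes> h)"
    using S g h by (simp add: G.coset_mult_assoc G.m_assoc[symmetric])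
  moreover have "?H #> (inv g \<otimes> h) = ?H"
    using G.repr_independence[OF _ _ sub, of "\<one>" "inv g \<otimes> h"] one g h calculation
      G.coset_mult_one[OF subgroup.subset[OF sub]] by simp
  ultimately show ?thesis using sub by simp
qed

text \<open>The witness \<open>K\<close> contains \<open>\<one>\<close>, which forces the translate \<open>S g\<^sub>0\<close> in the transfer to be a
  subgroup although the definition of twist maps only asks this of some translate.\<close>

lemma supports_transfer_iff:
  "supports_transfer G M n x K H \<longleftrightarrow>
     (\<exists>a \<beta> i. coherent n x H a \<beta> \<and> maximal_in K {h \<in> H. \<beta> h = i})"
proof
  assume "supports_transfer G M n x K H"
  then obtain S \<alpha> i g0 where tm: "twist_map G n S \<alpha>" and g0: "g0 \<in> carrier G" and H: "S #> g0 = H"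
    and K: "maximal_in K ({s \<in> S. \<alpha> s = i} #> g0)"
    and meets: "\<forall>g1 \<in> S. \<forall>g2 \<in> S. meets M (x (g1, \<alpha> g1)) (x (g2, \<alpha> g2))"
    unfolding supports_transfer_def structures_transfer_def maximal_in_def Let_def by blast
  have S: "S \<subseteq> carrier G" and \<alpha>: "\<alpha> ` S \<subseteq> {1..n}" using tm by (auto simp: twist_map_def)
  have "\<one> \<in> {s \<in> S. \<alpha> s = i} #> g0"
    using K by (auto simp: maximal_in_def dest: subgroup.one_closed)
  then have "\<one> \<in> S #> g0" by (auto simp: r_coset_def)
  then have subH: "subgroup H G"
    using tm rcos_subset_subgroup[OF S _ g0] unfolding twist_map_def H by blast
  let ?a = "inv g0" and ?\<beta> = "\<lambda>h. \<alpha> (h \<otimes> inv g0)"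
  have untrans: "s \<otimes> g0 \<otimes> inv g0 = s" if "s \<in> S" for s
    using that S g0 by (simp add: G.m_assoc subset_iff)
  have H': "H = (\<lambda>s. s \<otimes> g0) ` S" using H by (auto simp: r_coset_def)
  have "{s \<in> S. \<alpha> s = i} #> g0 = {h \<in> H. ?\<beta> h = i}"
    unfolding H' r_coset_def using untrans by auto
  moreover have "coherent n x H ?a ?\<beta>"
    unfolding coherent_def using subH g0 \<alpha> meets by (auto simp: H' untrans)
  ultimately show "\<exists>a \<beta> i. coherent n x H a \<beta> \<and> maximal_in K {h \<in> H. \<beta> h = i}"
    using K by (intro exI[of _ ?a] exI[of _ ?\<beta>] exI[of _ i]) simp
next
  assume "\<exists>a \<beta> i. coherent n x H a \<beta> \<and> maximal_in K {h \<in> H. \<beta> h = i}"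
  then obtain a \<beta> i where coh: "coherent n x H a \<beta>" and K: "maximal_in K {h \<in> H. \<beta> h = i}"
    by blast
  have subH: "subgroup H G" and a: "a \<in> carrier G" and \<beta>: "\<beta> ` H \<subseteq> {1..n}"
    and meets: "\<forall>h1 \<in> H. \<forall>h2 \<in> H. meets M (x (h1 \<otimes> a, \<beta> h1)) (x (h2 \<otimes> a, \<beta> h2))"
    using coh by (auto simp: coherent_def)
  let ?S = "(\<lambda>h. h \<otimes> a) ` H" and ?\<alpha> = "\<lambda>s. \<beta> (s \<otimes> inv a)"
  have HG: "H \<subseteq> carrier G" using subH by (rule subgroup.subset)
  have untrans: "h \<otimes> a \<otimes> inv a = h" if "h \<in> H" for h
    using that HG a by (simp add: G.m_assoc subset_iff)
  have coset: "((\<lambda>h. h \<otimes> a) ` L) #> inv a = L" if "L \<subseteq> H" for L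
    using that untrans by (force simp: r_coset_def)
  have fib: "{s \<in> ?S. ?\<alpha> s = i} = (\<lambda>h. h \<otimes> a) ` {h \<in> H. \<beta> h = i}"
    using untrans by auto
  have "twist_map G n ?S ?\<alpha>"
    unfolding twist_map_def
  proof (intro conjI bexI)
    show "subgroup (?S #> inv a) G" using coset[of H] subH by simp
    show "?S \<subseteq> carrier G" using HG a by auto
    show "?\<alpha> ` ?S \<subseteq> {1..n}" using \<beta> untrans by auto
  qed (use a in simp)
  moreover have "structures_transfer G ?S ?\<alpha> i K H"
    unfolding structures_transfer_def Let_def
  proof (intro conjI bexI)
    have "\<one> \<in> {h \<in> H. \<beta> h = i}"
      using K by (auto simp: maximal_in_def dest: subgroup.one_closed)
    then show "i \<in> ?\<alpha> ` ?S"
      using untrans by force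
    show "?S #> inv a = H" by (simp add: coset)
    have "{s \<in> ?S. ?\<alpha> s = i} #> inv a = {h \<in> H. \<beta> h = i}"
      unfolding fib by (rule coset) auto
    with K show "subgroup K G" "K \<subseteq> {s \<in> ?S. ?\<alpha> s = i} #> inv a"
      "\<forall>L. subgroup L G \<and> L \<subseteq> {s \<in> ?S. ?\<alpha> s = i} #> inv a \<and> K \<subseteq> L \<longrightarrow> L = K"
      by (auto simp: maximal_in_def)
  qed (use a in simp)
  moreover have "\<forall>g1 \<in> ?S. \<forall>g2 \<in> ?S. meets M (x (g1, ?\<alpha> g1)) (x (g2, ?\<alpha> g2))"
    using meets untrans by simp
  ultimately show "supports_transfer G M n x K H"
    unfolding supports_transfer_def by blast
qed

lemma maximal_in_subset: "maximal_in K F \<Longrightarrow> K \<subseteq> F' \<Longrightarrow> F' \<subseteq> F \<Longrightarrow> maximal_in K F'"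
  unfolding maximal_in_def by (meson subset_trans)

lemma maximal_in_self: "maximal_in K H \<Longrightarrow> subgroup H G \<Longrightarrow> K = H"
  unfolding maximal_in_def by blast

end

locale transfer_context = coinduction_context G M
  for G :: "('g, 'b) monoid_scheme" (structure) and M :: "'m top_monoid" +
  fixes \<tau> :: "('g set \<times> 'g set) set"
  assumes finite_carrier: "finite (carrier G)" and \<tau>: "transfer_system G \<tau>"
begin

lemma transfer_refl: "subgroup H G \<Longrightarrow> (H, H) \<in> \<tau>"
  using \<tau> by (auto simp: transfer_system_def partial_order_on_def preorder_on_def refl_on_def)

lemma transfer_trans: "(K, L) \<in> \<tau> \<Longrightarrow> (L, H) \<in> \<tau> \<Longrightarrow> (K, H) \<in> \<tau>"
  using \<tau> unfolding transfer_system_def partial_order_on_def preorder_on_def by (meson transD)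

lemma transfer_conj:
  "(K, H) \<in> \<tau> \<Longrightarrow> g \<in> carrier G \<Longrightarrow>
    ((\<lambda>k. inv g \<otimes> k \<otimes> g) ` K, (\<lambda>h. inv g \<otimes> h \<otimes> g) ` H) \<in> \<tau>"
  using \<tau> unfolding transfer_system_def by blast

lemma transfer_restrict:
  "(K, H) \<in> \<tau> \<Longrightarrow> subgroup H' G \<Longrightarrow> H' \<subseteq> H \<Longrightarrow> (K \<inter> H', H') \<in> \<tau>"
  using \<tau> unfolding transfer_system_def by blast

definition R_tau :: "nat \<Rightarrow> ('g \<times> nat \<Rightarrow> 'm) set" where
  "R_tau n = {x \<in> R_points G M n. \<forall>K H. supports_transfer G M n x K H \<longrightarrow> (K, H) \<in> \<tau>}"

lemma R_tau_R: "x \<in> R_tau n \<Longrightarrow> x \<in> R_points G M n"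
  by (simp add: R_tau_def)

lemma R_tau_transfer:
  "x \<in> R_tau n \<Longrightarrow> coherent n x H a \<beta> \<Longrightarrow> maximal_in K {h \<in> H. \<beta> h = i} \<Longrightarrow> (K, H) \<in> \<tau>"
  unfolding R_tau_def supports_transfer_iff by blast

lemma RtI:
  assumes "x \<in> R_points G M n"
    and "\<And>K H a \<beta> i. coherent n x H a \<beta> \<Longrightarrow> maximal_in K {h \<in> H. \<beta> h = i} \<Longrightarrow> (K, H) \<in> \<tau>"
  shows "x \<in> R_tau n"
  using assms unfolding R_tau_def supports_transfer_iff by blast

lemma transfer_if_constant:
  assumes "coherent n x H a \<beta>" "maximal_in K {h \<in> H. \<beta> h = i}" "\<And>h. h \<in> H \<Longrightarrow> \<beta> h = j"
  shows "(K, H) \<in> \<tau>"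
proof -
  have H: "subgroup H G" using assms(1) by (simp add: coherent_def)
  have "\<one> \<in> {h \<in> H. \<beta> h = i}"
    using assms(2) by (auto simp: maximal_in_def dest: subgroup.one_closed)
  with assms(3) have "{h \<in> H. \<beta> h = i} = H" by auto
  with assms(2) H have "K = H" by (simp add: maximal_in_self)
  then show ?thesis using H by (simp add: transfer_refl)
qed

text \<open>Every coherent twist map of \<open>y\<close> is one of \<open>x\<close>, so \<open>y\<close> supports no transfer that \<open>x\<close> does not.\<close>

lemma R_tau_coarser:
  assumes x: "x \<in> R_tau n" and y: "y \<in> R_points G M n"
    and meets: "\<And>g g' i i'. g \<in> carrier G \<Longrightarrow> g' \<in> carrier G \<Longrightarrow> i \<in> {1..n} \<Longrightarrow> i' \<in> {1..n} \<Longrightarrow>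
      meets M (y (g, i)) (y (g', i')) \<Longrightarrow> meets M (x (g, i)) (x (g', i'))"
  shows "y \<in> R_tau n"
proof (rule RtI[OF y])
  fix K H a \<beta> i assume coh: "coherent n y H a \<beta>" and K: "maximal_in K {h \<in> H. \<beta> h = i}"
  note D = coherentD[OF coh]
  have "coherent n x H a \<beta>"
  proof (rule coherentI[OF D(1,2,4)])
    fix h1 h2 assume h: "h1 \<in> H" "h2 \<in> H"
    show "meets M (x (h1 \<otimes> a, \<beta> h1)) (x (h2 \<otimes> a, \<beta> h2))"
      by (rule meets[OF D(3)[OF h(1)] D(3)[OF h(2)] D(4)[OF h(1)] D(4)[OF h(2)] D(5)[OF h]])
  qed
  with x K show "(K, H) \<in> \<tau>" by (simp add: R_tau_transfer)
qed

lemma exists_maximal_in: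
  assumes "subgroup K G" "K \<subseteq> F"
  obtains L where "K \<subseteq> L" "maximal_in L F"
proof -
  let ?A = "{L. subgroup L G \<and> L \<subseteq> F \<and> K \<subseteq> L}"
  have "finite ?A"
    by (rule finite_subset[of _ "Pow (carrier G)"]) (auto simp: finite_carrier dest: subgroup.subset)
  moreover have "K \<in> ?A" using assms by simp
  ultimately obtain L where "L \<in> ?A" "K \<subseteq> L" "\<forall>L' \<in> ?A. L \<subseteq> L' \<longrightarrow> L = L'"
    using finite_has_maximal2[of ?A K] by auto
  then show thesis
    using that[of L] unfolding maximal_in_def by blast
qed

text \<open>Let \<open>\<beta>\<close> structure \<open>K \<rightarrow> H\<close> at \<open>p\<close>.  If \<open>p\<close> is outside the inserted block, collapsing the block gives
  a twist map for \<open>x\<close> that structures the same transfer.  Otherwise enlarge \<open>K\<close> to a maximal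
  subgroup \<open>L\<close> of the elements that \<open>\<beta>\<close> sends into the block.  Then \<open>x\<close> supports \<open>L \<rightarrow> H\<close>, and the
  restriction of \<open>\<beta>\<close> to \<open>L\<close> is a twist map for \<open>y\<close> that structures \<open>K \<rightarrow> L\<close>.\<close>

lemma R_tau_pcomp:
  assumes x: "x \<in> R_tau n" and y: "y \<in> R_tau m" and i: "i \<in> {1..n}"
  shows "pcomp Op n m i x y \<in> R_tau (n + m - 1)"
proof (rule RtI)
  note xR = R_tau_R[OF x] and yt = R_points_tables[OF R_tau_R[OF y]]
  show "pcomp Op n m i x y \<in> R_points G M (n + m - 1)"
    using xR R_tau_R[OF y] i by (rule R_points_pcomp)
  fix K H a \<beta> p
  assume coh: "coherent (n + m - 1) (pcomp Op n m i x y) H a \<beta>"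
    and K: "maximal_in K {h \<in> H. \<beta> h = p}"
  define \<gamma> where "\<gamma> = (\<lambda>h. collapse m i (\<beta> h))"
  note H = coherentD(1)[OF coh] and a = coherentD(2)[OF coh] and Ha = coherentD(3)[OF coh]
    and \<beta> = coherentD(4)[OF coh] and meets = coherentD(5)[OF coh]
  have x_meets: "meets M (x (h1 \<otimes> a, \<gamma> h1)) (x (h2 \<otimes> a, \<gamma> h2))"
    if h: "h1 \<in> H" "h2 \<in> H" for h1 h2
    unfolding \<gamma>_def
    by (rule meets_pcomp(1)[OF xR yt i Ha[OF h(1)] Ha[OF h(2)] \<beta>[OF h(1)] \<beta>[OF h(2)] meets[OF h]])
  have coh_x: "coherent n x H a \<gamma>"
    by (rule coherentI[OF H a]) (use collapse_in[OF i \<beta>] x_meets in \<open>simp_all add: \<gamma>_def\<close>)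
  have K_sub: "K \<subseteq> {h \<in> H. \<gamma> h = collapse m i p}"
    using K by (auto simp: maximal_in_def \<gamma>_def)
  show "(K, H) \<in> \<tau>"
  proof (cases "collapse m i p = i")
    case False
    then have "{h \<in> H. \<gamma> h = collapse m i p} = {h \<in> H. \<beta> h = p}"
      using collapse_inj[of m i] by (auto simp: \<gamma>_def)
    with K show ?thesis using R_tau_transfer[OF x coh_x] by metis
  next
    case True
    then have "subgroup K G" "K \<subseteq> {h \<in> H. \<gamma> h = i}"
      using K K_sub by (auto simp: maximal_in_def)
    then obtain L where KL: "K \<subseteq> L" and L: "maximal_in L {h \<in> H. \<gamma> h = i}"
      by (rule exists_maximal_in)
    have LH: "(L, H) \<in> \<tau>" using R_tau_transfer[OF x coh_x L] .
    have subL: "subgroup L G" and L_sub: "L \<subseteq> H" "\<And>h. h \<in> L \<Longrightarrow> collapse m i (\<beta> h) = i"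
      using L by (auto simp: maximal_in_def \<gamma>_def)
    let ?\<delta> = "\<lambda>h. \<beta> h - i + 1"
    have "meets M (y (h1 \<otimes> a, ?\<delta> h1)) (y (h2 \<otimes> a, ?\<delta> h2))" if "h1 \<in> L" "h2 \<in> L" for h1 h2
    proof -
      have h: "h1 \<in> H" "h2 \<in> H" using that L_sub by auto
      show ?thesis
        by (rule meets_pcomp(3)[OF xR yt i Ha[OF h(1)] Ha[OF h(2)] \<beta>[OF h(1)] \<beta>[OF h(2)] meets[OF h]
              L_sub(2)[OF that(1)] L_sub(2)[OF that(2)]])
    qed
    moreover have "?\<delta> h \<in> {1..m}" if "h \<in> L" for h
      using L_sub(2)[OF that] by (auto simp: collapse_eq_iff)
    ultimately have coh_y: "coherent m y L a ?\<delta>"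
      by (intro coherentI subL a)
    have "?\<delta> h = p - i + 1 \<longleftrightarrow> \<beta> h = p" if "h \<in> L" for h
      using L_sub(2)[OF that] True by (auto simp: collapse_eq_iff)
    then have "{h \<in> L. ?\<delta> h = p - i + 1} = {h \<in> L. \<beta> h = p}" by auto
    moreover have "maximal_in K {h \<in> L. \<beta> h = p}"
      by (rule maximal_in_subset[OF K]) (use K KL L_sub(1) in \<open>auto simp: maximal_in_def\<close>)
    ultimately have "(K, L) \<in> \<tau>"
      using R_tau_transfer[OF y coh_y, of K "p - i + 1"] by simp
    then show ?thesis using LH by (rule transfer_trans)
  qed
qed

text \<open>A twist map for \<open>(g, \<sigma>) x\<close> translates into one for \<open>x\<close> that structures the conjugate transfer.\<close>

lemma R_tau_act:
  assumes x: "x \<in> R_tau n" and \<sigma>: "\<sigma> permutes {1..n}" and g: "g \<in> carrier G"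
  shows "act Op n (g, \<sigma>) x \<in> R_tau n"
proof (rule RtI)
  note xt = R_points_tables[OF R_tau_R[OF x]]
  show "act Op n (g, \<sigma>) x \<in> R_points G M n"
    using R_tau_R[OF x] \<sigma> g by (rule R_points_act)
  fix K H a \<beta> i
  assume coh: "coherent n (act Op n (g, \<sigma>) x) H a \<beta>" and K: "maximal_in K {h \<in> H. \<beta> h = i}"
  let ?c = "\<lambda>h. inv g \<otimes> h \<otimes> g" and ?d = "\<lambda>h. g \<otimes> h \<otimes> inv g"
  note H = coherentD(1)[OF coh] and a = coherentD(2)[OF coh]
    and \<beta> = coherentD(4)[OF coh] and meets = coherentD(5)[OF coh]
  note HG = subgroup.mem_carrier[OF H]
  let ?a = "inv g \<otimes> a" and ?\<beta> = "\<lambda>h. inv' \<sigma> (\<beta> (?d h))"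
  have val: "act Op n (g, \<sigma>) x (h \<otimes> a, \<beta> h) = x (?c h \<otimes> ?a, ?\<beta> (?c h))" if "h \<in> H" for h
  proof -
    have "inv g \<otimes> (h \<otimes> a) = ?c h \<otimes> ?a"
    proof -
      have "g \<otimes> (inv g \<otimes> a) = a" using g a by (simp add: G.m_assoc[symmetric])
      then show ?thesis using g a HG[OF that] by (simp add: G.m_assoc)
    qed
    then show ?thesis
      using HG[OF that] a \<beta>[OF that] g by (simp add: act_O[OF xt \<sigma>] G.conjugate_conjugate)
  qed
  have "coherent n x (?c ` H) ?a ?\<beta>"
  proof (rule coherentI)
    show "subgroup (?c ` H) G" using H g by (rule G.subgroup_conjugate)
    show "?a \<in> carrier G" using a g by simp
    fix h1 assume "h1 \<in> ?c ` H"
    then obtain k1 where k1: "k1 \<in> H" "h1 = ?c k1" by blast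
    then show "?\<beta> h1 \<in> {1..n}"
      using permutes_inv_in[OF \<sigma> \<beta>[OF k1(1)]] g HG by (simp add: G.conjugate_conjugate del: atLeastAtMost_iff)
    fix h2 assume "h2 \<in> ?c ` H"
    then obtain k2 where k2: "k2 \<in> H" "h2 = ?c k2" by blast
    show "meets M (x (h1 \<otimes> ?a, ?\<beta> h1)) (x (h2 \<otimes> ?a, ?\<beta> h2))"
      using meets[OF k1(1) k2(1)] unfolding val[OF k1(1)] val[OF k2(1)] k1(2) k2(2) .
  qed
  moreover have "maximal_in (?c ` K) {h \<in> ?c ` H. ?\<beta> h = inv' \<sigma> i}"
    unfolding maximal_in_def
  proof (intro conjI allI impI)
    have subK: "subgroup K G" and KH: "K \<subseteq> H" "\<And>k. k \<in> K \<Longrightarrow> \<beta> k = i"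
      and max: "\<And>L. subgroup L G \<Longrightarrow> L \<subseteq> {h \<in> H. \<beta> h = i} \<Longrightarrow> K \<subseteq> L \<Longrightarrow> L = K"
      using K by (auto simp: maximal_in_def)
    show "subgroup (?c ` K) G" using subK g by (rule G.subgroup_conjugate)
    show "?c ` K \<subseteq> {h \<in> ?c ` H. ?\<beta> h = inv' \<sigma> i}"
      using KH g HG by (auto simp: G.conjugate_conjugate subset_iff)
    fix L assume L: "subgroup L G \<and> L \<subseteq> {h \<in> ?c ` H. ?\<beta> h = inv' \<sigma> i} \<and> ?c ` K \<subseteq> L"
    note LG = subgroup.mem_carrier[of L G]
    have "?d ` L = K"
    proof (rule max)
      show "subgroup (?d ` L) G" using G.subgroup_conjugate[of L "inv g"] L g by simp
      show "K \<subseteq> ?d ` L"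
      proof
        fix k assume k: "k \<in> K"
        with KH HG g have "k = ?d (?c k)" by (simp add: G.conjugate_conjugate subset_iff)
        then show "k \<in> ?d ` L" using L k by blast
      qed
      show "?d ` L \<subseteq> {h \<in> H. \<beta> h = i}"
      proof
        fix l assume "l \<in> ?d ` L"
        then obtain l' where l': "l' \<in> L" "l = ?d l'" by blast
        then obtain h where h: "h \<in> H" "l' = ?c h" "?\<beta> l' = inv' \<sigma> i" using L by blast
        then have "l = h" using l' g HG by (simp add: G.conjugate_conjugate)
        moreover have "\<beta> l = i"
          using h(3) l' permutes_inj[OF permutes_inv[OF \<sigma>]] by (simp add: inj_eq)
        ultimately show "l \<in> {h \<in> H. \<beta> h = i}" using h by simp
      qed
    qed
    moreover have "?c ` ?d ` L = L"
      using LG L g by (force simp: image_image G.conjugate_conjugate)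
    ultimately show "L = ?c ` K" by simp
  qed
  ultimately have "(?c ` K, ?c ` H) \<in> \<tau>" by (rule R_tau_transfer[OF x])
  then have "(?d ` ?c ` K, ?d ` ?c ` H) \<in> \<tau>"
    using transfer_conj[of _ _ "inv g"] g by simp
  moreover have "?d ` ?c ` L = L" if "L \<subseteq> H" for L
    using that HG g by (force simp: image_image G.conjugate_conjugate subset_iff)
  moreover have "K \<subseteq> H" using K by (auto simp: maximal_in_def)
  ultimately show "(K, H) \<in> \<tau>" by simp
qed

lemma opunit_in_R_tau: "opunit Op \<in> R_tau 1"
proof (rule RtI[OF opunit_in_R_points])
  fix K H a \<beta> i assume coh: "coherent 1 (opunit Op) H a \<beta>" and "maximal_in K {h \<in> H. \<beta> h = i}"
  then show "(K, H) \<in> \<tau>"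
    by (rule transfer_if_constant[where j = 1]) (use coherentD(4)[OF coh] in simp)
qed

abbreviation Q_tau where "Q_tau \<equiv> incomplete_coinduction G \<tau> M"

lemma Q_tau_suboperad: "Q_tau = suboperad (R_operad G M) R_tau"
  by (simp add: incomplete_coinduction_def R_tau_def[abs_def])

lemma level_Q_tau: "level Q_tau n = k_subtopology (level Op n) (R_tau n)"
proof -
  have "R_points G M n \<inter> R_tau n = R_tau n" using R_tau_R by blast
  then show ?thesis
    by (simp add: Q_tau_suboperad suboperad_def level_R k_subtopology_k_subtopology[OF Hausdorff_level_O])
qed

lemma topspace_level_Q_tau [simp]: "topspace (level Q_tau n) = R_tau n"
  using R_tau_R R_points_tables by (auto simp: level_Q_tau)

lemma act_Q_tau: "x \<in> R_tau n \<Longrightarrow> act Q_tau n p x = act Op n p x"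
  using R_tau_R by (simp add: Q_tau_suboperad suboperad_def act_R)

lemma g_operad_Q_tau: "g_operad G Q_tau"
  unfolding Q_tau_suboperad
proof (rule g_operad_suboperad[OF g_operad_R Hausdorff_level_R])
  fix n p x assume "p \<in> carrier (G \<times>\<times> sym_group n)" "x \<in> R_tau n"
  then show "act (R_operad G M) n p x \<in> R_tau n"
    by (cases p) (simp add: R_tau_act sym_group_carrier act_R R_tau_R)
qed (auto simp: R_operad_def suboperad_def opunit_in_R_tau R_tau_pcomp simp del: One_nat_def atLeastAtMost_iff)

end

section \<open>Fixed points\<close>

context coinduction_context
begin

lemma act_O_fixed_iff:
  assumes x: "x \<in> tables n" and \<sigma>: "\<sigma> permutes {1..n}" and g: "g \<in> carrier G"
  shows "act Op n (g, \<sigma>) x = x \<longleftrightarrow>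
    (\<forall>k \<in> carrier G. \<forall>i \<in> {1..n}. x (g \<otimes> k, \<sigma> i) = x (k, i))"
proof
  assume "act Op n (g, \<sigma>) x = x"
  then show "\<forall>k \<in> carrier G. \<forall>i \<in> {1..n}. x (g \<otimes> k, \<sigma> i) = x (k, i)"
    using act_O_apply[OF x \<sigma> g] by metis
next
  assume "\<forall>k \<in> carrier G. \<forall>i \<in> {1..n}. x (g \<otimes> k, \<sigma> i) = x (k, i)"
  then show "act Op n (g, \<sigma>) x = x"
    by (intro act_O_unique[OF x \<sigma> g x]) auto
qed

lemma sigma_free_if_strict:
  assumes x: "x \<in> R_points G M n" and \<sigma>: "\<sigma> permutes {1..n}"
    and fixed: "act Op n (\<one>, \<sigma>) x = x"
  shows "\<sigma> = id"
proof
  fix i show "\<sigma> i = id i"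
  proof (cases "i \<in> {1..n}")
    case True
    have one: "\<one> \<in> carrier G" by simp
    have \<sigma>i: "\<sigma> i \<in> {1..n}" using \<sigma> True by (rule permutes_in)
    have "x (\<one>, \<sigma> i) = x (\<one>, i)"
      using act_O_apply[OF R_points_tables[OF x] \<sigma> one one True] fixed by simp
    moreover have "meets M (x (\<one>, i)) (x (\<one>, i))"
      using table_in[OF R_points_tables[OF x] one True] by (rule M.meets_refl)
    ultimately show ?thesis
      using R_disjoint[OF x one \<sigma>i True] by auto
  next
    case False
    then show ?thesis using permutes_not_in[OF \<sigma>] by simp
  qed
qed

lemma sigma_free_R: "sigma_free G (R_operad G M) n"
  unfolding sigma_free_def using sigma_free_if_strict by (auto simp: act_R sym_group_carrier)

end

text \<open>Besides the rescaling an infinite supply of pairwise disjoint elements is needed, from which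
  tables with disjoint entries are made.\<close>

locale contraction_context = coinduction_context G M
  for G :: "('g, 'b) monoid_scheme" (structure) and M :: "'m top_monoid" +
  fixes scale :: "real \<Rightarrow> 'm \<Rightarrow> 'm" and mark :: "nat \<Rightarrow> 'm"
  assumes scale_closed: "s \<in> {0..1} \<Longrightarrow> a \<in> carrier M \<Longrightarrow> scale s a \<in> carrier M"
    and scale_continuous:
      "continuous_map (prod_topology (top_of_set {0..1}) (mtop M)) (mtop M) (\<lambda>(s, a). scale s a)"
    and scale_0: "a \<in> carrier M \<Longrightarrow> scale 0 a = \<one>\<^bsub>M\<^esub>"
    and scale_1: "a \<in> carrier M \<Longrightarrow> scale 1 a = a"
    and scale_meets: "s \<in> {0<..1} \<Longrightarrow> a \<in> carrier M \<Longrightarrow> b \<in> carrier M \<Longrightarrow>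
      meets M (scale s a) (scale s b) \<Longrightarrow> meets M a b"
    and mark_closed: "mark i \<in> carrier M"
    and mark_disjoint: "meets M (mark i) (mark j) \<Longrightarrow> i = j"
begin

definition table_mult :: "nat \<Rightarrow> ('g \<times> nat \<Rightarrow> 'm) \<Rightarrow> ('g \<times> nat \<Rightarrow> 'm) \<Rightarrow> 'g \<times> nat \<Rightarrow> 'm" where
  "table_mult n x z = (\<lambda>p \<in> carrier G \<times> {1..n}. x p \<otimes>\<^bsub>M\<^esub> z p)"

definition table_scale :: "nat \<Rightarrow> real \<Rightarrow> ('g \<times> nat \<Rightarrow> 'm) \<Rightarrow> 'g \<times> nat \<Rightarrow> 'm" where
  "table_scale n s x = (\<lambda>p \<in> carrier G \<times> {1..n}. scale s (x p))"

lemma table_mult_in: "x \<in> tables n \<Longrightarrow> z \<in> tables n \<Longrightarrow> table_mult n x z \<in> tables n"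
  unfolding table_mult_def by (intro restrict_in_tables M.m_closed table_in)

lemma table_scale_in: "s \<in> {0..1} \<Longrightarrow> x \<in> tables n \<Longrightarrow> table_scale n s x \<in> tables n"
  unfolding table_scale_def by (intro restrict_in_tables scale_closed table_in)

lemma table_mult_apply: "g \<in> carrier G \<Longrightarrow> i \<in> {1..n} \<Longrightarrow> table_mult n x z (g, i) = x (g, i) \<otimes>\<^bsub>M\<^esub> z (g, i)"
  by (simp add: table_mult_def)

lemma table_scale_apply: "g \<in> carrier G \<Longrightarrow> i \<in> {1..n} \<Longrightarrow> table_scale n s x (g, i) = scale s (x (g, i))"
  by (simp add: table_scale_def)

text \<open>Closed under the products and rescalings that occur in the contraction for parameters
  \<open>s > 0\<close>.  At \<open>s = 0\<close> the contraction only passes through given points, although rescaling by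
  \<open>0\<close> may leave the set.\<close>

definition stable :: "nat \<Rightarrow> ('g \<times> nat \<Rightarrow> 'm) set \<Rightarrow> bool" where
  "stable n S \<longleftrightarrow> S \<subseteq> tables n \<and> (\<forall>x \<in> S. \<forall>z \<in> S. table_mult n x z \<in> S) \<and>
     (\<forall>x \<in> S. \<forall>s \<in> {0<..1}. table_scale n s x \<in> S)"

lemma stable_Int: "stable n S \<Longrightarrow> stable n T \<Longrightarrow> stable n (S \<inter> T)"
  by (auto simp: stable_def)

lemma table_mult_tscale_0_right:
  assumes "x \<in> tables n" "z \<in> tables n" shows "table_mult n x (table_scale n 0 z) = x"
  by (rule table_eqI[OF table_mult_in[OF assms(1) table_scale_in[OF _ assms(2)]] assms(1)])
     (use table_in[OF assms(1)] table_in[OF assms(2)] in \<open>auto simp: table_mult_apply table_scale_apply scale_0\<close>)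

lemma table_mult_tscale_0_left:
  assumes "x \<in> tables n" "z \<in> tables n" shows "table_mult n (table_scale n 0 x) z = z"
  by (rule table_eqI[OF table_mult_in[OF table_scale_in[OF _ assms(1)] assms(2)] assms(2)])
     (use table_in[OF assms(1)] table_in[OF assms(2)] in \<open>auto simp: table_mult_apply table_scale_apply scale_0\<close>)

lemma table_scale_1: assumes "x \<in> tables n" shows "table_scale n 1 x = x"
  by (rule table_eqI[OF table_scale_in[OF _ assms] assms])
     (use table_in[OF assms] in \<open>auto simp: table_scale_apply scale_1\<close>)

lemma continuous_map_scale:
  assumes "continuous_map Z (top_of_set {0..1}) f" "continuous_map Z (mtop M) h"
  shows "continuous_map Z (mtop M) (\<lambda>z. scale (f z) (h z))"
proof -
  have "continuous_map Z (prod_topology (top_of_set {0..1}) (mtop M)) (\<lambda>z. (f z, h z))"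
    using assms by (simp add: continuous_map_pairwise o_def)
  from continuous_map_compose[OF this scale_continuous] show ?thesis
    by (simp add: o_def)
qed

text \<open>\<open>x\<close> moves to \<open>x z\<close> while the scale of \<open>z\<close> grows from \<open>0\<close> to \<open>1\<close>, and then to \<open>z\<close> while the scale of
  \<open>x\<close> shrinks to \<open>0\<close>.\<close>

lemma contractible_stable:
  assumes S: "stable n S" and ne: "S \<noteq> {}"
  shows "nonempty_contractible (k_subtopology (level Op n) S)"
proof -
  let ?X = "k_subtopology (level Op n) S"
  let ?Z = "prod_topology (top_of_set {0..1::real}) ?X"
  have St: "S \<subseteq> tables n" using S by (simp add: stable_def)
  have top: "topspace ?X = S" using St by auto
  \<comment> \<open>The centre of the contraction.\<close>
  obtain z where z: "z \<in> S" using ne by blast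
  then have zt: "z \<in> tables n" using St by blast
  have Z: "k_space ?Z"
    by (intro k_space_prod_topology_left k_space_k_subtopology Hausdorff_level_O
        compact_imp_locally_compact_space)
       (auto simp: compact_space_subtopology Hausdorff_space_subtopology)
  have fst: "continuous_map ?Z (top_of_set {0..1}) fst" by (rule continuous_map_fst)
  have entry: "continuous_map ?Z (mtop M) (\<lambda>p. snd p (g, i))" if "g \<in> carrier G" "i \<in> {1..n}" for g i
    using continuous_map_compose[OF continuous_map_snd
        continuous_map_from_k_subtopology[OF continuous_map_entry[OF that]]]
    by (simp add: o_def)
  have const: "continuous_map ?Z (mtop M) (\<lambda>p. z (g, i))" if "g \<in> carrier G" "i \<in> {1..n}" for g i
    using table_in[OF zt that] by (simp add: M.topspace_mtop)
  have into: "continuous_map ?Z ?X h"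
    if h: "h \<in> topspace ?Z \<rightarrow> S"
      and c: "\<And>g i. g \<in> carrier G \<Longrightarrow> i \<in> {1..n} \<Longrightarrow> continuous_map ?Z (mtop M) (\<lambda>p. h p (g, i))"
    for h
    using h St c by (intro continuous_map_into_k_subtopology[OF Z Hausdorff_level_O _ h]
        continuous_map_into_level_O[OF Z]) auto
  have "homotopic_with (\<lambda>x. True) ?X ?X id (\<lambda>x. table_mult n x z)"
  proof (subst homotopic_with, simp, intro exI[of _ "\<lambda>p. table_mult n (snd p) (table_scale n (fst p) z)"] conjI ballI)
    show "continuous_map ?Z ?X (\<lambda>p. table_mult n (snd p) (table_scale n (fst p) z))"
    proof (rule into)
      show "(\<lambda>p. table_mult n (snd p) (table_scale n (fst p) z)) \<in> topspace ?Z \<rightarrow> S"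
      proof
        fix p assume "p \<in> topspace ?Z"
        then obtain s x where p: "p = (s, x)" "s \<in> {0..1}" "x \<in> S" using top by auto
        then show "table_mult n (snd p) (table_scale n (fst p) z) \<in> S"
          using S z St zt table_mult_tscale_0_right[of x n z]
          by (cases "s = 0") (auto simp: stable_def)
      qed
      fix g i assume gi: "g \<in> carrier G" "i \<in> {1..n}"
      then show "continuous_map ?Z (mtop M) (\<lambda>p. table_mult n (snd p) (table_scale n (fst p) z) (g, i))"
        unfolding table_mult_apply[OF gi] table_scale_apply[OF gi]
        by (intro continuous_map_mult[OF Z] continuous_map_scale fst entry const)
    qed
  qed (use St zt in \<open>auto simp: top table_mult_tscale_0_right table_scale_1\<close>)
  moreover have "homotopic_with (\<lambda>x. True) ?X ?X (\<lambda>x. z) (\<lambda>x. table_mult n x z)"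
  proof (subst homotopic_with, simp, intro exI[of _ "\<lambda>p. table_mult n (table_scale n (fst p) (snd p)) z"] conjI ballI)
    show "continuous_map ?Z ?X (\<lambda>p. table_mult n (table_scale n (fst p) (snd p)) z)"
    proof (rule into)
      show "(\<lambda>p. table_mult n (table_scale n (fst p) (snd p)) z) \<in> topspace ?Z \<rightarrow> S"
      proof
        fix p assume "p \<in> topspace ?Z"
        then obtain s x where p: "p = (s, x)" "s \<in> {0..1}" "x \<in> S" using top by auto
        then show "table_mult n (table_scale n (fst p) (snd p)) z \<in> S"
          using S z St zt table_mult_tscale_0_left[of x n z]
          by (cases "s = 0") (auto simp: stable_def)
      qed
      fix g i assume gi: "g \<in> carrier G" "i \<in> {1..n}"
      then show "continuous_map ?Z (mtop M) (\<lambda>p. table_mult n (table_scale n (fst p) (snd p)) z (g, i))"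
        unfolding table_mult_apply[OF gi] table_scale_apply[OF gi]
        by (intro continuous_map_mult[OF Z] continuous_map_scale fst entry const)
    qed
  qed (use St zt in \<open>auto simp: top table_mult_tscale_0_left table_scale_1\<close>)
  ultimately have "homotopic_with (\<lambda>x. True) ?X ?X id (\<lambda>x. z)"
    using homotopic_with_sym homotopic_with_trans by blast
  then show ?thesis
    using ne top by (auto simp: nonempty_contractible_def contractible_space_def)
qed

lemma table_mult_R:
  assumes x: "x \<in> R_points G M n" and z: "z \<in> R_points G M n"
  shows "table_mult n x z \<in> R_points G M n"
  unfolding R_points_iff
proof (intro conjI ballI impI)
  note xt = table_in[OF R_points_tables[OF x]] and zt = table_in[OF R_points_tables[OF z]]
  show "table_mult n x z \<in> tables n"
    using x z by (intro table_mult_in R_points_tables)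
  fix g i assume g: "g \<in> carrier G" and i: "i \<in> {1..n}"
  show "\<not> meets M (table_mult n x z (g, i)) (table_mult n x z (g, j))" if j: "j \<in> {1..n}" and "i \<noteq> j" for j
    unfolding table_mult_apply[OF g i] table_mult_apply[OF g j]
    using M.meets_prefix[OF xt[OF g i] zt[OF g i] xt[OF g j] zt[OF g j]]
      R_disjoint[OF x g i j \<open>i \<noteq> j\<close>] by blast
  fix h assume h: "h \<in> carrier G"
  show "table_mult n x z (g, i) = table_mult n x z (h, i) \<or> \<not> meets M (table_mult n x z (g, i)) (table_mult n x z (h, i))"
    unfolding table_mult_apply[OF g i] table_mult_apply[OF h i]
    using meets_mult_strict[OF xt[OF g i] zt[OF g i] xt[OF h i] zt[OF h i] _ R_strict[OF x i g h]]
      R_strict[OF z i g h] by metis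
qed

lemma table_scale_R:
  assumes x: "x \<in> R_points G M n" and s: "s \<in> {0<..1}"
  shows "table_scale n s x \<in> R_points G M n"
  unfolding R_points_iff
proof (intro conjI ballI impI)
  note xt = table_in[OF R_points_tables[OF x]]
  show "table_scale n s x \<in> tables n"
    using x s by (intro table_scale_in R_points_tables) auto
  fix g i assume g: "g \<in> carrier G" and i: "i \<in> {1..n}"
  show "\<not> meets M (table_scale n s x (g, i)) (table_scale n s x (g, j))" if j: "j \<in> {1..n}" and "i \<noteq> j" for j
    unfolding table_scale_apply[OF g i] table_scale_apply[OF g j]
    using scale_meets[OF s xt[OF g i] xt[OF g j]] R_disjoint[OF x g i j \<open>i \<noteq> j\<close>] by blast
  fix h assume h: "h \<in> carrier G"
  show "table_scale n s x (g, i) = table_scale n s x (h, i) \<or> \<not> meets M (table_scale n s x (g, i)) (table_scale n s x (h, i))"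
    unfolding table_scale_apply[OF g i] table_scale_apply[OF h i]
    using scale_meets[OF s xt[OF g i] xt[OF h i]] R_strict[OF x i g h] by metis
qed

lemma stable_R: "stable n (R_points G M n)"
  unfolding stable_def using R_points_tables table_mult_R table_scale_R by blast

definition fixed_tables :: "nat \<Rightarrow> ('g \<times> (nat \<Rightarrow> nat)) set \<Rightarrow> ('g \<times> nat \<Rightarrow> 'm) set" where
  "fixed_tables n \<Phi> = {x \<in> tables n. \<forall>p \<in> \<Phi>. act Op n p x = x}"

lemma fixed_tables_iff:
  assumes "\<Phi> \<subseteq> carrier (G \<times>\<times> sym_group n)"
  shows "x \<in> fixed_tables n \<Phi> \<longleftrightarrow> x \<in> tables n \<and>
    (\<forall>(g, \<sigma>) \<in> \<Phi>. \<forall>k \<in> carrier G. \<forall>i \<in> {1..n}. x (g \<otimes> k, \<sigma> i) = x (k, i))"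
proof -
  have "act Op n (g, \<sigma>) x = x \<longleftrightarrow>
      (\<forall>k \<in> carrier G. \<forall>i \<in> {1..n}. x (g \<otimes> k, \<sigma> i) = x (k, i))"
    if "x \<in> tables n" "(g, \<sigma>) \<in> \<Phi>" for g \<sigma>
    using assms that by (intro act_O_fixed_iff) (auto simp: sym_group_carrier)
  then show ?thesis unfolding fixed_tables_def by fast
qed

lemma stable_fixed:
  assumes \<Phi>: "\<Phi> \<subseteq> carrier (G \<times>\<times> sym_group n)"
  shows "stable n (fixed_tables n \<Phi>)"
proof -
  have *: "g \<otimes> k \<in> carrier G \<and> \<sigma> i \<in> {1..n}"
    if "(g, \<sigma>) \<in> \<Phi>" "k \<in> carrier G" "i \<in> {1..n}" for g \<sigma> k i
    using \<Phi> that permutes_in[of \<sigma> n i] by (auto simp: sym_group_carrier)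
  have "table_mult n x z \<in> fixed_tables n \<Phi>" if x: "x \<in> fixed_tables n \<Phi>" and z: "z \<in> fixed_tables n \<Phi>" for x z
    unfolding fixed_tables_iff[OF \<Phi>]
  proof (intro conjI ballI, goal_cases)
    case 1 then show ?case using x z by (simp add: fixed_tables_def table_mult_in)
  next
    case (2 p)
    obtain g \<sigma> where p: "p = (g, \<sigma>)" by (cases p)
    then show ?case
      using *[of g \<sigma>] x z 2 unfolding fixed_tables_iff[OF \<Phi>]
      by (fastforce simp: table_mult_apply simp del: atLeastAtMost_iff)
  qed
  moreover have "table_scale n s x \<in> fixed_tables n \<Phi>" if x: "x \<in> fixed_tables n \<Phi>" and s: "s \<in> {0<..1}" for x s
    unfolding fixed_tables_iff[OF \<Phi>]
  proof (intro conjI ballI, goal_cases)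
    case 1 then show ?case using x s by (intro table_scale_in) (auto simp: fixed_tables_def)
  next
    case (2 p)
    obtain g \<sigma> where p: "p = (g, \<sigma>)" by (cases p)
    then show ?case
      using *[of g \<sigma>] x 2 unfolding fixed_tables_iff[OF \<Phi>]
      by (fastforce simp: table_scale_apply simp del: atLeastAtMost_iff)
  qed
  ultimately show ?thesis
    by (auto simp: stable_def fixed_tables_def)
qed

text \<open>The same row everywhere: it is fixed by \<open>H \<times> {id}\<close>, and its coherent twist maps are constant, so
  it supports only the trivial transfers.\<close>

definition const_table :: "nat \<Rightarrow> 'g \<times> nat \<Rightarrow> 'm" where
  "const_table n = (\<lambda>p \<in> carrier G \<times> {1..n}. mark (snd p))"

lemma const_table_apply: "g \<in> carrier G \<Longrightarrow> i \<in> {1..n} \<Longrightarrow> const_table n (g, i) = mark i"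
  by (simp add: const_table_def)

lemma const_table_in: "const_table n \<in> tables n"
  unfolding const_table_def by (intro restrict_in_tables mark_closed)

lemma const_table_R: "const_table n \<in> R_points G M n"
  using const_table_in mark_disjoint unfolding R_points_iff by (auto simp: const_table_apply)

lemma contractible_level_R: "nonempty_contractible (level (R_operad G M) n)"
  unfolding level_R using const_table_R by (intro contractible_stable stable_R) auto

end

locale realization_context = contraction_context G M scale mark + transfer_context G M \<tau>
  for G :: "('g, 'b) monoid_scheme" (structure) and M :: "'m top_monoid" and scale mark \<tau>
begin

lemma stable_R_tau: "stable n (R_tau n)"
  unfolding stable_def
proof (intro conjI ballI)
  show "R_tau n \<subseteq> tables n" using R_tau_R R_points_tables by blast
  fix x assume x: "x \<in> R_tau n"
  note xt = table_in[OF R_points_tables[OF R_tau_R[OF x]]]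
  show "table_mult n x z \<in> R_tau n" if z: "z \<in> R_tau n" for z
  proof (rule R_tau_coarser[OF x table_mult_R[OF R_tau_R[OF x] R_tau_R[OF z]]])
    note zt = table_in[OF R_points_tables[OF R_tau_R[OF z]]]
    fix g h i j assume g: "g \<in> carrier G" and h: "h \<in> carrier G" and i: "i \<in> {1..n}" and j: "j \<in> {1..n}"
      and "meets M (table_mult n x z (g, i)) (table_mult n x z (h, j))"
    then show "meets M (x (g, i)) (x (h, j))"
      unfolding table_mult_apply[OF g i] table_mult_apply[OF h j]
      using M.meets_prefix[OF xt[OF g i] zt[OF g i] xt[OF h j] zt[OF h j]] by blast
  qed
  show "table_scale n s x \<in> R_tau n" if s: "s \<in> {0<..1}" for s
  proof (rule R_tau_coarser[OF x table_scale_R[OF R_tau_R[OF x] s]])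
    fix g h i j assume g: "g \<in> carrier G" and h: "h \<in> carrier G" and i: "i \<in> {1..n}" and j: "j \<in> {1..n}"
      and "meets M (table_scale n s x (g, i)) (table_scale n s x (h, j))"
    then show "meets M (x (g, i)) (x (h, j))"
      unfolding table_scale_apply[OF g i] table_scale_apply[OF h j]
      using scale_meets[OF s xt[OF g i] xt[OF h j]] by blast
  qed
qed

lemma fixed_points_Q_tau: "fixed_points Q_tau n \<Phi> = R_tau n \<inter> fixed_tables n \<Phi>"
  using R_tau_R R_points_tables by (auto simp: fixed_points_def fixed_tables_def act_Q_tau)

lemma contractible_fixed_points:
  assumes "\<Phi> \<subseteq> carrier (G \<times>\<times> sym_group n)" "fixed_points Q_tau n \<Phi> \<noteq> {}"
  shows "nonempty_contractible (k_subtopology (level Q_tau n) (fixed_points Q_tau n \<Phi>))"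
proof -
  have "R_tau n \<inter> (R_tau n \<inter> fixed_tables n \<Phi>) = R_tau n \<inter> fixed_tables n \<Phi>" by blast
  then have "k_subtopology (level Q_tau n) (fixed_points Q_tau n \<Phi>)
      = k_subtopology (level Op n) (R_tau n \<inter> fixed_tables n \<Phi>)"
    by (simp add: level_Q_tau fixed_points_Q_tau k_subtopology_k_subtopology[OF Hausdorff_level_O])
  with assms show ?thesis
    using contractible_stable[OF stable_Int[OF stable_R_tau stable_fixed[OF assms(1)]]]
    by (simp add: fixed_points_Q_tau)
qed

lemma const_table_R_tau: "const_table n \<in> R_tau n"
proof (rule RtI[OF const_table_R])
  fix K H a \<beta> i assume coh: "coherent n (const_table n) H a \<beta>" and K: "maximal_in K {h \<in> H. \<beta> h = i}"
  note D = coherentD[OF coh]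
  have one: "\<one> \<in> H" using D(1) by (rule subgroup.one_closed)
  show "(K, H) \<in> \<tau>"
  proof (rule transfer_if_constant[OF coh K])
    fix h assume h: "h \<in> H"
    show "\<beta> h = \<beta> \<one>"
      using D(5)[OF h one] mark_disjoint
      unfolding const_table_apply[OF D(3)[OF h] D(4)[OF h]] const_table_apply[OF D(3)[OF one] D(4)[OF one]]
      by blast
  qed
qed

lemma fixed_points_trivial_graph:
  assumes H: "subgroup H G"
  shows "const_table n \<in> fixed_points Q_tau n (H \<times> {id})"
proof -
  have HG: "H \<subseteq> carrier G" using H by (rule subgroup.subset)
  then have "H \<times> {id} \<subseteq> carrier (G \<times>\<times> sym_group n)"
    by (auto simp: sym_group_carrier permutes_id)
  then show ?thesis
    using HG const_table_R_tau const_table_in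
    by (auto simp: fixed_points_Q_tau fixed_tables_iff const_table_apply subset_iff)
qed

lemma sigma_free_Q_tau: "sigma_free G Q_tau n"
  unfolding sigma_free_def using sigma_free_if_strict[OF R_tau_R]
  by (auto simp: act_Q_tau sym_group_carrier simp del: atLeastAtMost_iff One_nat_def)

text \<open>Nonempty fixed point spaces are contractible, so the family may be taken to consist of all
  subgroups that have a fixed point; conjugate subgroups have translated fixed points.\<close>

lemma N_infty_operad_Q_tau: "N_infty_operad G Q_tau"
  unfolding N_infty_operad_def
proof (intro conjI allI g_operad_Q_tau sigma_free_Q_tau)
  show "nonempty_contractible (level Q_tau 0)"
    unfolding level_Q_tau using const_table_R_tau by (intro contractible_stable stable_R_tau) auto
  fix n
  let ?P = "G \<times>\<times> sym_group n"
  have P: "group ?P" by (intro DirProd_group G.is_group sym_group_is_group)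
  interpret P: group ?P by (rule P)
  have action: "group_action ?P (R_tau n) (act Q_tau n)"
    using g_operad.action[OF g_operad_Q_tau, of n] by simp
  define F where "F = {\<Phi>. subgroup \<Phi> ?P \<and> fixed_points Q_tau n \<Phi> \<noteq> {}}"
  have fixed: "fixed_points Q_tau n \<Phi> = {x \<in> R_tau n. \<forall>p \<in> \<Phi>. act Q_tau n p x = x}" for \<Phi>
    by (simp add: fixed_points_def)
  have "family_of_subgroups ?P F"
    unfolding family_of_subgroups_def
  proof (intro conjI ballI allI impI)
    fix \<Phi> assume \<Phi>: "\<Phi> \<in> F"
    then show sub: "subgroup \<Phi> ?P" by (simp add: F_def)
    obtain x where x: "x \<in> R_tau n" "\<And>p. p \<in> \<Phi> \<Longrightarrow> act Q_tau n p x = x"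
      using \<Phi> by (auto simp: F_def fixed)
    show "\<Psi> \<in> F" if "subgroup \<Psi> ?P \<and> \<Psi> \<subseteq> \<Phi>" for \<Psi>
      using that x unfolding F_def fixed by blast
    fix g assume g: "g \<in> carrier ?P"
    let ?c = "\<lambda>h. g \<otimes>\<^bsub>?P\<^esub> h \<otimes>\<^bsub>?P\<^esub> inv\<^bsub>?P\<^esub> g"
    have gx: "act Q_tau n g x \<in> R_tau n"
      using group_action.element_image[OF action g x(1)] by simp
    have "subgroup (?c ` \<Phi>) ?P"
      using P.subgroup_conjugate[OF sub P.inv_closed[OF g]] g by simp
    moreover have "act Q_tau n (?c p) (act Q_tau n g x) = act Q_tau n g x" if p: "p \<in> \<Phi>" for p
    proof -
      have pP: "p \<in> carrier ?P" using sub p by (rule subgroup.mem_carrier)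
      have "act Q_tau n (?c p) (act Q_tau n g x) = act Q_tau n (?c p \<otimes>\<^bsub>?P\<^esub> g) x"
        using g pP by (intro group_action.composition_rule[OF action x(1), symmetric])
           (simp_all del: carrier_DirProd)
      also have "?c p \<otimes>\<^bsub>?P\<^esub> g = g \<otimes>\<^bsub>?P\<^esub> p"
        using g pP by (simp add: P.m_assoc del: carrier_DirProd one_DirProd)
      also have "act Q_tau n (g \<otimes>\<^bsub>?P\<^esub> p) x = act Q_tau n g (act Q_tau n p x)"
        using g pP by (intro group_action.composition_rule[OF action x(1)])
      finally show ?thesis using x(2)[OF p] by simp
    qed
    ultimately show "?c ` \<Phi> \<in> F"
      using gx by (auto simp: F_def fixed)
  qed
  moreover have "\<forall>H. subgroup H G \<longrightarrow> H \<times> {id} \<in> F"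
  proof (intro allI impI)
    fix H assume H: "subgroup H G"
    have "subgroup {id} (sym_group n)"
      using group.triv_subgroup[OF sym_group_is_group, of n] by (simp add: sym_group_one)
    then have "subgroup (H \<times> {id}) ?P"
      by (rule DirProd_subgroups[OF G.is_group H sym_group_is_group])
    with fixed_points_trivial_graph[OF H] show "H \<times> {id} \<in> F" by (auto simp: F_def)
  qed
  moreover have "universal_level G Q_tau n F"
    unfolding universal_level_def
  proof (intro allI impI)
    fix \<Phi> assume sub: "subgroup \<Phi> ?P"
    then show "if \<Phi> \<in> F then nonempty_contractible (k_subtopology (level Q_tau n) (fixed_points Q_tau n \<Phi>))
        else fixed_points Q_tau n \<Phi> = {}"
      using contractible_fixed_points[OF subgroup.subset[OF sub]] by (auto simp: F_def)
  qed
  ultimately show "\<exists>F. family_of_subgroups ?P F \<and> (\<forall>H. subgroup H G \<longrightarrow> H \<times> {id} \<in> F) \<and>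
      universal_level G Q_tau n F" by blast
qed

subsection \<open>Admissible orbits\<close>

lemma lcos_stabilizer:
  assumes K: "subgroup K G" and g: "g \<in> carrier G"
  shows "g <# K = K \<longleftrightarrow> g \<in> K"
proof
  assume "g <# K = K"
  moreover have "g \<otimes> \<one> \<in> g <# K"
    using subgroup.one_closed[OF K] by (auto simp: l_coset_def)
  ultimately show "g \<in> K" using g by simp
next
  assume "g \<in> K"
  then have "g \<in> \<one> <# K"
    using G.lcos_mult_one[OF subgroup.subset[OF K]] by simp
  then show "g <# K = K"
    using G.l_repr_independence[OF _ _ K, of g "\<one>"] G.lcos_mult_one[OF subgroup.subset[OF K]]
    by simp
qed

context
  fixes K H assumes K: "subgroup K G" and H: "subgroup H G" and KH: "K \<subseteq> H"
begin

definition "orbit_set = (\<lambda>h. h <# K) ` H"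

lemma HG: "h \<in> H \<Longrightarrow> h \<in> carrier G"
  using H by (rule subgroup.mem_carrier)

lemma lcos_lcos:
  "h \<in> carrier G \<Longrightarrow> k \<in> carrier G \<Longrightarrow> C \<subseteq> carrier G \<Longrightarrow>
    h <# (k <# C) = (h \<otimes> k) <# C"
  by (simp add: G.lcos_m_assoc)

lemma orbit_subset: "C \<in> orbit_set \<Longrightarrow> C \<subseteq> carrier G"
  unfolding orbit_set_def using G.l_coset_subset_G[OF subgroup.subset[OF K]] HG by blast

lemma orbit_closed: "h \<in> H \<Longrightarrow> C \<in> orbit_set \<Longrightarrow> h <# C \<in> orbit_set"
  unfolding orbit_set_def
  using HG subgroup.m_closed[OF H] lcos_lcos[OF _ _ subgroup.subset[OF K]] by force

lemma K_in_orbit: "K \<in> orbit_set"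
  unfolding orbit_set_def
  using G.lcos_mult_one[OF subgroup.subset[OF K]] subgroup.one_closed[OF H] by (metis image_eqI)

lemma lcos_inject:
  assumes "h \<in> carrier G" "C \<subseteq> carrier G" "D \<subseteq> carrier G" "h <# C = h <# D"
  shows "C = D"
proof -
  have "inv h <# (h <# C) = inv h <# (h <# D)"
    using assms by simp
  with assms(1-3) show ?thesis by (simp add: lcos_lcos G.lcos_mult_one)
qed

lemma finite_orbit: "finite orbit_set"
  unfolding orbit_set_def using finite_carrier subgroup.subset[OF H] by (auto intro: finite_subset)

context
  fixes en assumes en: "bij_betw en {1..card orbit_set} orbit_set"
begin

abbreviation "N \<equiv> card orbit_set"

definition orbit_perm :: "'g \<Rightarrow> nat \<Rightarrow> nat" where
  "orbit_perm h i = (if i \<in> {1..N} then inv_into {1..N} en (h <# en i) else i)"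

lemma en_in: "i \<in> {1..N} \<Longrightarrow> en i \<in> orbit_set"
  using en by (auto simp: bij_betw_def)

lemma en_inject: "i \<in> {1..N} \<Longrightarrow> j \<in> {1..N} \<Longrightarrow> en i = en j \<Longrightarrow> i = j"
  using inj_onD[OF bij_betw_imp_inj_on[OF en]] by blast

lemma orbit_perm:
  assumes "h \<in> H" "i \<in> {1..N}"
  shows "orbit_perm h i \<in> {1..N}" "en (orbit_perm h i) = h <# en i"
proof -
  have "h <# en i \<in> en ` {1..N}"
    using orbit_closed[OF assms(1) en_in[OF assms(2)]] en by (simp add: bij_betw_def)
  then show "orbit_perm h i \<in> {1..N}" "en (orbit_perm h i) = h <# en i"
    unfolding orbit_perm_def using assms(2) by (simp_all only: if_True inv_into_into f_inv_into_f)
qed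

lemma orbit_perm_permutes: assumes h: "h \<in> H" shows "orbit_perm h permutes {1..N}"
proof -
  have "inj_on (orbit_perm h) {1..N}"
  proof (rule inj_onI)
    fix i j assume i: "i \<in> {1..N}" and j: "j \<in> {1..N}" and "orbit_perm h i = orbit_perm h j"
    then have "h <# en i = h <# en j"
      using orbit_perm(2)[OF h i] orbit_perm(2)[OF h j] by simp
    then have "en i = en j"
      using lcos_inject[OF HG[OF h] orbit_subset[OF en_in[OF i]] orbit_subset[OF en_in[OF j]]] by blast
    with i j show "i = j" by (rule en_inject)
  qed
  moreover have "orbit_perm h ` {1..N} \<subseteq> {1..N}"
    using orbit_perm(1)[OF h] by blast
  ultimately have "bij_betw (orbit_perm h) {1..N} {1..N}"
    by (simp add: bij_betw_def endo_inj_surj)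
  then show ?thesis
    by (rule bij_imp_permutes) (simp only: orbit_perm_def if_False)
qed

lemma graph_subgroup_orbit:
  "graph_subgroup H orbit_set (\<lambda>h C. h <# C) en = (\<lambda>h. (h, orbit_perm h)) ` H"
  by (simp add: graph_subgroup_def orbit_perm_def[abs_def])

lemma fixed_graph_iff:
  "x \<in> fixed_points Q_tau N ((\<lambda>h. (h, orbit_perm h)) ` H) \<longleftrightarrow> x \<in> R_tau N \<and>
    (\<forall>h \<in> H. \<forall>k \<in> carrier G. \<forall>i \<in> {1..N}. x (h \<otimes> k, orbit_perm h i) = x (k, i))"
proof -
  have "(\<lambda>h. (h, orbit_perm h)) ` H \<subseteq> carrier (G \<times>\<times> sym_group N)"
    using HG orbit_perm_permutes by (auto simp: sym_group_carrier)
  from fixed_tables_iff[OF this] show ?thesis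
    using R_tau_R R_points_tables by (auto simp: fixed_points_Q_tau)
qed

text \<open>Along \<open>h \<mapsto> hK\<close> an invariant table is constant, so this is a coherent twist map on \<open>H\<close>.  Its
  fibre over \<open>K\<close> is \<open>K\<close> itself.\<close>

lemma transfer_if_fixed:
  assumes x: "x \<in> fixed_points Q_tau N ((\<lambda>h. (h, orbit_perm h)) ` H)"
  shows "(K, H) \<in> \<tau>"
proof -
  have "K \<in> en ` {1..N}" using K_in_orbit en by (simp add: bij_betw_def)
  then obtain i0 where i0: "i0 \<in> {1..N}" "en i0 = K" by blast
  have xR: "x \<in> R_tau N" and fx: "\<And>h k i. h \<in> H \<Longrightarrow> k \<in> carrier G \<Longrightarrow> i \<in> {1..N} \<Longrightarrow>
      x (h \<otimes> k, orbit_perm h i) = x (k, i)"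
    using x unfolding fixed_graph_iff by blast+
  have one: "\<one> \<in> carrier G" by simp
  have coh: "coherent N x H \<one> (\<lambda>h. orbit_perm h i0)"
  proof (rule coherentI[OF H one])
    show "orbit_perm h i0 \<in> {1..N}" if "h \<in> H" for h using orbit_perm(1)[OF that i0(1)] .
    show "meets M (x (h1 \<otimes> \<one>, orbit_perm h1 i0)) (x (h2 \<otimes> \<one>, orbit_perm h2 i0))"
      if "h1 \<in> H" "h2 \<in> H" for h1 h2
      unfolding fx[OF that(1) one i0(1)] fx[OF that(2) one i0(1)]
      by (rule M.meets_refl[OF table_in[OF R_points_tables[OF R_tau_R[OF xR]] one i0(1)]])
  qed
  have "orbit_perm h i0 = i0 \<longleftrightarrow> h \<in> K" if h: "h \<in> H" for h
  proof -
    have "orbit_perm h i0 = i0 \<longleftrightarrow> h <# K = K"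
      using orbit_perm[OF h i0(1)] i0 en_inject by metis
    then show ?thesis using lcos_stabilizer[OF K HG[OF h]] by simp
  qed
  then have "{h \<in> H. orbit_perm h i0 = i0} = K" using KH by auto
  then have "maximal_in K {h \<in> H. orbit_perm h i0 = i0}"
    using K by (auto simp: maximal_in_def)
  with xR coh show ?thesis by (rule R_tau_transfer)
qed

text \<open>The free left \<open>H\<close>-set \<open>G\<close> is trivialized by a choice of representatives of the right cosets of
  \<open>H\<close>: each \<open>g\<close> is \<open>shift g\<close> times
  the representative of its coset.\<close>

definition rep :: "'g \<Rightarrow> 'g" where
  "rep g = (SOME r. r \<in> H #> g)"

definition shift :: "'g \<Rightarrow> 'g" where
  "shift g = g \<otimes> inv rep g"

lemma rep_shift:
  assumes g: "g \<in> carrier G"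
  shows "rep g \<in> carrier G" "shift g \<in> H" "shift g \<otimes> rep g = g"
proof -
  have "g \<in> H #> g" using G.rcos_self[OF g H] .
  then have "rep g \<in> H #> g" unfolding rep_def by (rule someI)
  then obtain h where h: "h \<in> H" "rep g = h \<otimes> g" by (auto simp: r_coset_def)
  then show r: "rep g \<in> carrier G" using g HG by simp
  have "shift g = g \<otimes> (inv g \<otimes> inv h)"
    using h g HG by (simp add: shift_def G.inv_mult_group)
  also have "\<dots> = inv h" using h g HG by (simp add: G.m_assoc[symmetric])
  finally show "shift g \<in> H" using h subgroup.m_inv_closed[OF H] by simp
  show "shift g \<otimes> rep g = g" using g r by (simp add: shift_def G.m_assoc)
qed

lemma rep_translate:
  assumes h: "h \<in> H" and g: "g \<in> carrier G"
  shows "rep (h \<otimes> g) = rep g" "shift (h \<otimes> g) = h \<otimes> shift g"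
proof -
  have "h \<otimes> g \<in> H #> g" using h by (auto simp: r_coset_def)
  then have "H #> (h \<otimes> g) = H #> g"
    using G.repr_independence[OF _ g H] by simp
  then show r: "rep (h \<otimes> g) = rep g" by (simp add: rep_def)
  show "shift (h \<otimes> g) = h \<otimes> shift g"
    unfolding shift_def r using HG[OF h] g rep_shift(1)[OF g] by (simp add: G.m_assoc)
qed

text \<open>The label of a position is its orbit under the diagonal action of \<open>H\<close> on \<open>G \<times> H/K\<close>, given by the
  element of the orbit whose first component is a chosen representative.\<close>

definition label :: "'g \<Rightarrow> nat \<Rightarrow> 'g \<times> 'g set" where
  "label g i = (rep g, inv shift g <# en i)"

lemma label_in: "g \<in> carrier G \<Longrightarrow> i \<in> {1..N} \<Longrightarrow> label g i \<in> carrier G \<times> orbit_set"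
  using rep_shift[of g] orbit_closed en_in subgroup.m_inv_closed[OF H] by (simp add: label_def del: atLeastAtMost_iff)

lemma label_inject:
  assumes g: "g \<in> carrier G" and i: "i \<in> {1..N}" and j: "j \<in> {1..N}" and "label g i = label g j"
  shows "i = j"
proof -
  have "inv shift g <# en i = inv shift g <# en j"
    using assms by (simp add: label_def)
  moreover have "inv shift g \<in> carrier G" using rep_shift(2)[OF g] HG by simp
  ultimately have "en i = en j"
    using lcos_inject orbit_subset[OF en_in[OF i]] orbit_subset[OF en_in[OF j]] by blast
  with i j show ?thesis by (rule en_inject)
qed

lemma label_translate:
  assumes h: "h \<in> H" and g: "g \<in> carrier G" and i: "i \<in> {1..N}"
  shows "label (h \<otimes> g) (orbit_perm h i) = label g i"
proof -
  note s = HG[OF rep_shift(2)[OF g]] and h' = HG[OF h]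
  have "inv (h \<otimes> shift g) \<otimes> h = inv shift g"
    using s h' by (simp add: G.inv_mult_group G.m_assoc)
  then show ?thesis
    using s h' orbit_subset[OF en_in[OF i]]
    by (simp add: label_def rep_translate[OF h g] orbit_perm(2)[OF h i] lcos_lcos)
qed

lemma label_eq:
  assumes g: "g \<in> carrier G" and g': "g' \<in> carrier G" and i: "i \<in> {1..N}" and i': "i' \<in> {1..N}"
    and eq: "label g i = label g' i'"
  obtains h where "h \<in> H" "g = h \<otimes> g'" "en i = h <# en i'"
proof -
  note s = rep_shift[OF g] and s' = rep_shift[OF g']
  let ?h = "shift g \<otimes> inv shift g'"
  have h: "?h \<in> H" using s s' H by (simp add: subgroup.m_closed subgroup.m_inv_closed)
  have "g = shift g \<otimes> rep g'" using s(3) eq by (simp add: label_def)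
  also have "rep g' = inv shift g' \<otimes> g'"
  proof -
    have "inv shift g' \<otimes> (shift g' \<otimes> rep g') = rep g'"
      using HG[OF s'(2)] s'(1) by (simp add: G.m_assoc[symmetric])
    then show ?thesis by (simp only: s'(3))
  qed
  finally have g_eq: "g = ?h \<otimes> g'"
    using HG[OF s(2)] HG[OF s'(2)] g' by (simp add: G.m_assoc)
  have "en i = shift g <# (inv shift g <# en i)"
    using HG[OF s(2)] orbit_subset[OF en_in[OF i]] by (simp add: lcos_lcos G.lcos_mult_one)
  also have "inv shift g <# en i = inv shift g' <# en i'"
    using eq by (simp add: label_def)
  finally have "en i = ?h <# en i'"
    using HG[OF s(2)] HG[OF s'(2)] orbit_subset[OF en_in[OF i']] by (simp add: lcos_lcos)
  with h g_eq show thesis by (rule that)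
qed

text \<open>Give every \<open>H\<close>-orbit of positions its own element, disjoint from all others.  A coherent twist map
  on \<open>J\<close> stays in a single orbit, hence \<open>J \<subseteq> H\<close> and the map is \<open>j \<mapsto> j c K\<close> for some \<open>c\<close> in
  \<open>H\<close>.  The fibre that contains \<open>\<one>\<close> is the stabilizer, the intersection of \<open>J\<close> with a conjugate of
  \<open>K\<close> by an element of \<open>H\<close>; so the transfer is a restriction of a conjugate of \<open>K \<rightarrow> H\<close>.\<close>

lemma fixed_if_transfer:
  assumes KH\<tau>: "(K, H) \<in> \<tau>"
  shows "fixed_points Q_tau N ((\<lambda>h. (h, orbit_perm h)) ` H) \<noteq> {}"
proof -
  have "finite (carrier G \<times> orbit_set)" using finite_carrier finite_orbit by simp
  then obtain code :: "'g \<times> 'g set \<Rightarrow> nat" where code: "inj_on code (carrier G \<times> orbit_set)"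
    using finite_imp_inj_to_nat_seg by blast
  define x where "x = (\<lambda>p \<in> carrier G \<times> {1..N}. mark (code (label (fst p) (snd p))))"
  have x: "x (g, i) = mark (code (label g i))" if "g \<in> carrier G" "i \<in> {1..N}" for g i
    using that by (simp add: x_def)
  have meets: "label g i = label h j"
    if g: "g \<in> carrier G" "i \<in> {1..N}" and h: "h \<in> carrier G" "j \<in> {1..N}"
      and m: "meets M (x (g, i)) (x (h, j))" for g i h j
  proof -
    have "code (label g i) = code (label h j)"
      using m unfolding x[OF g] x[OF h] by (rule mark_disjoint)
    then show ?thesis
      by (rule inj_onD[OF code _ label_in[OF g] label_in[OF h]])
  qed
  have xR: "x \<in> R_points G M N"
    unfolding R_points_iff
  proof (intro conjI ballI impI)
    show "x \<in> tables N" unfolding x_def by (intro restrict_in_tables mark_closed)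
    fix g i assume g: "g \<in> carrier G" and i: "i \<in> {1..N}"
    show "\<not> meets M (x (g, i)) (x (g, j))" if "j \<in> {1..N}" "i \<noteq> j" for j
      using meets[OF g i g that(1)] label_inject[OF g i that(1)] that(2) by blast
    fix h assume h: "h \<in> carrier G"
    show "x (g, i) = x (h, i) \<or> \<not> meets M (x (g, i)) (x (h, i))"
      using meets[OF g i h i] x[OF g i] x[OF h i] by metis
  qed
  have "x \<in> R_tau N"
  proof (rule RtI[OF xR])
    fix L J a \<beta> i assume coh: "coherent N x J a \<beta>" and L: "maximal_in L {h \<in> J. \<beta> h = i}"
    note D = coherentD[OF coh]
    have one: "\<one> \<in> J" using D(1) by (rule subgroup.one_closed)
    have J: "j \<in> H \<and> en (\<beta> j) = j <# en (\<beta> \<one>)" if j: "j \<in> J" for j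
    proof -
      have "label (j \<otimes> a) (\<beta> j) = label (\<one> \<otimes> a) (\<beta> \<one>)"
        by (rule meets[OF D(3)[OF j] D(4)[OF j] D(3)[OF one] D(4)[OF one] D(5)[OF j one]])
      then obtain h where h: "h \<in> H" "j \<otimes> a = h \<otimes> (\<one> \<otimes> a)"
        "en (\<beta> j) = h <# en (\<beta> \<one>)"
        using label_eq[OF D(3)[OF j] D(3)[OF one] D(4)[OF j] D(4)[OF one]] by blast
      then have "j = h"
        using D(2) HG subgroup.mem_carrier[OF D(1) j] by simp
      with h show ?thesis by simp
    qed
    obtain c where c: "c \<in> H" "en (\<beta> \<one>) = c <# K"
      using en_in[OF D(4)[OF one]] by (auto simp: orbit_set_def)
    note cG = HG[OF c(1)] and KG = subgroup.subset[OF K]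
    have "\<one> \<in> {h \<in> J. \<beta> h = i}"
      using L by (auto simp: maximal_in_def dest: subgroup.one_closed)
    then have i: "i = \<beta> \<one>" by simp
    let ?c = "\<lambda>k. c \<otimes> k \<otimes> inv c"
    \<comment> \<open>The fibre is the stabilizer of the coset \<open>c K\<close>.\<close>
    have stab: "\<beta> j = i \<longleftrightarrow> j \<in> ?c ` K" if j: "j \<in> J" for j
    proof -
      have jG: "j \<in> carrier G" using J[OF j] HG by blast
      have "\<beta> j = i \<longleftrightarrow> en (\<beta> j) = en (\<beta> \<one>)"
        unfolding i using en_inject[OF D(4)[OF j] D(4)[OF one]] by auto
      also have "\<dots> \<longleftrightarrow> j <# (c <# K) = c <# K"
        using J[OF j] c(2) by simp
      also have "\<dots> \<longleftrightarrow> inv c <# (j <# (c <# K)) = inv c <# (c <# K)"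
        using lcos_inject[of "inv c"] cG jG G.l_coset_subset_G[OF KG cG]
          G.l_coset_subset_G[OF G.l_coset_subset_G[OF KG cG] jG] by auto
      also have "\<dots> \<longleftrightarrow> (inv c \<otimes> j \<otimes> c) <# K = K"
        using cG jG KG G.l_coset_subset_G[OF KG cG] by (simp add: lcos_lcos G.lcos_mult_one G.m_assoc)
      also have "\<dots> \<longleftrightarrow> inv c \<otimes> j \<otimes> c \<in> K"
        using cG jG by (intro lcos_stabilizer K) simp
      also have "\<dots> \<longleftrightarrow> j \<in> ?c ` K"
        using G.conjugate_conjugate[OF cG] jG subgroup.mem_carrier[OF K] by (force simp: image_iff)
      finally show ?thesis .
    qed
    have "(?c ` K, ?c ` H) \<in> \<tau>"
      using transfer_conj[OF KH\<tau>, of "inv c"] cG by simp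
    moreover have "?c ` H = H"
    proof
      show "?c ` H \<subseteq> H"
        using c(1) H by (auto intro!: subgroup.m_closed subgroup.m_inv_closed)
      show "H \<subseteq> ?c ` H"
      proof
        fix h assume h: "h \<in> H"
        then have "inv c \<otimes> h \<otimes> c \<in> H"
          using c(1) H by (intro subgroup.m_closed subgroup.m_inv_closed)
        moreover have "h = ?c (inv c \<otimes> h \<otimes> c)"
          using G.conjugate_conjugate(2)[OF cG HG[OF h]] by simp
        ultimately show "h \<in> ?c ` H" by blast
      qed
    qed
    ultimately have "(?c ` K, H) \<in> \<tau>" by simp
    then have *: "(?c ` K \<inter> J, J) \<in> \<tau>"
      using D(1) J by (intro transfer_restrict) auto
    have "subgroup (?c ` K) G"
      using G.subgroup_conjugate[OF K, of "inv c"] cG by simp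
    then have "subgroup (?c ` K \<inter> J) G"
      using D(1) by (rule G.subgroups_Inter_pair)
    moreover have "{h \<in> J. \<beta> h = i} = ?c ` K \<inter> J" using stab by blast
    ultimately have "L = ?c ` K \<inter> J"
      using L by (intro maximal_in_self) simp_all
    with * show "(L, J) \<in> \<tau>" by simp
  qed
  moreover have "x (h \<otimes> k, orbit_perm h i) = x (k, i)"
    if "h \<in> H" "k \<in> carrier G" "i \<in> {1..N}" for h k i
    using label_translate[OF that] x[OF that(2,3)] x[of "h \<otimes> k" "orbit_perm h i"]
      orbit_perm(1)[OF that(1,3)] HG[OF that(1)] that(2) by simp
  ultimately show ?thesis
    using fixed_graph_iff by blast
qed

end

lemma admissible_iff:
  "admissible Q_tau H orbit_set (\<lambda>h C. h <# C) \<longleftrightarrow> (K, H) \<in> \<tau>"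
proof
  assume "admissible Q_tau H orbit_set (\<lambda>h C. h <# C)"
  then obtain en where en: "bij_betw en {1..card orbit_set} orbit_set"
    and "fixed_points Q_tau (card orbit_set) (graph_subgroup H orbit_set (\<lambda>h C. h <# C) en) \<noteq> {}"
    by (auto simp: admissible_def)
  then show "(K, H) \<in> \<tau>"
    unfolding graph_subgroup_orbit[OF en] using transfer_if_fixed[OF en] by blast
next
  assume \<tau>: "(K, H) \<in> \<tau>"
  obtain en where en: "bij_betw en {1..card orbit_set} orbit_set"
    using ex_bij_betw_nat_finite_1[OF finite_orbit] by blast
  show "admissible Q_tau H orbit_set (\<lambda>h C. h <# C)"
    unfolding admissible_def using en fixed_if_transfer[OF en \<tau>] graph_subgroup_orbit[OF en] by auto
qed

end

lemma realizes_Q_tau: "realizes G Q_tau \<tau>"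
  unfolding realizes_def
proof (intro conjI allI impI sigma_free_Q_tau)
  fix H assume "subgroup H G"
  then show "fixed_points Q_tau 2 (H \<times> {id}) \<noteq> {}"
    using fixed_points_trivial_graph by blast
next
  fix K H assume "subgroup K G \<and> subgroup H G \<and> K \<subseteq> H"
  then have KH: "subgroup K G" "subgroup H G" "K \<subseteq> H" by simp_all
  show "admissible Q_tau H ((\<lambda>h. h <# K) ` H) (\<lambda>h C. h <# C) \<longleftrightarrow> (K, H) \<in> \<tau>"
    using admissible_iff[OF KH] unfolding orbit_set_def[OF KH] .
qed

end

section \<open>The dyadic Barratt-Eccles operad\<close>

text \<open>The words \<open>b\<^sup>i a\<close> form an infinite family of pairwise disjoint words.\<close>

definition separated_word :: "nat \<Rightarrow> (letter \<times> real) list" where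
  "separated_word i = replicate i (Lb, 1) @ [(La, 1)]"

lemma separated_word_in: "separated_word i \<in> fat_lists"
  by (auto simp: separated_word_def fat_lists_def)

lemma word_disjoint_separated:
  assumes "i \<noteq> j"
  shows "word_disjoint (map fst (separated_word i)) (map fst (separated_word j))"
proof -
  have *: "map fst (separated_word i) ! k = (if k < i then Lb else La)" if "k \<le> i" for i k
    using that by (auto simp: separated_word_def nth_append)
  have "min i j < min (length (map fst (separated_word i))) (length (map fst (separated_word j)))"
    by (simp add: separated_word_def)
  moreover have "map fst (separated_word i) ! min i j \<noteq> map fst (separated_word j) ! min i j"
    using assms by (simp only: * min.cobounded1 min.cobounded2) (auto simp: min_def)
  ultimately show ?thesis
    unfolding word_disjoint_def by blast
qed

lemma contraction_context_WD:
  assumes "group G"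
  shows "contraction_context G WD wd_scale (\<lambda>i. wd (separated_word i))"
proof (intro contraction_context.intro coinduction_context.intro coinduction_context_axioms.intro
    contraction_context_axioms.intro)
  show "group G" by fact
  show "intersection_monoid WD" by (rule intersection_monoid_WD)
  show "Hausdorff_space (mtop WD)" by (rule Hausdorff_space_WD)
  show "continuous_map (prod_topology (top_of_set {0..1}) (mtop WD)) (mtop WD) (\<lambda>(s, a). wd_scale s a)"
    by (rule continuous_map_wd_scale)
  show "wd (separated_word i) \<in> carrier WD" for i
    by (simp add: separated_word_in)
  show "i = j" if "meets WD (wd (separated_word i)) (wd (separated_word j))" for i j
  proof (rule ccontr)
    assume "i \<noteq> j"
    moreover have "reduce (separated_word k) = separated_word k" for k
      by (simp add: reduce_def separated_word_def)
    ultimately show False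
      using that word_disjoint_separated[of i j] by (simp add: meets_wd separated_word_in)
  qed
  fix a assume "a \<in> carrier WD"
  then obtain xs where xs: "xs \<in> fat_lists" "a = wd xs" by (auto simp: carrier_WD)
  show "wd_scale s a \<in> carrier WD" if "s \<in> {0..1}" for s
    using xs that by (simp add: wd_scale_wd scale_list_in_fat_lists)
  have "scale_list 0 xs \<in> fat_lists" using xs by (simp add: scale_list_in_fat_lists)
  then show "wd_scale 0 a = \<one>\<^bsub>WD\<^esub>"
    using xs by (simp add: wd_scale_wd one_WD wd_eq_iff reduce_scale_list) (simp add: reduce_def)
  show "wd_scale 1 a = a"
    using xs by (simp add: wd_scale_wd scale_list_one)
  fix b assume "b \<in> carrier WD"
  then obtain ys where ys: "ys \<in> fat_lists" "b = wd ys" by (auto simp: carrier_WD)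
  show "meets WD a b" if s: "s \<in> {0<..1}" and m: "meets WD (wd_scale s a) (wd_scale s b)" for s
  proof -
    have "s \<in> {0..1}" "s \<noteq> 0" using s by auto
    then show ?thesis
      using m xs ys by (simp add: wd_scale_wd meets_wd scale_list_in_fat_lists reduce_scale_list
          del: atLeastAtMost_iff)
  qed
qed

lemma E_infty_dyadic_Barratt_Eccles: "E_infty_operad dyadic_Barratt_Eccles"
proof -
  interpret contraction_context "singleton_group ()" WD wd_scale "\<lambda>i. wd (separated_word i)"
    by (rule contraction_context_WD) simp
  show ?thesis
    unfolding E_infty_operad_def dyadic_Barratt_Eccles_def
    using g_operad_R contractible_level_R sigma_free_R by blast
qed

theorem theorem2:
  fixes G :: "('g, 'b) monoid_scheme" and \<tau> :: "('g set \<times> 'g set) set"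
  assumes "group G" and "finite (carrier G)" and "transfer_system G \<tau>"
  shows "intersection_monoid WD \<and>
         intersection_operad dyadic_Barratt_Eccles \<and>
         E_infty_operad dyadic_Barratt_Eccles \<and>
         N_infty_operad G (incomplete_coinduction G \<tau> WD) \<and>
         realizes G (incomplete_coinduction G \<tau> WD) \<tau>"
proof -
  interpret contraction_context G WD wd_scale "\<lambda>i. wd (separated_word i)"
    using assms(1) by (rule contraction_context_WD)
  interpret realization_context G WD wd_scale "\<lambda>i. wd (separated_word i)" \<tau>
    using assms(2,3) by unfold_locales
  have "intersection_operad dyadic_Barratt_Eccles"
    unfolding intersection_operad_def dyadic_Barratt_Eccles_def using intersection_monoid_WD by blast
  then show ?thesis
    using intersection_monoid_WD E_infty_dyadic_Barratt_Eccles N_infty_operad_Q_tau realizes_Q_tau by blast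
qed

end
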